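(* Let $1<r\le d$ be fixed. For any $u\in W^{1,r}(\mathbb{T})$ and any $\alpha\in(0,\frac rd)$ there exist a negligible set $N\subset\mathbb{T}$ and a nonnegative function $g\in L^r(\mathbb{T})$ satisfying the inequalities $$\|g\|_{L^r}\le C(\alpha,r,d)\,\|Du\|_{L^r},$$ $$|u(x)-u(y)|\le|x-y|\left(g(x)+g(x)^{\alpha}g(y)^{1-\alpha}\right)\qquad\text{for any }x,y\in\mathbb{R}^d\setminus N,$$ where the constant $C(\alpha,r,d)$ depends only on $\alpha,r,d$. Moreover, we can assume $N=\emptyset$ provided we choose an appropriate representative of $u\in W^{1,r}(\mathbb{T})$, and there is a continuous selection $W^{1,r}(\mathbb{T})\ni u\mapsto g\in L^r(\mathbb{T})$.
   Context: $\mathbb{T}=\mathbb{T}^d=\mathbb{R}^d/\mathbb{Z}^d$ is the $d$-dimensional torus. Functions on $\mathbb{T}$ are identified with $\mathbb{Z}^d$-periodic functions on $\mathbb{R}^d$ and $N$ with its periodic extension; $u$ is real-valued. Negligible means of zero Lebesgue measure. The function $g$ takes values in $[0,+\infty]$, and at pairs of points where the right-hand side equals $+\infty$ the inequality is regarded as trivially satisfied. *)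

theory Defs
  imports "HOL-Analysis.Analysis"
begin

text \<open>
  Functions on the torus are \<open>\<int>\<^sup>d\<close>-periodic functions on \<^typ>\<open>real ^ 'd\<close>, with \<open>d = CARD('d)\<close>.
  Elements of \<open>L\<^sup>r\<close> and \<open>W\<^sup>1\<^sup>,\<^sup>r\<close> are represented by functions; equality of classes is
  equality almost everywhere.
\<close>

definition periodic :: "(real ^ 'd::finite \<Rightarrow> 'b) \<Rightarrow> bool" where
  "periodic f \<longleftrightarrow> (\<forall>x k. (\<forall>i. k $ i \<in> \<int>) \<longrightarrow> f (x + k) = f x)"

text \<open>The closed unit cube is a fundamental domain up to a null set.\<close>

definition torus :: "(real ^ 'd::finite) measure" where
  "torus = lebesgue_on (cbox 0 1)"

text \<open>The power \<open>x\<^sup>a\<close> on \<open>[0, \<infinity>]\<close>; only used with \<open>a > 0\<close>, where \<open>0\<^sup>a = 0\<close> and \<open>\<infinity>\<^sup>a = \<infinity>\<close>.\<close>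

definition epow :: "ennreal \<Rightarrow> real \<Rightarrow> ennreal" where
  "epow x a = (if x = \<infinity> then \<infinity> else ennreal (enn2real x powr a))"

definition eLr_norm :: "real \<Rightarrow> (real ^ 'd::finite \<Rightarrow> ennreal) \<Rightarrow> ennreal" where
  "eLr_norm r g = epow (\<integral>\<^sup>+ x. epow (g x) r \<partial>torus) (1 / r)"

definition eLr :: "real \<Rightarrow> (real ^ 'd::finite \<Rightarrow> ennreal) set" where
  "eLr r = {g. periodic g \<and> g \<in> borel_measurable torus \<and> eLr_norm r g < \<infinity>}"

definition Lr_norm :: "real \<Rightarrow> (real ^ 'd::finite \<Rightarrow> 'b::euclidean_space) \<Rightarrow> ennreal" where
  "Lr_norm r f = eLr_norm r (\<lambda>x. ennreal (norm (f x)))"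

definition Lr :: "real \<Rightarrow> (real ^ 'd::finite \<Rightarrow> 'b::euclidean_space) set" where
  "Lr r = {f. periodic f \<and> f \<in> borel_measurable torus \<and> Lr_norm r f < \<infinity>}"

definition partial :: "'d \<Rightarrow> (real ^ 'd::finite \<Rightarrow> real) \<Rightarrow> real ^ 'd \<Rightarrow> real" where
  "partial i f x = frechet_derivative f (at x) (axis i 1)"

primrec C_k :: "nat \<Rightarrow> (real ^ 'd::finite \<Rightarrow> real) \<Rightarrow> bool" where
  "C_k 0 f \<longleftrightarrow> continuous_on UNIV f"
| "C_k (Suc k) f \<longleftrightarrow> (\<forall>x. f differentiable (at x)) \<and> (\<forall>i. C_k k (partial i f))"

definition test_functions :: "(real ^ 'd::finite \<Rightarrow> real) set" where
  "test_functions = {\<phi>. periodic \<phi> \<and> (\<forall>k. C_k k \<phi>)}"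

definition is_weak_gradient :: "(real ^ 'd::finite \<Rightarrow> real) \<Rightarrow> (real ^ 'd \<Rightarrow> real ^ 'd) \<Rightarrow> bool" where
  "is_weak_gradient u V \<longleftrightarrow> periodic V \<and> integrable torus V \<and>
     (\<forall>\<phi>\<in>test_functions. \<forall>i.
        (LINT x|torus. u x * partial i \<phi> x) = - (LINT x|torus. V x $ i * \<phi> x))"

text \<open>A weak gradient is unique up to a null set, so the choice does not affect norms.\<close>

definition weak_gradient :: "(real ^ 'd::finite \<Rightarrow> real) \<Rightarrow> real ^ 'd \<Rightarrow> real ^ 'd" where
  "weak_gradient u = (SOME V. is_weak_gradient u V)"

definition W1r :: "real \<Rightarrow> (real ^ 'd::finite \<Rightarrow> real) set" where
  "W1r r = {u. u \<in> Lr r \<and> (\<exists>V. is_weak_gradient u V \<and> V \<in> Lr r)}"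

definition W1r_norm :: "real \<Rightarrow> (real ^ 'd::finite \<Rightarrow> real) \<Rightarrow> ennreal" where
  "W1r_norm r u = Lr_norm r u + Lr_norm r (weak_gradient u)"

text \<open>
  The pointwise inequality for all \<open>x, y \<in> S\<close>, evaluated in \<open>[0, \<infinity>]\<close>.  It holds trivially
  wherever the right-hand side is \<open>\<infinity>\<close>; the product of \<open>0\<close> and \<open>\<infinity>\<close> is \<open>0\<close> in \<^typ>\<open>ennreal\<close>.
\<close>

definition lusin_lipschitz ::
  "real \<Rightarrow> (real ^ 'd::finite \<Rightarrow> real) \<Rightarrow> (real ^ 'd \<Rightarrow> ennreal) \<Rightarrow> (real ^ 'd) set \<Rightarrow> bool" where
  "lusin_lipschitz \<alpha> u g S \<longleftrightarrow>
     (\<forall>x\<in>S. \<forall>y\<in>S. ennreal \<bar>u x - u y\<bar> \<le>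
        ennreal (norm (x - y)) * (g x + epow (g x) \<alpha> * epow (g y) (1 - \<alpha>)))"

text \<open>
  Continuity for the \<open>W\<^sup>1\<^sup>,\<^sup>r\<close> and \<open>L\<^sup>r\<close> seminorms.  In particular, functions equal almost everywhere
  have images equal almost everywhere, so \<open>G\<close> descends to the equivalence classes.
  Members of \<^term>\<open>eLr r\<close> are finite almost everywhere, so \<^const>\<open>enn2real\<close> changes them
  only on a null set.
\<close>

definition continuous_W1r_Lr ::
  "real \<Rightarrow> ((real ^ 'd::finite \<Rightarrow> real) \<Rightarrow> real ^ 'd \<Rightarrow> ennreal) \<Rightarrow> bool" where
  "continuous_W1r_Lr r G \<longleftrightarrow> G \<in> W1r r \<rightarrow> eLr r \<and>
     (\<forall>u\<in>W1r r. \<forall>\<epsilon>>0. \<exists>\<delta>>0. \<forall>v\<in>W1r r.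
        W1r_norm r (\<lambda>x. v x - u x) < ennreal \<delta> \<longrightarrow>
        Lr_norm r (\<lambda>x. enn2real (G v x) - enn2real (G u x)) < ennreal \<epsilon>)"

end

theory Submission
  imports Defs
begin

text \<open>
  The function \<open>g\<close> is a multiple of \<open>(M |Du|\<^sup>p)\<^sup>1\<^sup>/\<^sup>p\<close>, where \<open>\<alpha>d < p < r\<close>, \<open>p \<ge> 1\<close> and \<open>M\<close> is the
  maximal function over balls of the radii \<open>R 2\<^sup>-\<^sup>n\<close>.  The \<open>L\<^sup>r\<close> bound is the strong type \<open>(r/p, r/p)\<close>
  estimate, and \<open>g\<close> depends continuously on \<open>Du\<close> because \<open>f \<mapsto> (M f\<^sup>p)\<^sup>1\<^sup>/\<^sup>p\<close> is sublinear.

  The weak gradient controls increments: for each \<open>h\<close>, almost every \<open>x\<close> satisfies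
  \<open>u(x + h) - u(x) = \<integral>\<^sub>0\<^sup>1 Du(x + th) \<cdot> h dt\<close>.  Integrating over a ball gives a Poincare inequality,
  so the averages of \<open>u\<close> over two comparable balls contained in a ball \<open>B\<close> of radius \<open>\<rho>\<close> differ by at
  most a constant times \<open>\<rho>\<close> times the average of \<open>|Du|\<close> over \<open>B\<close>.  Telescoping along the radii
  \<open>\<rho>\<^sub>k = 2\<^sup>-\<^sup>k \<rho>\<close>, \<open>\<rho> \<approx> |x - y|\<close>, reduces \<open>|u(x) - u(y)|\<close> to the sums of \<open>\<rho>\<^sub>k\<close> times the averages
  \<open>b\<^sub>k\<close> of \<open>|Du|\<close> over the balls \<open>B(x, \<rho>\<^sub>k)\<close> and \<open>B(y, \<rho>\<^sub>k)\<close>.  At \<open>x\<close> one has \<open>b\<^sub>k \<le> m(x)\<close> with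
  \<open>m = (M |Du|\<^sup>p)\<^sup>1\<^sup>/\<^sup>p\<close>.  At \<open>y\<close> one has both \<open>b\<^sub>k \<le> m(y)\<close> and, by comparison with the ball \<open>B(x, \<rho>)\<close>,
  \<open>b\<^sub>k \<le> C 2\<^sup>k\<^sup>d\<^sup>/\<^sup>p m(x)\<close>; the geometric mean of the two bounds with weights \<open>1 - \<alpha>\<close> and \<open>\<alpha>\<close> is summable
  against \<open>\<rho>\<^sub>k\<close> because \<open>\<alpha>d < p\<close>.
\<close>


section \<open>Periodic functions and the period cell\<close>

text \<open>The inequality is wanted at every pair of points, so the representative of
  \<open>u\<close> is the limit of its ball averages, and wherever this limit is not controlled the
  right-hand side has to be infinite. That is clear if \<open>g(x)\<close> is infinite. If only
  \<open>g(y)\<close> is, the product of the powers is infinite unless \<open>g(x) = 0\<close>.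
  Taking \<open>R = 2 d\<close> lets every ball of radius \<open>R\<close> contain a period cell, so
  \<open>g(x) = 0\<close> forces \<open>Du = 0\<close> almost everywhere and then
  \<open>g = 0\<close> everywhere. The same \<open>R\<close> makes \<open>R / 2\<close> at least the
  norm of every point of the cell, so distant points can first be brought together by an integer
  translation. Each condition on \<open>p\<close> has its own task: \<open>p < r\<close> is for the
  strong type estimate, \<open>\<alpha> d < p\<close> for the summation, \<open>p \<ge> 1\<close>
  for Jensen's inequality. No smooth approximation of \<open>u\<close> is made: increments come from
  duality with test functions, and the averages converge to \<open>u\<close> almost everywhere
  because their L1 errors are summable over dyadic radii.\<close>

definition int_vecs :: "(real ^ 'd::finite) set" where
  "int_vecs = {k. \<forall>i. k $ i \<in> \<int>}"

definition unit_cell :: "(real ^ 'd::finite) set" where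
  "unit_cell = {x. \<forall>i. 0 \<le> x $ i \<and> x $ i < 1}"

text \<open>The half-open cube tiles space exactly under integer translations, the closed cube of
  \<open>torus\<close> only up to null sets. Restricting \<open>lborel\<close> rather than
  \<open>lebesgue\<close> keeps joint Borel measurability available for Fubini.\<close>

definition cell :: "(real ^ 'd::finite) measure" where
  "cell = restrict_space lborel unit_cell"

definition frac_vec :: "real ^ 'd::finite \<Rightarrow> real ^ 'd" where
  "frac_vec x = (\<chi> i. frac (x $ i))"

lemma countable_int_vecs: "countable (int_vecs :: (real ^ 'd::finite) set)"
proof -
  have "int_vecs \<subseteq> range (\<lambda>f :: 'd \<Rightarrow> int. \<chi> i. of_int (f i))"
  proof
    fix k :: "real ^ 'd" assume "k \<in> int_vecs"
    then have "k = (\<chi> i. of_int \<lfloor>k $ i\<rfloor>)"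
      by (auto simp: int_vecs_def vec_eq_iff)
    then show "k \<in> range (\<lambda>f :: 'd \<Rightarrow> int. \<chi> i. of_int (f i))" by (metis rangeI)
  qed
  then show ?thesis by (rule countable_subset) simp
qed

lemma int_vecs_minus: "k \<in> int_vecs \<Longrightarrow> - k \<in> int_vecs"
  by (simp add: int_vecs_def)

lemma frac_vec_in_unit_cell: "frac_vec x \<in> unit_cell"
  by (simp add: frac_vec_def unit_cell_def frac_lt_1)

lemma diff_frac_vec_in_int_vecs: "x - frac_vec x \<in> int_vecs"
  by (simp add: frac_vec_def int_vecs_def frac_def)

lemma unit_cell_translate_iff:
  assumes "k \<in> int_vecs" shows "x - k \<in> unit_cell \<longleftrightarrow> k = x - frac_vec x"
proof
  assume *: "x - k \<in> unit_cell"
  { fix i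
    have "k $ i \<in> \<int>" "0 \<le> x $ i - k $ i" "x $ i - k $ i < 1"
      using assms * by (auto simp: int_vecs_def unit_cell_def)
    then have "frac (x $ i) = x $ i - k $ i" by (simp add: frac_unique_iff) }
  then show "k = x - frac_vec x" by (simp add: vec_eq_iff frac_vec_def)
next
  assume "k = x - frac_vec x"
  then show "x - k \<in> unit_cell" using frac_vec_in_unit_cell[of x] by simp
qed

lemma frac_vec_of_unit_cell: "x \<in> unit_cell \<Longrightarrow> frac_vec x = x"
  by (auto simp: vec_eq_iff frac_vec_def unit_cell_def frac_eq)

lemma frac_vec_translate: "k \<in> int_vecs \<Longrightarrow> frac_vec (x + k) = frac_vec x"
  by (auto simp: frac_vec_def int_vecs_def vec_eq_iff frac_def elim!: Ints_cases)

lemma periodicD: "periodic f \<Longrightarrow> k \<in> int_vecs \<Longrightarrow> f (x + k) = f x"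
  by (auto simp: periodic_def int_vecs_def)

lemma periodic_iff: "periodic f \<longleftrightarrow> (\<forall>x. \<forall>k\<in>int_vecs. f (x + k) = f x)"
  by (auto simp: periodic_def int_vecs_def)

lemma periodic_frac_vec: "periodic f \<Longrightarrow> f (frac_vec x) = f x"
  using periodicD[OF _ diff_frac_vec_in_int_vecs, of f "frac_vec x" x] by simp

lemma periodic_comp_frac_vec: "periodic (\<lambda>x. f (frac_vec x))"
  by (auto simp: periodic_iff frac_vec_translate)

lemma periodic_translate:
  fixes f :: "real ^ 'd::finite \<Rightarrow> 'b"
  assumes "periodic f" shows "periodic (\<lambda>x. f (x + a))"
proof -
  have "x + k + a = x + a + k" for x k :: "real ^ 'd" by (simp add: algebra_simps)
  then show ?thesis using assms unfolding periodic_iff by metis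
qed

lemma periodic_comp: "periodic f \<Longrightarrow> periodic (\<lambda>x. g (f x))"
  by (simp add: periodic_def)

lemma periodic_comp2: "periodic f \<Longrightarrow> periodic h \<Longrightarrow> periodic (\<lambda>x. g (f x) (h x))"
  by (simp add: periodic_def)

lemma unit_cell_borel [measurable]: "unit_cell \<in> sets borel"
proof -
  have eq: "unit_cell = (\<Inter>i. {x :: real ^ 'd. 0 \<le> x $ i} \<inter> {x. x $ i < 1})"
    by (auto simp: unit_cell_def)
  have "closed {x :: real ^ 'd. 0 \<le> x $ i}" "open {x :: real ^ 'd. x $ i < 1}" for i
    by (intro closed_Collect_le open_Collect_less continuous_intros)+
  then show ?thesis unfolding eq
    by (intro sets.countable_INT'' sets.Int borel_closed borel_open) auto
qed

lemma frac_vec_measurable [measurable]: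
  "(frac_vec :: real ^ 'd::finite \<Rightarrow> real ^ 'd) \<in> borel_measurable borel"
proof -
  have "(\<lambda>x :: real ^ 'd. frac_vec x \<bullet> i) \<in> borel_measurable borel" if i: "i \<in> Basis" for i
  proof -
    obtain j where j: "i = axis j 1" using i by (auto simp: Basis_vec_def)
    have "frac_vec x \<bullet> i = x \<bullet> i - of_int \<lfloor>x \<bullet> i\<rfloor>" for x :: "real ^ 'd"
      by (simp add: j inner_axis frac_vec_def frac_def)
    then show ?thesis by simp
  qed
  then show ?thesis by (subst borel_measurable_euclidean_space) auto
qed

section \<open>Measure and integrals over the period cell\<close>

lemma cbox_minus_unit_cell_null:
  "cbox 0 1 - unit_cell \<in> null_sets (lborel :: (real ^ 'd::finite) measure)"
proof -
  have sub: "cbox 0 1 - unit_cell \<subseteq> cbox 0 (1 :: real ^ 'd) - box 0 1"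
    by (auto simp: mem_box_cart unit_cell_def less_imp_le)
  have "negligible (cbox 0 (1 :: real ^ 'd) - box 0 1)"
    using negligible_frontier_interval by blast
  then have "negligible (cbox 0 (1 :: real ^ 'd) - unit_cell)"
    using sub negligible_subset by blast
  then have "cbox 0 (1 :: real ^ 'd) - unit_cell \<in> null_sets lebesgue"
    by (simp add: negligible_iff_null_sets)
  moreover have "cbox 0 (1 :: real ^ 'd) - unit_cell \<in> sets lborel" by measurable
  ultimately show ?thesis by (simp add: null_sets_completion_iff)
qed

lemma unit_cell_subset_cbox: "unit_cell \<subseteq> cbox 0 1"
  by (auto simp: unit_cell_def mem_box_cart less_imp_le)

lemma indicator_cbox_AE:
  "AE x in lborel. (indicator (cbox 0 1) x :: 'b::zero_neq_one) = indicator unit_cell (x :: real ^ 'd::finite)"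
  using AE_not_in[OF cbox_minus_unit_cell_null] unit_cell_subset_cbox
  by (auto simp: indicator_def elim!: eventually_mono)

lemma emeasure_unit_cell: "emeasure lborel (unit_cell :: (real ^ 'd::finite) set) = 1"
proof -
  have "emeasure lborel (unit_cell :: (real ^ 'd::finite) set) = (\<integral>\<^sup>+x. indicator (unit_cell :: (real ^ 'd::finite) set) x \<partial>lborel)"
    by simp
  also have "\<dots> = (\<integral>\<^sup>+x. indicator (cbox 0 (1 :: real ^ 'd)) x \<partial>lborel)"
    by (intro nn_integral_cong_AE) (rule eventually_mono[OF indicator_cbox_AE[where 'b=ennreal]], simp)
  also have "\<dots> = emeasure lborel (cbox 0 (1 :: real ^ 'd))" by simp
  also have "\<dots> = 1"
  proof -
    have "(\<Prod>b\<in>Basis. (1 :: real ^ 'd) \<bullet> b) = 1"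
      by (intro prod.neutral) (auto simp: Basis_vec_def inner_axis)
    then show ?thesis
      by (subst emeasure_lborel_cbox) (auto simp: Basis_vec_def inner_axis)
  qed
  finally show ?thesis .
qed

lemma space_cell [simp]: "space cell = unit_cell"
  by (simp add: cell_def space_restrict_space)


lemma measurable_cell [measurable (raw)]:
  "f \<in> borel \<rightarrow>\<^sub>M M \<Longrightarrow> f \<in> cell \<rightarrow>\<^sub>M M"
  by (simp add: cell_def measurable_restrict_space1)

lemma measurable_ident_cell: "(\<lambda>x. x) \<in> borel_measurable cell"
  by (rule measurable_cell) simp

text \<open>Lets joint measurability be checked over \<open>borel\<close> and then moved to products
  of \<open>cell\<close>, \<open>uint\<close> and \<open>lborel\<close>.\<close>

lemma measurable_pair_borel:
  assumes f: "f \<in> borel \<Otimes>\<^sub>M borel \<rightarrow>\<^sub>M N"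
    and A: "(\<lambda>x. x) \<in> A \<rightarrow>\<^sub>M borel" and B: "(\<lambda>x. x) \<in> B \<rightarrow>\<^sub>M borel"
  shows "f \<in> A \<Otimes>\<^sub>M B \<rightarrow>\<^sub>M N"
proof -
  have "(\<lambda>p. (fst p, snd p)) \<in> A \<Otimes>\<^sub>M B \<rightarrow>\<^sub>M borel \<Otimes>\<^sub>M borel"
    by (intro measurable_Pair measurable_compose[OF measurable_fst A] measurable_compose[OF measurable_snd B])
  from measurable_compose[OF this f] show ?thesis by simp
qed

lemma finite_measure_cell: "finite_measure (cell :: (real ^ 'd::finite) measure)"
  by (intro finite_measureI) (simp add: cell_def emeasure_restrict_space emeasure_unit_cell)

interpretation cell: finite_measure "cell :: (real ^ 'd::finite) measure"
  by (rule finite_measure_cell)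

lemma nn_integral_cell:
  "(\<integral>\<^sup>+x. F x \<partial>cell) = (\<integral>\<^sup>+x. F x * indicator unit_cell x \<partial>lborel)"
  by (simp add: cell_def nn_integral_restrict_space)

lemma nn_integral_torus: "(\<integral>\<^sup>+x. F x \<partial>torus) = (\<integral>\<^sup>+x. F x \<partial>cell)"
proof -
  have "(\<integral>\<^sup>+x. F x \<partial>torus) = (\<integral>\<^sup>+x. F x * indicator (cbox 0 1) x \<partial>lborel)"
    unfolding torus_def by (subst nn_integral_restrict_space) (auto simp: nn_integral_completion)
  also have "\<dots> = (\<integral>\<^sup>+x. F x * indicator unit_cell x \<partial>lborel)"
    by (intro nn_integral_cong_AE) (rule eventually_mono[OF indicator_cbox_AE[where 'b=ennreal]], simp)
  finally show ?thesis by (simp add: nn_integral_cell)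
qed

lemma integral_torus:
  fixes F :: "real ^ 'd::finite \<Rightarrow> 'b::{banach, second_countable_topology}"
  assumes [measurable]: "F \<in> borel_measurable borel"
  shows "(LINT x|torus. F x) = (LINT x|cell. F x)"
proof -
  have "(LINT x|torus. F x) = (LINT x|lborel. indicator (cbox 0 1) x *\<^sub>R F x)"
    unfolding torus_def by (subst integral_restrict_space) (auto simp: integral_completion)
  also have "\<dots> = (LINT x|lborel. indicator unit_cell x *\<^sub>R F x)"
    by (intro integral_cong_AE) (use indicator_cbox_AE[where 'b=real] in \<open>auto elim!: eventually_mono\<close>)
  finally show ?thesis by (simp add: cell_def integral_restrict_space)
qed

lemma measurable_torus [measurable (raw)]:
  "f \<in> borel_measurable borel \<Longrightarrow> f \<in> borel_measurable torus"
  unfolding torus_def by (intro measurable_restrict_space1 measurable_completion) simp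

lemma integrable_torus:
  fixes F :: "real ^ 'd::finite \<Rightarrow> 'b::{banach, second_countable_topology}"
  assumes "F \<in> borel_measurable borel"
  shows "integrable torus F \<longleftrightarrow> integrable cell F"
  using assms by (simp add: integrable_iff_bounded nn_integral_torus measurable_torus measurable_cell)

lemma nn_integral_translate:
  fixes F :: "'a::euclidean_space \<Rightarrow> ennreal"
  assumes [measurable]: "F \<in> borel_measurable borel"
  shows "(\<integral>\<^sup>+x. F (x + a) \<partial>lborel) = (\<integral>\<^sup>+x. F x \<partial>lborel)"
proof -
  have "(\<integral>\<^sup>+x. F x \<partial>lborel) = (\<integral>\<^sup>+x. F x \<partial>distr lborel borel ((+) a))"
    by (simp add: lborel_distr_plus)
  also have "\<dots> = (\<integral>\<^sup>+x. F (x + a) \<partial>lborel)"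
    by (subst nn_integral_distr) (auto simp: add.commute)
  finally show ?thesis by simp
qed

text \<open>The translates of the cell partition space: only \<open>k = x - frac_vec x\<close>
  contributes.\<close>

lemma nn_integral_int_vecs_indicator:
  "(\<integral>\<^sup>+k. c * indicator unit_cell (x - k) \<partial>count_space int_vecs) = c"
proof -
  have "(\<integral>\<^sup>+k. c * indicator unit_cell (x - k) \<partial>count_space int_vecs)
     = (\<Sum>k\<in>{x - frac_vec x}. c * indicator unit_cell (x - k))"
    by (rule nn_integral_count_space')
       (auto simp: diff_frac_vec_in_int_vecs unit_cell_translate_iff)
  then show ?thesis by (simp add: frac_vec_in_unit_cell)
qed

text \<open>Insert the partition into translated cells, exchange sum and integral, and translate
  each piece back to the cell.\<close>

lemma nn_integral_lborel_cell:
  fixes F :: "real ^ 'd::finite \<Rightarrow> ennreal"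
  assumes [measurable]: "F \<in> borel_measurable borel"
  shows "(\<integral>\<^sup>+x. F x \<partial>lborel) = (\<integral>\<^sup>+x. (\<integral>\<^sup>+k. F (x + k) \<partial>count_space int_vecs) \<partial>cell)"
proof -
  have "(\<integral>\<^sup>+x. F x \<partial>lborel) = (\<integral>\<^sup>+x. (\<integral>\<^sup>+k. F x * indicator unit_cell (x - k) \<partial>count_space int_vecs) \<partial>lborel)"
    by (simp add: nn_integral_int_vecs_indicator)
  also have "\<dots> = (\<integral>\<^sup>+k. (\<integral>\<^sup>+x. F x * indicator unit_cell (x - k) \<partial>lborel) \<partial>count_space int_vecs)"
    by (intro nn_integral_count_space_nn_integral countable_int_vecs) auto
  also have "\<dots> = (\<integral>\<^sup>+k. (\<integral>\<^sup>+x. F (x + k) * indicator unit_cell x \<partial>lborel) \<partial>count_space int_vecs)"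
  proof (rule nn_integral_cong)
    fix k :: "real ^ 'd"
    show "(\<integral>\<^sup>+x. F x * indicator unit_cell (x - k) \<partial>lborel) = (\<integral>\<^sup>+x. F (x + k) * indicator unit_cell x \<partial>lborel)"
      using nn_integral_translate[of "\<lambda>x. F x * indicator unit_cell (x - k)" k] by simp
  qed
  also have "\<dots> = (\<integral>\<^sup>+x. (\<integral>\<^sup>+k. F (x + k) * indicator unit_cell x \<partial>count_space int_vecs) \<partial>lborel)"
    by (intro nn_integral_count_space_nn_integral[symmetric] countable_int_vecs) auto
  also have "\<dots> = (\<integral>\<^sup>+x. (\<integral>\<^sup>+k. F (x + k) \<partial>count_space int_vecs) * indicator unit_cell x \<partial>lborel)"
    by (intro nn_integral_cong nn_integral_multc) auto
  finally show ?thesis by (simp add: nn_integral_cell)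
qed

text \<open>The left side is an integral over the shifted cell. Folding it back multiplies
  \<open>F x\<close> by the number of integer translates of \<open>x\<close> in the shifted cell,
  which is one.\<close>

lemma nn_integral_cell_translate:
  fixes F :: "real ^ 'd::finite \<Rightarrow> ennreal"
  assumes [measurable]: "F \<in> borel_measurable borel" and per: "periodic F"
  shows "(\<integral>\<^sup>+x. F (x + h) \<partial>cell) = (\<integral>\<^sup>+x. F x \<partial>cell)"
proof -
  have "(\<integral>\<^sup>+x. F (x + h) \<partial>cell) = (\<integral>\<^sup>+x. F x * indicator unit_cell (x - h) \<partial>lborel)"
    unfolding nn_integral_cell
    using nn_integral_translate[of "\<lambda>x. F x * indicator unit_cell (x - h)" h] by simp
  also have "\<dots> = (\<integral>\<^sup>+x. (\<integral>\<^sup>+k. F (x + k) * indicator unit_cell (x + k - h) \<partial>count_space int_vecs) \<partial>cell)"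
    by (subst nn_integral_lborel_cell) auto
  also have "\<dots> = (\<integral>\<^sup>+x. F x \<partial>cell)"
  proof (rule nn_integral_cong)
    fix x :: "real ^ 'd"
    have bij: "bij_betw uminus (int_vecs :: (real ^ 'd) set) int_vecs"
      by (rule bij_betwI[where g=uminus]) (auto simp: int_vecs_minus)
    have "(\<integral>\<^sup>+k. F x * indicator unit_cell (x - h - k) \<partial>count_space int_vecs)
       = (\<integral>\<^sup>+k. F x * indicator unit_cell (x - h - - k) \<partial>count_space int_vecs)"
      by (rule nn_integral_bij_count_space[OF bij, symmetric])
    also have "\<dots> = (\<integral>\<^sup>+k. F (x + k) * indicator unit_cell (x + k - h) \<partial>count_space int_vecs)"
      by (rule nn_integral_cong) (auto simp: periodicD[OF per] diff_add_eq)
    finally have "(\<integral>\<^sup>+k. F (x + k) * indicator unit_cell (x + k - h) \<partial>count_space int_vecs)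
       = (\<integral>\<^sup>+k. F x * indicator unit_cell (x - h - k) \<partial>count_space int_vecs)" ..
    then show "(\<integral>\<^sup>+k. F (x + k) * indicator unit_cell (x + k - h) \<partial>count_space int_vecs) = F x"
      by (simp add: nn_integral_int_vecs_indicator)
  qed
  finally show ?thesis .
qed

text \<open>Translation modulo the integer lattice preserves the measure. The form with
  \<open>distr\<close> carries over to Bochner integrals and integrability at once.\<close>

lemma distr_cell_translate:
  fixes h :: "real ^ 'd::finite"
  shows "distr cell borel (\<lambda>x. frac_vec (x + h)) = distr cell borel frac_vec"
proof (rule measure_eqI)
  fix A :: "(real ^ 'd) set" assume "A \<in> sets (distr cell borel (\<lambda>x. frac_vec (x + h)))"
  then have [measurable]: "A \<in> sets borel" by simp
  have [measurable]: "(\<lambda>x. indicator A (frac_vec x) :: ennreal) \<in> borel_measurable borel" by simp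
  have "emeasure (distr cell borel (\<lambda>x. frac_vec (x + h))) A = (\<integral>\<^sup>+x. indicator A x \<partial>distr cell borel (\<lambda>x. frac_vec (x + h)))"
    by simp
  also have "\<dots> = (\<integral>\<^sup>+x. indicator A (frac_vec (x + h)) \<partial>cell)"
    by (subst nn_integral_distr) auto
  also have "\<dots> = (\<integral>\<^sup>+x. indicator A (frac_vec x) \<partial>cell)"
    by (rule nn_integral_cell_translate) (auto simp: periodic_comp_frac_vec)
  also have "\<dots> = (\<integral>\<^sup>+x. indicator A x \<partial>distr cell borel frac_vec)"
    by (subst nn_integral_distr) auto
  finally show "emeasure (distr cell borel (\<lambda>x. frac_vec (x + h))) A = emeasure (distr cell borel frac_vec) A"
    by simp
qed simp

lemma
  fixes F :: "real ^ 'd::finite \<Rightarrow> 'b::{banach, second_countable_topology}"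
  assumes F [measurable]: "F \<in> borel_measurable borel" and per: "periodic F"
  shows integral_cell_translate: "(LINT x|cell. F (x + h)) = (LINT x|cell. F x)"
    and integrable_cell_translate: "integrable cell (\<lambda>x. F (x + h)) \<longleftrightarrow> integrable cell F"
proof -
  have [measurable]: "(\<lambda>x. frac_vec (x + h)) \<in> borel_measurable cell" "frac_vec \<in> borel_measurable cell"
    by measurable
  have "(LINT x|cell. F (x + h)) = (LINT x|distr cell borel (\<lambda>x. frac_vec (x + h)). F x)"
    by (subst integral_distr) (auto simp: periodic_frac_vec[OF per])
  also have "\<dots> = (LINT x|cell. F x)"
    unfolding distr_cell_translate by (subst integral_distr) (auto simp: periodic_frac_vec[OF per])
  finally show "(LINT x|cell. F (x + h)) = (LINT x|cell. F x)" .
  have "integrable cell (\<lambda>x. F (x + h)) \<longleftrightarrow> integrable (distr cell borel (\<lambda>x. frac_vec (x + h))) F"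
    by (subst integrable_distr_eq) (auto simp: periodic_frac_vec[OF per])
  also have "\<dots> \<longleftrightarrow> integrable cell F"
    unfolding distr_cell_translate by (subst integrable_distr_eq) (auto simp: periodic_frac_vec[OF per])
  finally show "integrable cell (\<lambda>x. F (x + h)) \<longleftrightarrow> integrable cell F" .
qed

lemma AE_cell_iff: "(AE x in cell. P x) \<longleftrightarrow> (AE x in lborel. x \<in> unit_cell \<longrightarrow> P x)"
  unfolding cell_def by (rule AE_restrict_space_iff) simp

lemma AE_torus_iff: "(AE x in torus. P x) \<longleftrightarrow> (AE x in cell. P x)"
proof -
  have "(AE x in torus. P x) \<longleftrightarrow> (AE x in lborel. x \<in> cbox 0 1 \<longrightarrow> P x)"
    unfolding torus_def by (subst AE_restrict_space_iff) (auto simp: AE_completion_iff)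
  also have "\<dots> \<longleftrightarrow> (AE x in lborel. x \<in> unit_cell \<longrightarrow> P x)"
  proof (intro iffI)
    assume "AE x in lborel. x \<in> cbox 0 1 \<longrightarrow> P x"
    then show "AE x in lborel. x \<in> unit_cell \<longrightarrow> P x"
      by (rule eventually_mono) (use unit_cell_subset_cbox in blast)
  next
    assume "AE x in lborel. x \<in> unit_cell \<longrightarrow> P x"
    with AE_not_in[OF cbox_minus_unit_cell_null] show "AE x in lborel. x \<in> cbox 0 1 \<longrightarrow> P x"
      by eventually_elim auto
  qed
  finally show ?thesis by (simp add: AE_cell_iff)
qed

lemma AE_translate:
  fixes P :: "'a::euclidean_space \<Rightarrow> bool"
  assumes "AE x in lborel. P x" shows "AE x in lborel. P (x + a)"
proof -
  have "AE x in distr lborel borel ((+) a). P x" using assms unfolding lborel_distr_plus .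
  then have "AE x in lborel. P (a + x)" by (rule AE_distrD[rotated]) simp
  then show ?thesis by (simp add: add.commute)
qed

text \<open>A null exceptional set in the cell has only countably many integer translates.\<close>

lemma AE_cell_periodic:
  assumes "periodic P" shows "(AE x in cell. P x) \<longleftrightarrow> (AE x in lborel. P x)"
proof
  assume "AE x in cell. P x"
  then have *: "AE x in lborel. x \<in> unit_cell \<longrightarrow> P x" by (simp add: AE_cell_iff)
  have "AE x in lborel. \<forall>k\<in>int_vecs. x + k \<in> unit_cell \<longrightarrow> P (x + k)"
    by (subst AE_ball_countable) (auto intro: AE_translate[OF *] simp: countable_int_vecs)
  then show "AE x in lborel. P x"
  proof (rule eventually_mono)
    fix x assume "\<forall>k\<in>int_vecs. x + k \<in> unit_cell \<longrightarrow> P (x + k)"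
    then have "x + - (x - frac_vec x) \<in> unit_cell \<longrightarrow> P (x + - (x - frac_vec x))"
      using int_vecs_minus[OF diff_frac_vec_in_int_vecs] by blast
    then show "P x" using frac_vec_in_unit_cell periodic_frac_vec[OF assms] by auto
  qed
qed (auto simp: AE_cell_iff elim: eventually_mono)

text \<open>\<open>n\<close> counts finitely many cells that cover \<open>S\<close>; it is fixed
  before \<open>F\<close>, so the bound is uniform in \<open>F\<close>.\<close>

lemma nn_integral_bounded_le_cell:
  fixes S :: "(real ^ 'd::finite) set"
  assumes "bounded S"
  obtains n :: nat where "\<And>F :: real ^ 'd \<Rightarrow> ennreal. F \<in> borel_measurable borel \<Longrightarrow> periodic F \<Longrightarrow>
     (\<integral>\<^sup>+x. F x * indicator S x \<partial>lborel) \<le> of_nat n * (\<integral>\<^sup>+x. F x \<partial>cell)"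
proof -
  obtain B where B: "\<And>x. x \<in> S \<Longrightarrow> norm x \<le> B" using assms by (auto simp: bounded_iff)
  define m where "m = (\<lceil>B\<rceil> + 1 :: int)"
  define K where "K = (\<lambda>f :: 'd \<Rightarrow> int. \<chi> i. real_of_int (f i)) ` (UNIV \<rightarrow>\<^sub>E {-m..m})"
  have finK: "finite K" unfolding K_def by (intro finite_imageI finite_PiE) auto
  have sub: "x - frac_vec x \<in> K" if "x \<in> S" for x
  proof -
    have "x - frac_vec x = (\<chi> i. real_of_int \<lfloor>x $ i\<rfloor>)" by (simp add: vec_eq_iff frac_vec_def frac_def)
    moreover have "\<lfloor>x $ i\<rfloor> \<in> {-m..m}" for i
    proof -
      have "\<bar>x $ i\<bar> \<le> B" using B[OF that] component_le_norm_cart[of x i] by linarith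
      then show ?thesis unfolding m_def by simp linarith
    qed
    ultimately show ?thesis unfolding K_def by auto
  qed
  have KZ: "K \<subseteq> int_vecs" by (auto simp: K_def int_vecs_def)
  show ?thesis
  proof (rule that[of "card K"])
    fix F :: "real ^ 'd \<Rightarrow> ennreal"
    assume [measurable]: "F \<in> borel_measurable borel" and per: "periodic F"
    have "(\<integral>\<^sup>+x. F x * indicator S x \<partial>lborel) \<le> (\<integral>\<^sup>+x. (\<Sum>k\<in>K. F x * indicator unit_cell (x - k)) \<partial>lborel)"
    proof (rule nn_integral_mono)
      fix x
      show "F x * indicator S x \<le> (\<Sum>k\<in>K. F x * indicator unit_cell (x - k))"
      proof (cases "x \<in> S")
        case True
        have "F x * indicator unit_cell (x - (x - frac_vec x)) \<le> (\<Sum>k\<in>K. F x * indicator unit_cell (x - k))"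
          by (rule member_le_sum[OF sub[OF True]]) (auto simp: finK)
        then show ?thesis using True by (simp add: frac_vec_in_unit_cell)
      qed simp
    qed
    also have "\<dots> = (\<Sum>k\<in>K. \<integral>\<^sup>+x. F x * indicator unit_cell (x - k) \<partial>lborel)"
      by (rule nn_integral_sum) simp
    also have "\<dots> = (\<Sum>k\<in>K. \<integral>\<^sup>+x. F x \<partial>cell)"
    proof (rule sum.cong)
      fix k assume k: "k \<in> K"
      have "(\<integral>\<^sup>+x. F x * indicator unit_cell (x - k) \<partial>lborel) = (\<integral>\<^sup>+x. F (x + k) * indicator unit_cell x \<partial>lborel)"
        using nn_integral_translate[of "\<lambda>x. F x * indicator unit_cell (x - k)" k] by simp
      then show "(\<integral>\<^sup>+x. F x * indicator unit_cell (x - k) \<partial>lborel) = (\<integral>\<^sup>+x. F x \<partial>cell)"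
        using k KZ periodicD[OF per] by (auto simp: nn_integral_cell)
    qed simp
    finally show "(\<integral>\<^sup>+x. F x * indicator S x \<partial>lborel) \<le> of_nat (card K) * (\<integral>\<^sup>+x. F x \<partial>cell)" by simp
  qed
qed

text \<open>The completion yields a Borel function that agrees with \<open>f\<close> almost
  everywhere on the cube but need not be periodic. Composing it with \<open>frac_vec\<close>
  restores exact periodicity.\<close>

lemma periodic_borel_version_real:
  fixes f :: "real ^ 'd::finite \<Rightarrow> real"
  assumes "f \<in> borel_measurable torus" "periodic f"
  obtains f' where "f' \<in> borel_measurable borel" "periodic f'" "AE x in lborel. f x = f' x"
proof -
  have "(\<lambda>x. indicator (cbox 0 1) x *\<^sub>R f x) \<in> borel_measurable lebesgue"
    using assms(1) unfolding torus_def by (subst (asm) borel_measurable_restrict_space_iff) auto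
  then obtain g where [measurable]: "g \<in> borel_measurable lborel"
    and g: "AE x in lborel. indicator (cbox 0 1) x *\<^sub>R f x = g x"
    using completion_ex_borel_measurable_real by blast
  have "AE x in cell. f x = g (frac_vec x)"
    unfolding AE_cell_iff using g
    by (rule eventually_mono) (use unit_cell_subset_cbox in \<open>auto simp: frac_vec_of_unit_cell\<close>)
  then have "AE x in lborel. f x = g (frac_vec x)"
    by (subst (asm) AE_cell_periodic) (rule periodic_comp2[OF assms(2) periodic_comp_frac_vec], assumption)
  moreover have "(\<lambda>x. g (frac_vec x)) \<in> borel_measurable borel" by measurable
  ultimately show ?thesis by (rule that[OF _ periodic_comp_frac_vec, rotated])
qed

lemma periodic_borel_version_vec:
  fixes f :: "real ^ 'd::finite \<Rightarrow> real ^ 'd"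
  assumes "f \<in> borel_measurable torus" "periodic f"
  obtains f' where "f' \<in> borel_measurable borel" "periodic f'" "AE x in lborel. f x = f' x"
proof -
  have m: "(\<lambda>x. f x $ i) \<in> borel_measurable torus" for i
    using assms(1) borel_measurable_inner[OF assms(1) borel_measurable_const, of "axis i 1"]
    by (simp add: inner_axis)
  have "\<forall>i. \<exists>g. g \<in> borel_measurable borel \<and> periodic g \<and> (AE x in lborel. f x $ i = g x)"
  proof
    fix i
    show "\<exists>g. g \<in> borel_measurable borel \<and> periodic g \<and> (AE x in lborel. f x $ i = g x)"
      by (rule periodic_borel_version_real[OF m[of i] periodic_comp[OF assms(2)]]) blast
  qed
  from choice[OF this] obtain g where gg: "\<forall>i. g i \<in> borel_measurable borel \<and> periodic (g i) \<and>
    (AE x in lborel. f x $ i = g i x)" ..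
  have g: "\<And>i. g i \<in> borel_measurable borel" "\<And>i. periodic (g i)"
    "\<And>i. AE x in lborel. f x $ i = g i x" using gg by blast+
  define f' where "f' = (\<lambda>x. \<chi> i. g i x)"
  have "f' \<in> borel_measurable borel"
    by (subst borel_measurable_euclidean_space) (auto simp: Basis_vec_def inner_axis f'_def g)
  moreover have "periodic f'" using g(2) by (auto simp: periodic_def f'_def vec_eq_iff)
  moreover have "AE x in lborel. f x = f' x"
  proof -
    have "AE x in lborel. \<forall>i\<in>UNIV. f x $ i = g i x"
      by (rule AE_finite_allI) (auto simp: g(3))
    then show ?thesis by (rule eventually_mono) (auto simp: vec_eq_iff f'_def)
  qed
  ultimately show ?thesis using that by blast
qed

section \<open>Periodic test functions and weak gradients\<close>

definition sigmoid :: "real \<Rightarrow> real" where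
  "sigmoid s = 1 / (1 + exp (- s))"

lemma sigmoid_pos: "0 < sigmoid s" and sigmoid_le_1: "sigmoid s \<le> 1"
  by (auto simp: sigmoid_def add_pos_pos)

lemma DERIV_sigmoid: "(sigmoid has_real_derivative sigmoid s * (1 - sigmoid s)) (at s)"
proof -
  have ne: "1 + exp (- s) \<noteq> 0" by (smt (verit) exp_gt_zero)
  have "((\<lambda>s. 1 / (1 + exp (- s))) has_real_derivative exp (- s) / (1 + exp (- s))\<^sup>2) (at s)"
    using ne by (auto intro!: derivative_eq_intros simp: power2_eq_square)
  moreover have "exp (- s) / (1 + exp (- s))\<^sup>2 = sigmoid s * (1 - sigmoid s)"
    using ne by (simp add: sigmoid_def power2_eq_square field_simps)
  ultimately show ?thesis by (simp add: sigmoid_def [abs_def])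
qed

lemma sigmoid_at_top: "((\<lambda>n. sigmoid (real n * c)) \<longlonglongrightarrow> 1)" if "c > 0"
proof -
  have "filterlim (\<lambda>n. real n * c) at_top sequentially"
    using that by (intro filterlim_at_top_mult_tendsto_pos[OF tendsto_const that]
        filterlim_real_sequentially)
  then have "((\<lambda>n. exp (- (real n * c))) \<longlonglongrightarrow> 0)"
    by (intro filterlim_compose[OF exp_at_bot]) (simp add: filterlim_uminus_at_bot)
  then have "((\<lambda>n. 1 / (1 + exp (- (real n * c)))) \<longlonglongrightarrow> 1 / (1 + 0))"
    by (intro tendsto_intros) auto
  then show ?thesis by (simp add: sigmoid_def)
qed

lemma sigmoid_at_bot: "((\<lambda>n. sigmoid (real n * c)) \<longlonglongrightarrow> 0)" if "c < 0"
proof -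
  have "sigmoid (real n * c) = 1 - sigmoid (real n * - c)" for n
  proof -
    have "exp (real n * c) * exp (- (real n * c)) = 1" by (simp add: exp_add[symmetric])
    moreover have "1 + exp (real n * c) \<noteq> 0" "1 + exp (- (real n * c)) \<noteq> 0"
      by (smt (verit) exp_gt_zero)+
    ultimately show ?thesis by (simp add: sigmoid_def field_simps)
  qed
  then show ?thesis using tendsto_diff[OF tendsto_const sigmoid_at_top[of "- c"], of 1] that by simp
qed

text \<open>An algebra of smooth periodic functions that is closed under partial derivatives because
  the sigmoid satisfies \<open>s' = s (1 - s)\<close>, and that still contains sharp approximations of
  indicator functions of intervals.\<close>

inductive smooth_alg :: "(real ^ 'd::finite \<Rightarrow> real) \<Rightarrow> bool" where
  const: "smooth_alg (\<lambda>x. c)"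
| cos: "smooth_alg (\<lambda>x. cos (2 * pi * x $ i + a))"
| sigmoid: "smooth_alg (\<lambda>x. sigmoid (s * (cos (2 * pi * x $ i + a) - b)))"
| add: "smooth_alg f \<Longrightarrow> smooth_alg g \<Longrightarrow> smooth_alg (\<lambda>x. f x + g x)"
| mult: "smooth_alg f \<Longrightarrow> smooth_alg g \<Longrightarrow> smooth_alg (\<lambda>x. f x * g x)"

lemma smooth_alg_one_minus: "smooth_alg f \<Longrightarrow> smooth_alg (\<lambda>x. 1 - f x)"
  using smooth_alg.add[OF smooth_alg.const smooth_alg.mult[OF smooth_alg.const], of f 1 "- 1"] by simp

lemma smooth_alg_prod:
  "finite A \<Longrightarrow> (\<And>i. i \<in> A \<Longrightarrow> smooth_alg (f i)) \<Longrightarrow> smooth_alg (\<lambda>x. \<Prod>i\<in>A. f i x)"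
  by (induction A rule: finite_induct) (auto intro: smooth_alg.intros)

text \<open>Writing the derivative with a phase shift by \<open>pi / 2\<close> makes each partial
  derivative a multiple of a generator of \<open>smooth_alg\<close>.\<close>

lemma cos_has_derivative_cart:
  "((\<lambda>x :: real ^ 'd::finite. cos (2 * pi * x $ i + a)) has_derivative
      (\<lambda>h. 2 * pi * cos (2 * pi * x $ i + (a + pi / 2)) * h $ i)) (at x)"
proof -
  have "((\<lambda>x :: real ^ 'd. cos (2 * pi * x $ i + a)) has_derivative
      (\<lambda>h. (2 * pi * h $ i) * - sin (2 * pi * x $ i + a))) (at x)"
    by (auto intro!: derivative_eq_intros bounded_linear.has_derivative[OF bounded_linear_vec_nth]
        simp: algebra_simps)
  moreover have "cos (2 * pi * x $ i + (a + pi / 2)) = - sin (2 * pi * x $ i + a)"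
    by (simp add: cos_add sin_add add.assoc[symmetric])
  ultimately show ?thesis by (simp add: algebra_simps)
qed

lemma smooth_alg_has_derivative:
  fixes f :: "real ^ 'd::finite \<Rightarrow> real"
  assumes "smooth_alg f"
  shows "\<exists>D. \<forall>x. (f has_derivative D x) (at x) \<and> (\<forall>j. smooth_alg (\<lambda>x. D x (axis j 1)))"
  using assms
proof induction
  case (const c)
  show ?case by (intro exI[of _ "\<lambda>x h. 0"]) (auto intro: smooth_alg.const)
next
  case (cos i a)
  have "smooth_alg (\<lambda>x. 2 * pi * cos (2 * pi * x $ i + (a + pi / 2)) * axis j 1 $ i)" for j :: 'd
    by (intro smooth_alg.intros)
  then show ?case
    by (intro exI[of _ "\<lambda>x h. 2 * pi * cos (2 * pi * x $ i + (a + pi / 2)) * h $ i"] allI conjI cos_has_derivative_cart)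
next
  case (sigmoid s i a b)
  let ?S = "\<lambda>x. sigmoid (s * (cos (2 * pi * x $ i + a) - b))"
  let ?D = "\<lambda>x h. (s * (2 * pi * cos (2 * pi * x $ i + (a + pi / 2)) * h $ i)) * (?S x * (1 - ?S x))"
  have "(?S has_derivative ?D x) (at x)" for x :: "real ^ 'd"
  proof -
    have "((\<lambda>x. s * (cos (2 * pi * x $ i + a) - b)) has_derivative
       (\<lambda>h. s * (2 * pi * cos (2 * pi * x $ i + (a + pi / 2)) * h $ i))) (at x)"
      using has_derivative_mult_right[OF has_derivative_diff[OF cos_has_derivative_cart[where i=i] has_derivative_const[of b]], of s]
      by simp
    from DERIV_compose_FDERIV[OF DERIV_sigmoid this] show ?thesis .
  qed
  moreover have "smooth_alg (\<lambda>x. ?D x (axis j 1))" for j :: 'd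
    by (intro smooth_alg.intros smooth_alg_one_minus)
  ultimately show ?case by (intro exI[of _ ?D] allI conjI)
next
  case (add f g)
  then obtain D E where *: "\<And>x. (f has_derivative D x) (at x)" "\<And>j. smooth_alg (\<lambda>x. D x (axis j 1))"
    "\<And>x. (g has_derivative E x) (at x)" "\<And>j. smooth_alg (\<lambda>x. E x (axis j 1))" by blast
  have "((\<lambda>x. f x + g x) has_derivative (\<lambda>h. D x h + E x h)) (at x)" for x
    by (intro has_derivative_add *)
  moreover have "smooth_alg (\<lambda>x. D x (axis j 1) + E x (axis j 1))" for j
    by (intro smooth_alg.add *)
  ultimately show ?case by (intro exI[of _ "\<lambda>x h. D x h + E x h"] allI conjI)
next
  case (mult f g)
  then obtain D E where *: "\<And>x. (f has_derivative D x) (at x)" "\<And>j. smooth_alg (\<lambda>x. D x (axis j 1))"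
    "\<And>x. (g has_derivative E x) (at x)" "\<And>j. smooth_alg (\<lambda>x. E x (axis j 1))" by blast
  have "((\<lambda>x. f x * g x) has_derivative (\<lambda>h. f x * E x h + D x h * g x)) (at x)" for x
    by (intro has_derivative_mult *)
  moreover have "smooth_alg (\<lambda>x. f x * E x (axis j 1) + D x (axis j 1) * g x)" for j
    by (intro smooth_alg.add smooth_alg.mult mult *)
  ultimately show ?case by (intro exI[of _ "\<lambda>x h. f x * E x h + D x h * g x"] allI conjI)
qed

lemma smooth_alg_partial:
  assumes "smooth_alg f" shows "f differentiable (at x)" and "smooth_alg (partial j f)"
proof -
  obtain D where D: "\<And>x. (f has_derivative D x) (at x)" "\<And>j. smooth_alg (\<lambda>x. D x (axis j 1))"
    using smooth_alg_has_derivative[OF assms] by blast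
  show "f differentiable (at x)" using D(1) by (auto simp: differentiable_def)
  have "partial j f = (\<lambda>x. D x (axis j 1))"
    by (simp add: fun_eq_iff partial_def frechet_derivative_at[OF D(1), symmetric])
  then show "smooth_alg (partial j f)" using D(2) by simp
qed

lemma smooth_alg_C_k: "smooth_alg f \<Longrightarrow> C_k k f"
proof (induction k arbitrary: f)
  case 0
  then have "f differentiable_on UNIV"
    by (simp add: differentiable_on_def smooth_alg_partial(1))
  then show ?case by (simp add: differentiable_imp_continuous_on)
qed (auto simp: smooth_alg_partial)

lemma cos_cart_periodic:
  "periodic (\<lambda>x :: real ^ 'd::finite. cos (2 * pi * x $ i + a))"
proof -
  have "cos (2 * pi * (x + k) $ i + a) = cos (2 * pi * x $ i + a)" if k: "k $ i \<in> \<int>" for x k :: "real ^ 'd"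
  proof -
    obtain n where "k $ i = of_int n" using k by (auto elim: Ints_cases)
    then have "2 * pi * (x + k) $ i + a = (2 * pi * x $ i + a) + 2 * pi * of_int n"
      by (simp add: algebra_simps)
    then show ?thesis by (simp only: cos_add[of "_ + _"] cos_int_2pin sin_int_2pin mult_1_right mult_zero_right diff_0_right)
  qed
  then show ?thesis by (simp add: periodic_def)
qed

lemma smooth_alg_periodic: "smooth_alg f \<Longrightarrow> periodic f"
proof (induction rule: smooth_alg.induct)
  case (cos i a)
  show ?case by (rule cos_cart_periodic)
next
  case (sigmoid s i a b)
  show ?case by (rule periodic_comp[OF cos_cart_periodic])
qed (auto simp: periodic_def)

lemma smooth_alg_test_functions: "smooth_alg f \<Longrightarrow> f \<in> test_functions"
  by (simp add: test_functions_def smooth_alg_periodic smooth_alg_C_k)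

lemma test_function_continuous: "\<phi> \<in> test_functions \<Longrightarrow> continuous_on UNIV \<phi>"
  by (auto simp: test_functions_def dest: spec[of _ 0])

lemma test_function_borel: "\<phi> \<in> test_functions \<Longrightarrow> \<phi> \<in> borel_measurable borel"
  by (intro borel_measurable_continuous_onI test_function_continuous)

lemma test_function_periodic: "\<phi> \<in> test_functions \<Longrightarrow> periodic \<phi>"
  by (simp add: test_functions_def)

lemma test_function_differentiable: "\<phi> \<in> test_functions \<Longrightarrow> \<phi> differentiable (at x)"
  by (auto simp: test_functions_def dest: spec[of _ "Suc 0"])

lemma partial_continuous: "\<phi> \<in> test_functions \<Longrightarrow> continuous_on UNIV (partial i \<phi>)"
  by (auto simp: test_functions_def dest: spec[of _ "Suc 0"])

section \<open>Translations, periodicity and bounds of test functions\<close>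

lemma frechet_derivative_translate:
  assumes "f differentiable (at (x + a))"
  shows "((\<lambda>x. f (x + a)) has_derivative frechet_derivative f (at (x + a))) (at x)"
proof -
  have "((\<lambda>x. x + a) has_derivative (\<lambda>h. h)) (at x)"
    by (auto intro!: derivative_eq_intros)
  moreover have "(f has_derivative frechet_derivative f (at (x + a))) (at (x + a))"
    using assms by (simp add: frechet_derivative_works)
  ultimately show ?thesis by (rule has_derivative_compose)
qed

lemma partial_translate:
  assumes "\<And>x. f differentiable (at x)"
  shows "partial i (\<lambda>x. f (x + a)) = (\<lambda>x. partial i f (x + a))"
  by (simp add: fun_eq_iff partial_def
      frechet_derivative_at[OF frechet_derivative_translate[OF assms], symmetric])

lemma C_k_translate: "C_k k f \<Longrightarrow> C_k k (\<lambda>x. f (x + a))"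
proof (induction k arbitrary: f)
  case 0
  then have "continuous_on UNIV (f \<circ> (\<lambda>x. x + a))"
    by (intro continuous_on_compose continuous_intros) (auto intro: continuous_on_subset)
  then show ?case by (simp add: o_def)
next
  case (Suc k)
  then have d: "\<And>x. f differentiable (at x)" by simp
  then have "(\<lambda>x. f (x + a)) differentiable (at x)" for x
    using frechet_derivative_translate[OF d] unfolding differentiable_def by blast
  moreover have "C_k k (partial i (\<lambda>x. f (x + a)))" for i
    unfolding partial_translate[OF d] using Suc by simp
  ultimately show ?case by simp
qed

lemma test_function_translate: "\<phi> \<in> test_functions \<Longrightarrow> (\<lambda>x. \<phi> (x + a)) \<in> test_functions"
  by (simp add: test_functions_def C_k_translate periodic_translate)

lemma partial_periodic:
  assumes "\<phi> \<in> test_functions" shows "periodic (partial i \<phi>)"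
proof (unfold periodic_iff, intro allI ballI)
  fix x k :: "real ^ 'a" assume k: "k \<in> int_vecs"
  have "(\<lambda>x. \<phi> (x + k)) = \<phi>"
    using periodicD[OF test_function_periodic[OF assms] k] by auto
  then show "partial i \<phi> (x + k) = partial i \<phi> x"
    using fun_cong[OF partial_translate[OF test_function_differentiable[OF assms], of i k], of x] by simp
qed

lemma periodic_continuous_bounded:
  fixes f :: "real ^ 'd::finite \<Rightarrow> real"
  assumes "periodic f" "continuous_on UNIV f"
  obtains B where "\<And>x. \<bar>f x\<bar> \<le> B"
proof -
  have "compact (f ` cbox 0 1)"
    by (intro compact_continuous_image continuous_on_subset[OF assms(2)]) auto
  then obtain B where B: "\<And>y. y \<in> f ` cbox 0 1 \<Longrightarrow> norm y \<le> B"
    by (blast dest: compact_imp_bounded bounded_iff[THEN iffD1])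
  have "\<bar>f x\<bar> \<le> B" for x
  proof -
    have "f (frac_vec x) \<in> f ` cbox 0 1"
      using frac_vec_in_unit_cell unit_cell_subset_cbox by blast
    from B[OF this] show ?thesis by (simp add: periodic_frac_vec[OF assms(1)])
  qed
  then show ?thesis by (rule that)
qed

lemma test_function_bounded:
  assumes "\<phi> \<in> test_functions" obtains B where "\<And>x. \<bar>\<phi> x\<bar> \<le> B"
  by (rule periodic_continuous_bounded[OF test_function_periodic test_function_continuous, OF assms assms]) (rule that)

lemma partial_bounded:
  assumes "\<phi> \<in> test_functions" obtains B where "\<And>x. \<bar>partial i \<phi> x\<bar> \<le> B"
  by (rule periodic_continuous_bounded[OF partial_periodic partial_continuous, OF assms assms]) (rule that)

lemma partial_borel: "\<phi> \<in> test_functions \<Longrightarrow> partial i \<phi> \<in> borel_measurable borel"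
  by (intro borel_measurable_continuous_onI partial_continuous)

section \<open>Pairing with test functions and the fundamental lemma of the calculus of
  variations\<close>

lemma integrable_mult_bounded:
  fixes u f :: "'a \<Rightarrow> real"
  assumes "integrable M u" "f \<in> borel_measurable M" "\<And>x. \<bar>f x\<bar> \<le> B"
  shows "integrable M (\<lambda>x. u x * f x)"
proof (rule Bochner_Integration.integrable_bound)
  show "integrable M (\<lambda>x. B * u x)" using assms by simp
  show "(\<lambda>x. u x * f x) \<in> borel_measurable M" using assms by (intro borel_measurable_times) auto
  show "AE x in M. norm (u x * f x) \<le> norm (B * u x)"
  proof (rule AE_I2)
    fix x
    have "\<bar>u x\<bar> * \<bar>f x\<bar> \<le> \<bar>u x\<bar> * \<bar>B\<bar>"
      using assms(3)[of x] by (intro mult_left_mono) auto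
    then show "norm (u x * f x) \<le> norm (B * u x)" by (simp add: abs_mult mult.commute)
  qed
qed

lemma integrable_mult_test_function:
  fixes u :: "real ^ 'd::finite \<Rightarrow> real"
  assumes u: "integrable torus u" and \<phi>: "\<phi> \<in> test_functions"
  shows "integrable torus (\<lambda>x. u x * \<phi> x)" "integrable torus (\<lambda>x. u x * partial i \<phi> x)"
  by (rule test_function_bounded[OF \<phi>],
      rule integrable_mult_bounded[OF u measurable_torus[OF test_function_borel[OF \<phi>]]], assumption)
     (rule partial_bounded[OF \<phi>],
      rule integrable_mult_bounded[OF u measurable_torus[OF partial_borel[OF \<phi>]]], assumption)

lemma integrable_cell_mult_test_function:
  fixes u :: "real ^ 'd::finite \<Rightarrow> real"
  assumes u: "integrable cell u" and \<phi>: "\<phi> \<in> test_functions"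
  shows "integrable cell (\<lambda>x. u x * \<phi> x)" "integrable cell (\<lambda>x. u x * partial i \<phi> x)"
  by (rule test_function_bounded[OF \<phi>],
      rule integrable_mult_bounded[OF u measurable_cell[OF test_function_borel[OF \<phi>]]], assumption)
     (rule partial_bounded[OF \<phi>],
      rule integrable_mult_bounded[OF u measurable_cell[OF partial_borel[OF \<phi>]]], assumption)

text \<open>On the circle, the interval from \<open>a\<close> to \<open>b\<close> consists of the
  points nearer than \<open>(b - a) / 2\<close> to its midpoint, and the cosine decreases with that
  distance. The bound \<open>s < 1 - w\<close> in the proof excludes reaching the interval by going
  round the circle.\<close>

lemma cos_interval_compare:
  assumes "0 \<le> a" "a < b" "b \<le> 1" "0 < t" "t < 1"
  shows "a < t \<Longrightarrow> t < b \<Longrightarrow> cos (2 * pi * (t - (a + b) / 2)) > cos (2 * pi * ((b - a) / 2))"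
    and "t < a \<or> b < t \<Longrightarrow> cos (2 * pi * (t - (a + b) / 2)) < cos (2 * pi * ((b - a) / 2))"
proof -
  define w s where "w = (b - a) / 2" and "s = \<bar>t - (a + b) / 2\<bar>"
  have w: "0 < w" "w \<le> 1/2" using assms by (auto simp: w_def)
  have s0: "0 \<le> s" by (simp add: s_def)
  have c: "cos (2 * pi * (t - (a + b) / 2)) = cos (2 * pi * s)"
    using cos_abs_real[of "2 * pi * (t - (a + b) / 2)"] by (simp add: s_def abs_mult)
  { assume "a < t" "t < b"
    then have "s < w" unfolding s_def w_def abs_less_iff by (intro conjI) argo+
    then have "cos (2 * pi * w) < cos (2 * pi * s)"
      using w s0 by (intro cos_monotone_0_pi) auto
    then show "cos (2 * pi * (t - (a + b) / 2)) > cos (2 * pi * ((b - a) / 2))"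
      by (simp add: c w_def) }
  { assume "t < a \<or> b < t"
    then have "w < s" unfolding s_def w_def
      using abs_ge_self[of "t - (a + b) / 2"] abs_ge_minus_self[of "t - (a + b) / 2"] by argo
    moreover have "s < 1 - w" unfolding s_def w_def abs_less_iff using assms by (intro conjI) argo+
    ultimately have s: "w < s" "s < 1 - w" by auto
    have "cos (2 * pi * s) < cos (2 * pi * w)"
    proof (cases "s \<le> 1/2")
      case True
      then show ?thesis using w s by (intro cos_monotone_0_pi) auto
    next
      case False
      have "cos (2 * pi * s) = cos (2 * pi * (1 - s))"
        by (simp add: right_diff_distrib cos_diff)
      also have "\<dots> < cos (2 * pi * w)" using w s False by (intro cos_monotone_0_pi) auto
      finally show ?thesis .
    qed
    then show "cos (2 * pi * (t - (a + b) / 2)) < cos (2 * pi * ((b - a) / 2))"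
      by (simp add: c w_def) }
qed

lemma AE_component_neq: "AE x in lborel. (x :: real ^ 'd::finite) $ i \<noteq> c"
proof -
  have "negligible {x :: real ^ 'd. axis i 1 \<bullet> x = c}"
    by (rule negligible_hyperplane) (simp add: axis_eq_0_iff)
  moreover have "{x :: real ^ 'd. axis i 1 \<bullet> x = c} \<in> sets lborel"
    using closed_hyperplane by (simp add: borel_closed)
  ultimately have "{x :: real ^ 'd. axis i 1 \<bullet> x = c} \<in> null_sets lborel"
    by (simp add: negligible_iff_null_sets null_sets_completion_iff)
  from AE_not_in[OF this] show ?thesis by (simp add: inner_axis inner_commute)
qed

text \<open>Products of ever steeper sigmoids are test functions bounded by 1 that converge, off
  finitely many hyperplanes, to the indicator of the box. Dominated convergence with the absolute
  value of \<open>W\<close> as majorant gives the claim.\<close>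

lemma integral_box_eq_0_of_test:
  fixes W :: "real ^ 'd::finite \<Rightarrow> real"
  assumes [measurable]: "W \<in> borel_measurable borel" and int: "integrable cell W"
    and zero: "\<And>\<phi>. \<phi> \<in> test_functions \<Longrightarrow> (LINT x|cell. W x * \<phi> x) = 0"
    and ab: "\<And>i. 0 \<le> a $ i" "\<And>i. a $ i < b $ i" "\<And>i. b $ i \<le> 1"
  shows "(LINT x|cell. W x * indicator (box a b) x) = 0"
proof -
  \<comment> \<open>The bracket is positive between the two faces of the box orthogonal to direction
    \<open>i\<close> and negative outside, so the factor \<open>n\<close> drives the sigmoid to 1 or
    to 0.\<close>
  define c where "c n i x = real n * (cos (2 * pi * x $ i + (- (2 * pi * ((a $ i + b $ i) / 2))))
     - cos (2 * pi * ((b $ i - a $ i) / 2)))" for n :: nat and i and x :: "real ^ 'd"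
  define \<phi> where "\<phi> n x = (\<Prod>i\<in>UNIV. sigmoid (c n i x))" for n x
  have test: "\<phi> n \<in> test_functions" for n
    unfolding \<phi>_def c_def by (intro smooth_alg_test_functions smooth_alg_prod smooth_alg.sigmoid) simp
  note [measurable] = test_function_borel[OF test]
  have lim: "AE x in cell. (\<lambda>n. W x * \<phi> n x) \<longlonglongrightarrow> W x * indicator (box a b) x"
  proof -
    have "AE x in lborel. \<forall>i\<in>UNIV. x $ i \<noteq> a $ i \<and> x $ i \<noteq> b $ i \<and> x $ i \<noteq> 0"
      by (intro AE_finite_allI AE_conjI AE_component_neq) simp
    then show ?thesis unfolding AE_cell_iff
    proof (rule eventually_mono, intro impI)
      fix x :: "real ^ 'd" assume ne: "\<forall>i\<in>UNIV. x $ i \<noteq> a $ i \<and> x $ i \<noteq> b $ i \<and> x $ i \<noteq> 0"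
        and x: "x \<in> unit_cell"
      have "(\<lambda>n. sigmoid (c n i x)) \<longlonglongrightarrow> (if a $ i < x $ i \<and> x $ i < b $ i then 1 else 0)" for i
      proof -
        have x01: "0 < x $ i" "x $ i < 1" using x ne by (auto simp: unit_cell_def less_le)
        have ceq: "c n i x = real n * (cos (2 * pi * (x $ i - (a $ i + b $ i) / 2)) - cos (2 * pi * ((b $ i - a $ i) / 2)))" for n
          by (simp add: c_def right_diff_distrib)
        note cmp = cos_interval_compare[OF ab(1)[of i] ab(2)[of i] ab(3)[of i] x01]
        show ?thesis
        proof (cases "a $ i < x $ i \<and> x $ i < b $ i")
          case True
          then show ?thesis unfolding ceq using cmp(1) by (auto intro!: sigmoid_at_top)
        next
          case False
          then have "x $ i < a $ i \<or> b $ i < x $ i" using ne by (meson UNIV_I linorder_neqE_linordered_idom)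
          then show ?thesis unfolding ceq using cmp(2) False by (auto intro!: sigmoid_at_bot)
        qed
      qed
      then have "(\<lambda>n. \<phi> n x) \<longlonglongrightarrow> (\<Prod>i\<in>UNIV. if a $ i < x $ i \<and> x $ i < b $ i then 1 else 0)"
        unfolding \<phi>_def by (intro tendsto_prod)
      also have "(\<Prod>i\<in>UNIV. if a $ i < x $ i \<and> x $ i < b $ i then 1 else 0) = (indicator (box a b) x :: real)"
      proof (cases "x \<in> box a b")
        case False
        then obtain i where "\<not> (a $ i < x $ i \<and> x $ i < b $ i)" by (auto simp: mem_box_cart)
        then have "(\<Prod>i\<in>UNIV. if a $ i < x $ i \<and> x $ i < b $ i then 1 else 0 :: real) = 0"
          by (intro prod_zero) auto
        then show ?thesis using False by simp
      qed (auto simp: mem_box_cart)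
      finally show "(\<lambda>n. W x * \<phi> n x) \<longlonglongrightarrow> W x * indicator (box a b) x"
        by (intro tendsto_intros)
    qed
  qed
  have bd: "\<bar>\<phi> n x\<bar> \<le> 1" for n x
  proof -
    have "0 \<le> \<phi> n x" unfolding \<phi>_def by (intro prod_nonneg) (simp add: sigmoid_pos less_imp_le)
    moreover have "\<phi> n x \<le> 1" unfolding \<phi>_def
      by (intro prod_le_1) (simp add: sigmoid_pos less_imp_le sigmoid_le_1)
    ultimately show ?thesis by simp
  qed
  have "(\<lambda>n. LINT x|cell. W x * \<phi> n x) \<longlonglongrightarrow> (LINT x|cell. W x * indicator (box a b) x)"
  proof (rule integral_dominated_convergence[where w="\<lambda>x. \<bar>W x\<bar>"])
    show "integrable cell (\<lambda>x. \<bar>W x\<bar>)" using int by simp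
    show "AE x in cell. norm (W x * \<phi> n x) \<le> \<bar>W x\<bar>" for n
      using bd by (intro AE_I2) (simp add: abs_mult mult_left_le)
    show "(\<lambda>x. W x * \<phi> n x) \<in> borel_measurable cell" for n by measurable
  qed (use lim in \<open>simp_all\<close>)
  then have "(\<lambda>n. 0) \<longlonglongrightarrow> (LINT x|cell. W x * indicator (box a b) x)"
    by (simp add: zero[OF test])
  then show ?thesis by (simp add: LIMSEQ_const_iff)
qed

text \<open>By Lebesgue differentiation, \<open>W x\<close> is for almost every \<open>x\<close> in
  the cell the limit of averages over small cubes with lower corner \<open>x\<close>, and these
  vanish by \<open>integral_box_eq_0_of_test\<close>.\<close>

lemma fundamental_lemma:
  fixes W :: "real ^ 'd::finite \<Rightarrow> real"
  assumes [measurable]: "W \<in> borel_measurable borel" and int: "integrable cell W"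
    and zero: "\<And>\<phi>. \<phi> \<in> test_functions \<Longrightarrow> (LINT x|cell. W x * \<phi> x) = 0"
  shows "AE x in cell. W x = 0"
proof -
  define f where "f = (\<lambda>x. indicator unit_cell x *\<^sub>R W x)"
  have intf: "integrable lborel f"
    using int unfolding cell_def f_def by (subst (asm) integrable_restrict_space) auto
  then have "f integrable_on UNIV" using has_integral_integral_lborel by blast
  then have "f integrable_on cbox a b" for a b by (rule integrable_on_subcbox) simp
  from integrable_ccontinuous_explicit[OF this] obtain N where neg: "negligible N"
    and N: "\<And>x e. x \<notin> N \<Longrightarrow> 0 < e \<Longrightarrow> \<exists>d>0. \<forall>h. 0 < h \<and> h < d \<longrightarrow>
        norm (integral (cbox x (x + h *\<^sub>R One)) f /\<^sub>R h ^ DIM((real, 'd) vec) - f x) < e" by blast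
  have boxzero: "integral (cbox a b) f = 0"
    if ab: "\<And>i. 0 \<le> a $ i" "\<And>i. a $ i < b $ i" "\<And>i. b $ i \<le> 1" for a b
  proof -
    have eq: "(\<lambda>x. if x \<in> box a b then f x else 0) = (\<lambda>x. indicator unit_cell x *\<^sub>R (W x * indicator (box a b) x))"
      by (auto simp: f_def fun_eq_iff indicator_def)
    have "integrable cell (\<lambda>x. W x * indicator (box a b) x)"
      by (rule integrable_mult_bounded[OF int, where B=1]) (auto simp: indicator_def)
    then have "integrable lborel (\<lambda>x. if x \<in> box a b then f x else 0)"
      unfolding eq cell_def by (subst (asm) integrable_restrict_space) auto
    from has_integral_integral_lborel[OF this]
    have "(f has_integral (LINT x|lborel. (if x \<in> box a b then f x else 0))) (box a b)"
      by (simp add: has_integral_restrict_UNIV)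
    also have "(LINT x|lborel. (if x \<in> box a b then f x else 0)) = (LINT x|cell. W x * indicator (box a b) x)"
      unfolding eq cell_def by (subst integral_restrict_space) auto
    also have "\<dots> = 0" by (rule integral_box_eq_0_of_test[OF assms ab])
    finally show ?thesis by (metis integral_open_interval integral_unique)
  qed
  have "N \<in> null_sets lebesgue" using neg by (simp add: negligible_iff_null_sets)
  then have "AE x in lborel. x \<notin> N" using AE_not_in by (subst AE_completion_iff[symmetric])
  moreover have "AE x in lborel. \<forall>i\<in>UNIV. (x :: real ^ 'd) $ i \<noteq> 1"
    by (intro AE_finite_allI AE_component_neq) simp
  ultimately have "AE x in lborel. x \<in> unit_cell \<longrightarrow> W x = 0"
  proof eventually_elim
    case (elim x)
    show ?case
    proof (rule impI, rule ccontr)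
      assume x: "x \<in> unit_cell" and ne: "W x \<noteq> 0"
      then obtain d where d: "d > 0" "\<And>h. 0 < h \<Longrightarrow> h < d \<Longrightarrow>
        norm (integral (cbox x (x + h *\<^sub>R One)) f /\<^sub>R h ^ DIM((real, 'd) vec) - f x) < \<bar>W x\<bar>"
        using N[OF elim(1), of "\<bar>W x\<bar>"] by auto
      \<comment> \<open>A cube with lower corner \<open>x\<close> and side at most \<open>m\<close>
        stays in the unit cube, where the vanishing of box integrals is known.\<close>
      define m where "m = Min (range (\<lambda>i. 1 - x $ i))"
      have m: "0 < m" "\<And>i. m \<le> 1 - x $ i"
        using x by (auto simp: m_def unit_cell_def)
      define h where "h = min (d / 2) m"
      have h: "0 < h" "h < d" "h \<le> m" using d(1) m by (auto simp: h_def)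
      have one: "(One :: real ^ 'd) $ i = 1" for i
        by (simp add: cart_eq_inner_axis axis_in_Basis_iff)
      have "integral (cbox x (x + h *\<^sub>R One)) f = 0"
      proof (rule boxzero)
        fix i
        show "0 \<le> x $ i" using x by (simp add: unit_cell_def)
        show "x $ i < (x + h *\<^sub>R One) $ i" "(x + h *\<^sub>R One) $ i \<le> 1"
          using h m(2)[of i] one[of i] by simp_all
      qed
      then have "\<bar>f x\<bar> < \<bar>W x\<bar>" using d(2)[OF h(1,2)] by simp
      then show False using x by (simp add: f_def)
    qed
  qed
  then show ?thesis by (simp add: AE_cell_iff)
qed

lemma integral_torus_AE:
  fixes f :: "real ^ 'd::finite \<Rightarrow> real"
  assumes "f \<in> borel_measurable torus" "f' \<in> borel_measurable borel" "AE x in lborel. f x = f' x"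
  shows "(LINT x|torus. f x) = (LINT x|cell. f' x)"
proof -
  have "AE x in torus. f x = f' x"
    unfolding AE_torus_iff AE_cell_iff using assms(3) by (rule eventually_mono) simp
  then have "(LINT x|torus. f x) = (LINT x|torus. f' x)"
    by (intro integral_cong_AE measurable_torus[OF assms(2)] assms(1))
  then show ?thesis using integral_torus[OF assms(2)] by simp
qed

lemma integrable_torus_AE:
  fixes f :: "real ^ 'd::finite \<Rightarrow> 'b::{banach, second_countable_topology}"
  assumes "integrable torus f" "f' \<in> borel_measurable borel" "AE x in lborel. f x = f' x"
  shows "integrable cell f'"
proof -
  have "AE x in torus. f x = f' x"
    unfolding AE_torus_iff AE_cell_iff using assms(3) by (rule eventually_mono) simp
  then have "integrable torus f'"
    using assms(1) integrable_cong_AE[OF borel_measurable_integrable[OF assms(1)] measurable_torus[OF assms(2)]]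
    by simp
  then show ?thesis using integrable_torus[OF assms(2)] by simp
qed

lemma integrable_vec_nth:
  fixes V :: "'a \<Rightarrow> real ^ 'd::finite"
  assumes "integrable M V" shows "integrable M (\<lambda>x. V x $ i)"
  by (rule integrable_bounded_linear[OF bounded_linear_vec_nth assms])

lemma fundamental_lemma_torus:
  fixes W :: "real ^ 'd::finite \<Rightarrow> real"
  assumes "periodic W" and int: "integrable torus W"
    and zero: "\<And>\<phi>. \<phi> \<in> test_functions \<Longrightarrow> (LINT x|torus. W x * \<phi> x) = 0"
  shows "AE x in lborel. W x = 0"
proof -
  obtain W' where [measurable]: "W' \<in> borel_measurable borel" and W': "periodic W'" "AE x in lborel. W x = W' x"
    using periodic_borel_version_real[OF borel_measurable_integrable[OF int] assms(1)] .
  have "AE x in cell. W' x = 0"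
  proof (rule fundamental_lemma)
    show "integrable cell W'" by (rule integrable_torus_AE[OF int _ W'(2)]) simp
    fix \<phi> :: "real ^ 'd \<Rightarrow> real" assume \<phi>: "\<phi> \<in> test_functions"
    have "AE x in lborel. W x * \<phi> x = W' x * \<phi> x" using W'(2) by (rule eventually_mono) simp
    then have "(LINT x|torus. W x * \<phi> x) = (LINT x|cell. W' x * \<phi> x)"
      using test_function_borel[OF \<phi>] borel_measurable_integrable[OF integrable_mult_test_function(1)[OF int \<phi>]]
      by (intro integral_torus_AE) auto
    then show "(LINT x|cell. W' x * \<phi> x) = 0" using zero[OF \<phi>] by simp
  qed simp
  then have "AE x in lborel. W' x = 0"
    by (subst (asm) AE_cell_periodic) (rule periodic_comp[OF W'(1)], assumption)
  with W'(2) show ?thesis by eventually_elim simp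
qed

section \<open>Uniqueness and differences of weak gradients\<close>

lemma is_weak_gradientD:
  assumes "is_weak_gradient u V"
  shows "periodic V" "integrable torus V"
    "\<phi> \<in> test_functions \<Longrightarrow> (LINT x|torus. u x * partial i \<phi> x) = - (LINT x|torus. V x $ i * \<phi> x)"
  using assms by (simp_all only: is_weak_gradient_def)

lemma is_weak_gradientI:
  assumes "periodic V" "integrable torus V"
    "\<And>\<phi> i. \<phi> \<in> test_functions \<Longrightarrow> (LINT x|torus. u x * partial i \<phi> x) = - (LINT x|torus. V x $ i * \<phi> x)"
  shows "is_weak_gradient u V"
  using assms by (simp only: is_weak_gradient_def) blast

lemma weak_gradient_unique:
  assumes "is_weak_gradient u V" "is_weak_gradient u V'"
  shows "AE x in lborel. V x = V' x"
proof -
  note int = assms[THEN is_weak_gradientD(2)] and per = assms[THEN is_weak_gradientD(1)]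
  have "AE x in lborel. V x $ i - V' x $ i = 0" for i
  proof (rule fundamental_lemma_torus)
    show "periodic (\<lambda>x. V x $ i - V' x $ i)" using per by (simp add: periodic_def)
    show "integrable torus (\<lambda>x. V x $ i - V' x $ i)"
      using int by (intro Bochner_Integration.integrable_diff integrable_vec_nth)
    fix \<phi> :: "real ^ 'a \<Rightarrow> real" assume \<phi>: "\<phi> \<in> test_functions"
    have "(LINT x|torus. (V x $ i - V' x $ i) * \<phi> x) = (LINT x|torus. V x $ i * \<phi> x) - (LINT x|torus. V' x $ i * \<phi> x)"
      using int by (simp add: left_diff_distrib integrable_mult_test_function(1)[OF integrable_vec_nth \<phi>])
    also have "\<dots> = 0"
      using is_weak_gradientD(3)[OF assms(1) \<phi>, of i] is_weak_gradientD(3)[OF assms(2) \<phi>, of i] by linarith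
    finally show "(LINT x|torus. (V x $ i - V' x $ i) * \<phi> x) = 0" .
  qed
  then have "AE x in lborel. \<forall>i\<in>UNIV. V x $ i - V' x $ i = 0" by (intro AE_finite_allI) auto
  then show ?thesis by (rule eventually_mono) (simp add: vec_eq_iff)
qed

lemma is_weak_gradient_diff:
  assumes "is_weak_gradient u U" "is_weak_gradient v V" "integrable torus u" "integrable torus v"
  shows "is_weak_gradient (\<lambda>x. v x - u x) (\<lambda>x. V x - U x)"
proof -
  note int = assms(2,1)[THEN is_weak_gradientD(2)] and per = assms(2,1)[THEN is_weak_gradientD(1)]
  have "(LINT x|torus. (v x - u x) * partial i \<phi> x) = - (LINT x|torus. (V x - U x) $ i * \<phi> x)"
    if \<phi>: "\<phi> \<in> test_functions" for \<phi> i
  proof -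
    have "(LINT x|torus. (v x - u x) * partial i \<phi> x) = (LINT x|torus. v x * partial i \<phi> x) - (LINT x|torus. u x * partial i \<phi> x)"
      using assms(3,4) by (simp add: left_diff_distrib integrable_mult_test_function(2)[OF _ \<phi>])
    also have "\<dots> = - ((LINT x|torus. V x $ i * \<phi> x) - (LINT x|torus. U x $ i * \<phi> x))"
      using is_weak_gradientD(3)[OF assms(1) \<phi>, of i] is_weak_gradientD(3)[OF assms(2) \<phi>, of i] by linarith
    also have "\<dots> = - (LINT x|torus. (V x - U x) $ i * \<phi> x)"
      using int by (simp add: left_diff_distrib integrable_mult_test_function(1)[OF integrable_vec_nth \<phi>])
    finally show ?thesis .
  qed
  moreover have "periodic (\<lambda>x. V x - U x)" by (rule periodic_comp2[OF per])
  ultimately show ?thesis using int by (intro is_weak_gradientI) auto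
qed

section \<open>Increments of Sobolev functions\<close>

definition uint :: "real measure" where
  "uint = restrict_space lborel {0..1}"

lemma space_uint [simp]: "space uint = {0..1}"
  by (simp add: uint_def space_restrict_space)

lemma finite_measure_uint: "finite_measure uint"
  by (intro finite_measureI) (simp add: uint_def emeasure_restrict_space)

interpretation uint: finite_measure uint
  by (rule finite_measure_uint)

lemma emeasure_uint: "emeasure uint {0..1} = 1"
  by (simp add: uint_def emeasure_restrict_space)

lemma measurable_uint [measurable (raw)]:
  "f \<in> borel \<rightarrow>\<^sub>M M \<Longrightarrow> f \<in> uint \<rightarrow>\<^sub>M M"
  by (simp add: uint_def measurable_restrict_space1)

lemma measurable_ident_uint: "(\<lambda>x. x) \<in> borel_measurable uint"
  by (rule measurable_uint) simp

lemma measurable_uint_cell: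
  fixes f :: "real \<times> (real ^ 'd::finite) \<Rightarrow> 'b::topological_space"
  assumes [measurable]: "f \<in> borel_measurable (borel \<Otimes>\<^sub>M borel)"
  shows "f \<in> borel_measurable (uint \<Otimes>\<^sub>M cell)"
  by (rule measurable_pair_borel[OF assms measurable_ident_uint measurable_ident_cell])

text \<open>The bound \<open>B\<close>, uniform in \<open>t\<close>, gives integrability on the
  product because \<open>uint\<close> is finite.\<close>

lemma integral_uint_cell_swap:
  fixes F :: "real \<Rightarrow> real ^ 'd::finite \<Rightarrow> real"
  assumes meas [measurable]: "(\<lambda>(t, x). F t x) \<in> borel_measurable (borel \<Otimes>\<^sub>M borel)"
    and int: "\<And>t. t \<in> {0..1} \<Longrightarrow> integrable cell (F t)"
    and bd: "\<And>t. t \<in> {0..1} \<Longrightarrow> (LINT x|cell. \<bar>F t x\<bar>) \<le> B"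
  shows "(LINT x|cell. LINT t|uint. F t x) = (LINT t|uint. LINT x|cell. F t x)"
    and "integrable cell (\<lambda>x. LINT t|uint. F t x)"
proof -
  interpret pair_sigma_finite uint "cell :: (real ^ 'd) measure" ..
  have m: "(\<lambda>(t, x). F t x) \<in> borel_measurable (uint \<Otimes>\<^sub>M cell)"
    by (rule measurable_uint_cell[OF meas])
  have "integrable (uint \<Otimes>\<^sub>M cell) (\<lambda>(t, x). F t x)"
  proof (rule Fubini_integrable[OF m])
    show "AE t in uint. integrable cell (\<lambda>x. case (t, x) of (t, x) \<Rightarrow> F t x)"
      using int by (intro AE_I2) simp
    have "(\<lambda>t. LINT x|cell. norm (F t x)) \<in> borel_measurable uint"
    proof (rule cell.borel_measurable_lebesgue_integral)
      have "(\<lambda>(t, x). norm (F t x)) \<in> borel_measurable (borel \<Otimes>\<^sub>M borel)" by measurable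
      then show "(\<lambda>(t, x). norm (F t x)) \<in> borel_measurable (uint \<Otimes>\<^sub>M cell)"
        by (rule measurable_uint_cell)
    qed
    then show "integrable uint (\<lambda>t. LINT x|cell. norm (case (t, x) of (t, x) \<Rightarrow> F t x))"
      using bd by (intro uint.integrable_const_bound[where B=B] AE_I2) auto
  qed
  then show "(LINT x|cell. LINT t|uint. F t x) = (LINT t|uint. LINT x|cell. F t x)"
    and "integrable cell (\<lambda>x. LINT t|uint. F t x)"
    using Fubini_integral[of F] integrable_snd[of F] by simp_all
qed

text \<open>The segment runs from \<open>x\<close> back to \<open>x - h\<close>, because shifting
  \<open>u\<close> by \<open>h\<close> amounts to shifting the test function by
  \<open>- h\<close>.\<close>

lemma test_function_FTC:
  fixes \<phi> :: "real ^ 'd::finite \<Rightarrow> real"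
  assumes \<phi>: "\<phi> \<in> test_functions"
  shows "(LINT t|uint. (\<Sum>i\<in>UNIV. h $ i * partial i \<phi> (x - t *\<^sub>R h))) = \<phi> x - \<phi> (x - h)"
proof -
  let ?f = "\<lambda>t. \<Sum>i\<in>UNIV. h $ i * partial i \<phi> (x - t *\<^sub>R h)"
  have der: "((\<lambda>t. - \<phi> (x - t *\<^sub>R h)) has_real_derivative ?f t) (at t)" for t
  proof -
    let ?D = "frechet_derivative \<phi> (at (x - t *\<^sub>R h))"
    have D: "(\<phi> has_derivative ?D) (at (x - t *\<^sub>R h))"
      using test_function_differentiable[OF \<phi>] by (simp add: frechet_derivative_works)
    then interpret D: bounded_linear ?D by (rule has_derivative_bounded_linear)
    have "h = (\<Sum>i\<in>UNIV. h $ i *\<^sub>R axis i 1)"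
      using basis_expansion[of h] by (simp add: scalar_mult_eq_scaleR)
    then have "?D h = ?D (\<Sum>i\<in>UNIV. h $ i *\<^sub>R axis i 1)" by simp
    also have "\<dots> = ?f t" by (simp add: D.sum D.scaleR partial_def)
    finally have Dh: "?D h = ?f t" .
    have "((\<lambda>t. x - t *\<^sub>R h) has_derivative (\<lambda>s. - (s *\<^sub>R h))) (at t)"
      by (auto intro!: derivative_eq_intros)
    from has_derivative_compose[OF this D]
    have "((\<lambda>t. \<phi> (x - t *\<^sub>R h)) has_derivative (\<lambda>s. ?D (- (s *\<^sub>R h)))) (at t)" .
    moreover have "(\<lambda>s. - ?D (- (s *\<^sub>R h))) = (*) (?f t)"
      by (auto simp: fun_eq_iff D.neg D.scaleR Dh)
    ultimately show ?thesis
      using has_derivative_minus[of "\<lambda>t. \<phi> (x - t *\<^sub>R h)"] by (fastforce simp: has_field_derivative_def)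
  qed
  have cont: "continuous_on {0..1} ?f"
    by (intro continuous_intros continuous_on_compose2[OF partial_continuous[OF \<phi>]]) auto
  have "(LINT t|uint. ?f t) = (LINT t|lborel. indicator {0..1} t *\<^sub>R ?f t)"
    by (simp add: uint_def integral_restrict_space)
  also have "\<dots> = - \<phi> (x - 1 *\<^sub>R h) - - \<phi> (x - 0 *\<^sub>R h)"
    by (intro integral_FTC_Icc cont)
       (auto intro!: has_field_derivative_at_within der simp: has_real_derivative_iff_has_vector_derivative[symmetric])
  finally show ?thesis by simp
qed

text \<open>Exactly periodic Borel representatives of a function and its weak gradient, as
  \<open>W1r_borel_version\<close> supplies them. Only L1 integrability is asked for: the exponent
  \<open>r\<close> enters later, through the maximal function.\<close>

locale borel_sobolev =
  fixes u :: "real ^ 'd::finite \<Rightarrow> real" and V :: "real ^ 'd \<Rightarrow> real ^ 'd"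
  assumes u_meas [measurable]: "u \<in> borel_measurable borel" and V_meas [measurable]: "V \<in> borel_measurable borel"
    and u_per: "periodic u" and V_per: "periodic V"
    and u_int: "integrable cell u" and V_int: "integrable cell V"
    and weak: "\<phi> \<in> test_functions \<Longrightarrow> (LINT x|cell. u x * partial i \<phi> x) = - (LINT x|cell. V x $ i * \<phi> x)"
begin


lemma Vh_per: "periodic (\<lambda>x. V x \<bullet> h)"
  by (rule periodic_comp[OF V_per])

text \<open>The weak formulation is applied to the test function translated by \<open>a\<close>;
  invariance of the cell integral then moves the translation onto \<open>V\<close>.\<close>

lemma weak_directional:
  assumes \<phi>: "\<phi> \<in> test_functions"
  shows "(LINT x|cell. u x * (\<Sum>i\<in>UNIV. h $ i * partial i \<phi> (x - a))) = - (LINT x|cell. (V (x + a) \<bullet> h) * \<phi> x)"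
proof -
  define \<psi> where "\<psi> = (\<lambda>x. \<phi> (x + (- a)))"
  have \<psi>: "\<psi> \<in> test_functions" unfolding \<psi>_def by (rule test_function_translate[OF \<phi>])
  have p: "partial i \<phi> (x - a) = partial i \<psi> x" for i x
    unfolding \<psi>_def partial_translate[OF test_function_differentiable[OF \<phi>]] by simp
  have "(LINT x|cell. u x * (\<Sum>i\<in>UNIV. h $ i * partial i \<phi> (x - a))) = (LINT x|cell. (\<Sum>i\<in>UNIV. h $ i * (u x * partial i \<psi> x)))"
    by (simp add: p sum_distrib_left mult.left_commute)
  also have "\<dots> = (\<Sum>i\<in>UNIV. h $ i * (LINT x|cell. u x * partial i \<psi> x))"
    by (subst Bochner_Integration.integral_sum) (auto intro!: integrable_cell_mult_test_function(2)[OF u_int \<psi>])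
  also have "\<dots> = - (\<Sum>i\<in>UNIV. h $ i * (LINT x|cell. V x $ i * \<psi> x))"
    by (simp add: weak[OF \<psi>] sum_negf)
  also have "(\<Sum>i\<in>UNIV. h $ i * (LINT x|cell. V x $ i * \<psi> x)) = (LINT x|cell. (\<Sum>i\<in>UNIV. h $ i * (V x $ i * \<psi> x)))"
    by (subst Bochner_Integration.integral_sum)
       (auto intro!: integrable_cell_mult_test_function(1)[OF integrable_vec_nth[OF V_int] \<psi>])
  also have "\<dots> = (LINT x|cell. (V x \<bullet> h) * \<phi> (x + (- a)))"
    by (simp add: \<psi>_def inner_vec_def sum_distrib_left mult_ac)
  also have "\<dots> = (LINT x|cell. (V (x + a) \<bullet> h) * \<phi> (x + a + (- a)))"
  proof (rule integral_cell_translate[symmetric])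
    show "periodic (\<lambda>x. V x \<bullet> h * \<phi> (x + - a))"
      by (rule periodic_comp2[OF Vh_per periodic_translate[OF test_function_periodic[OF \<phi>]]])
    note [measurable] = test_function_borel[OF \<phi>]
    show "(\<lambda>x. V x \<bullet> h * \<phi> (x + - a)) \<in> borel_measurable borel" by measurable
  qed
  finally show ?thesis by simp
qed

text \<open>Duality: against a test function the increment of \<open>u\<close> is minus the integral
  of \<open>u x * (\<phi> x - \<phi> (x - h))\<close>. Writing this difference of
  \<open>\<phi>\<close> as an integral over the segment, exchanging integrals and using
  \<open>weak_directional\<close> for each \<open>t\<close> gives the integral of
  \<open>g x * \<phi> x\<close>. Then the fundamental lemma applies.\<close>

lemma translation_identity:
  "AE x in cell. u (x + h) - u x - (LINT t|uint. V (x + t *\<^sub>R h) \<bullet> h) = 0"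
proof (rule fundamental_lemma)
  define g where "g = (\<lambda>x. LINT t|uint. V (x + t *\<^sub>R h) \<bullet> h)"
  have Vh_int: "integrable cell (\<lambda>x. V x \<bullet> h)" using V_int by simp
  have Vt_int: "integrable cell (\<lambda>x. V (x + a) \<bullet> h)" for a
    using integrable_cell_translate[of "\<lambda>x. V x \<bullet> h" a] Vh_per Vh_int by simp
  have Vt_eq: "(LINT x|cell. \<bar>V (x + a) \<bullet> h\<bar>) = (LINT x|cell. \<bar>V x \<bullet> h\<bar>)" for a
    using integral_cell_translate[of "\<lambda>x. \<bar>V x \<bullet> h\<bar>" a] periodic_comp[OF Vh_per, of abs] by simp
  have m1: "(\<lambda>(t, x). V (x + t *\<^sub>R h) \<bullet> h) \<in> borel_measurable (borel \<Otimes>\<^sub>M borel)"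
    by measurable
  have g_int: "integrable cell g"
    unfolding g_def by (rule integral_uint_cell_swap(2)[OF m1, where B="LINT x|cell. \<bar>V x \<bullet> h\<bar>"])
      (simp_all add: Vt_int Vt_eq)
  have g_meas [measurable]: "g \<in> borel_measurable borel"
  proof -
    have "(\<lambda>(x, t). V (x + t *\<^sub>R h) \<bullet> h) \<in> borel_measurable (borel \<Otimes>\<^sub>M uint)"
      by (rule measurable_pair_borel[OF _ measurable_ident_sets[OF refl] measurable_ident_uint]) measurable
    then show ?thesis unfolding g_def by (rule uint.borel_measurable_lebesgue_integral)
  qed
  show "(\<lambda>x. u (x + h) - u x - (LINT t|uint. V (x + t *\<^sub>R h) \<bullet> h)) \<in> borel_measurable borel"
    using g_meas by (simp add: g_def)
  have u_tr: "integrable cell (\<lambda>x. u (x + h))"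
    by (subst integrable_cell_translate) (use u_int u_per in auto)
  then show "integrable cell (\<lambda>x. u (x + h) - u x - (LINT t|uint. V (x + t *\<^sub>R h) \<bullet> h))"
    using u_int g_int by (simp add: g_def)
  fix \<phi> :: "real ^ 'd \<Rightarrow> real" assume \<phi>: "\<phi> \<in> test_functions"
  note [measurable] = test_function_borel[OF \<phi>]
  note [measurable] = partial_borel[OF \<phi>]
  obtain B where B: "\<And>x. \<bar>\<phi> x\<bar> \<le> B" by (rule test_function_bounded[OF \<phi>]) (rule that)
  have "\<forall>i. \<exists>B. \<forall>x. \<bar>partial i \<phi> x\<bar> \<le> B"
  proof
    fix i
    obtain B where "\<And>x. \<bar>partial i \<phi> x\<bar> \<le> B" by (rule partial_bounded[OF \<phi>]) (rule that)
    then show "\<exists>B. \<forall>x. \<bar>partial i \<phi> x\<bar> \<le> B" by auto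
  qed
  from choice[OF this] obtain C where C: "\<And>i x. \<bar>partial i \<phi> x\<bar> \<le> C i" by auto
  define P where "P = (\<lambda>y. \<Sum>i\<in>UNIV. h $ i * partial i \<phi> y)"
  have P_meas [measurable]: "P \<in> borel_measurable borel" unfolding P_def by measurable
  define K where "K = (\<Sum>i\<in>UNIV. \<bar>h $ i\<bar> * C i)"
  have P_bd: "\<bar>P y\<bar> \<le> K" for y
  proof -
    have "\<bar>P y\<bar> \<le> (\<Sum>i\<in>UNIV. \<bar>h $ i * partial i \<phi> y\<bar>)" unfolding P_def by (rule sum_abs)
    also have "\<dots> \<le> K" unfolding K_def abs_mult by (intro sum_mono mult_left_mono C) simp
    finally show ?thesis .
  qed
  have uP_int: "integrable cell (\<lambda>x. u x * P (x - t *\<^sub>R h))" for t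
    by (rule integrable_mult_bounded[OF u_int _ P_bd]) (intro measurable_cell, measurable)
  have m2: "(\<lambda>(t, x). u x * P (x - t *\<^sub>R h)) \<in> borel_measurable (borel \<Otimes>\<^sub>M borel)"
    by measurable
  have b2: "(LINT x|cell. \<bar>u x * P (x - t *\<^sub>R h)\<bar>) \<le> (LINT x|cell. \<bar>u x\<bar> * K)" for t
  proof (rule integral_mono)
    show "integrable cell (\<lambda>x. \<bar>u x\<bar> * K)" using u_int by simp
    show "integrable cell (\<lambda>x. \<bar>u x * P (x - t *\<^sub>R h)\<bar>)" using uP_int by simp
    show "\<bar>u x * P (x - t *\<^sub>R h)\<bar> \<le> \<bar>u x\<bar> * K" for x
      unfolding abs_mult by (intro mult_left_mono P_bd) simp
  qed
  have Vp_int: "integrable cell (\<lambda>x. (V (x + t *\<^sub>R h) \<bullet> h) * \<phi> x)" for t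
    by (rule integrable_cell_mult_test_function(1)[OF Vt_int \<phi>])
  have m3: "(\<lambda>(t, x). (V (x + t *\<^sub>R h) \<bullet> h) * \<phi> x) \<in> borel_measurable (borel \<Otimes>\<^sub>M borel)"
    by measurable
  have b3: "(LINT x|cell. \<bar>(V (x + t *\<^sub>R h) \<bullet> h) * \<phi> x\<bar>) \<le> (LINT x|cell. \<bar>V x \<bullet> h\<bar>) * B" for t
  proof -
    have "(LINT x|cell. \<bar>(V (x + t *\<^sub>R h) \<bullet> h) * \<phi> x\<bar>) \<le> (LINT x|cell. \<bar>V (x + t *\<^sub>R h) \<bullet> h\<bar> * B)"
    proof (rule integral_mono)
      show "integrable cell (\<lambda>x. \<bar>(V (x + t *\<^sub>R h) \<bullet> h) * \<phi> x\<bar>)" using Vp_int by simp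
      show "integrable cell (\<lambda>x. \<bar>V (x + t *\<^sub>R h) \<bullet> h\<bar> * B)" using Vt_int by simp
      show "\<bar>(V (x + t *\<^sub>R h) \<bullet> h) * \<phi> x\<bar> \<le> \<bar>V (x + t *\<^sub>R h) \<bullet> h\<bar> * B" for x
        unfolding abs_mult by (intro mult_left_mono B) simp
    qed
    then show ?thesis by (simp add: Vt_eq)
  qed
  have e1: "(LINT t|uint. P (x - t *\<^sub>R h)) = \<phi> x - \<phi> (x - h)" for x
    unfolding P_def by (rule test_function_FTC[OF \<phi>])
  have "(LINT x|cell. u x * (\<phi> x - \<phi> (x - h))) = (LINT x|cell. LINT t|uint. u x * P (x - t *\<^sub>R h))"
    by (simp add: e1)
  also have "\<dots> = (LINT t|uint. LINT x|cell. u x * P (x - t *\<^sub>R h))"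
    by (rule integral_uint_cell_swap(1)[OF m2 uP_int b2])
  also have "\<dots> = - (LINT t|uint. LINT x|cell. (V (x + t *\<^sub>R h) \<bullet> h) * \<phi> x)"
    unfolding P_def weak_directional[OF \<phi>] by simp
  also have "(LINT t|uint. LINT x|cell. (V (x + t *\<^sub>R h) \<bullet> h) * \<phi> x) = (LINT x|cell. LINT t|uint. (V (x + t *\<^sub>R h) \<bullet> h) * \<phi> x)"
    by (rule integral_uint_cell_swap(1)[OF m3 Vp_int b3, symmetric])
  also have "\<dots> = (LINT x|cell. g x * \<phi> x)" by (simp add: g_def)
  finally have main: "(LINT x|cell. u x * (\<phi> x - \<phi> (x - h))) = - (LINT x|cell. g x * \<phi> x)" .
  have tr: "(LINT x|cell. u (x + h) * \<phi> x) = (LINT x|cell. u x * \<phi> (x - h))"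
  proof -
    have "(LINT x|cell. u (x + h) * \<phi> (x + h + (- h))) = (LINT x|cell. u x * \<phi> (x + (- h)))"
    proof (rule integral_cell_translate)
      show "periodic (\<lambda>x. u x * \<phi> (x + - h))"
        by (rule periodic_comp2[OF u_per periodic_translate[OF test_function_periodic[OF \<phi>]]])
    qed measurable
    then show ?thesis by simp
  qed
  have i1: "integrable cell (\<lambda>x. u x * \<phi> (x - h))"
    using integrable_cell_mult_test_function(1)[OF u_int test_function_translate[OF \<phi>], of "- h"] by simp
  note i2 = integrable_cell_mult_test_function(1)[OF u_int \<phi>] and i3 = integrable_cell_mult_test_function(1)[OF u_tr \<phi>]
    and i4 = integrable_cell_mult_test_function(1)[OF g_int \<phi>]
  have "(LINT x|cell. (u (x + h) - u x - g x) * \<phi> x) = (LINT x|cell. u (x + h) * \<phi> x) - (LINT x|cell. u x * \<phi> x) - (LINT x|cell. g x * \<phi> x)"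
    using i2 i3 i4 by (simp add: left_diff_distrib)
  also have "\<dots> = 0" using main i1 i2 unfolding tr by (simp add: right_diff_distrib)
  finally show "(LINT x|cell. (u (x + h) - u x - (LINT t|uint. V (x + t *\<^sub>R h) \<bullet> h)) * \<phi> x) = 0"
    by (simp add: g_def)
qed

lemma translation_bound:
  "AE x in lborel. ennreal \<bar>u (x + h) - u x\<bar> \<le> ennreal (norm h) * (\<integral>\<^sup>+t. ennreal (norm (V (x + t *\<^sub>R h))) \<partial>uint)"
proof -
  have per: "periodic (\<lambda>x. u (x + h) - u x - (LINT t|uint. V (x + t *\<^sub>R h) \<bullet> h) = 0)"
  proof -
    have swap: "x + k + y = x + y + k" for x k y :: "real ^ 'd"
      by (simp add: add.commute add.left_commute)
    show ?thesis
      unfolding periodic_iff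
    proof (intro allI ballI)
      fix x k :: "real ^ 'd" assume k: "k \<in> int_vecs"
      show "(u (x + k + h) - u (x + k) - (LINT t|uint. V (x + k + t *\<^sub>R h) \<bullet> h) = 0) =
        (u (x + h) - u x - (LINT t|uint. V (x + t *\<^sub>R h) \<bullet> h) = 0)"
        unfolding swap[of x k] periodicD[OF u_per k] periodicD[OF V_per k] ..
    qed
  qed
  have "AE x in lborel. u (x + h) - u x - (LINT t|uint. V (x + t *\<^sub>R h) \<bullet> h) = 0"
    using translation_identity[of h] unfolding AE_cell_periodic[OF per] .
  then show ?thesis
  proof (rule eventually_mono)
    fix x assume eq: "u (x + h) - u x - (LINT t|uint. V (x + t *\<^sub>R h) \<bullet> h) = 0"
    have "ennreal \<bar>u (x + h) - u x\<bar> = ennreal (norm (LINT t|uint. V (x + t *\<^sub>R h) \<bullet> h))"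
      using eq by simp
    also have "\<dots> \<le> (\<integral>\<^sup>+t. ennreal (norm (V (x + t *\<^sub>R h) \<bullet> h)) \<partial>uint)"
    \<comment> \<open>If the integrand is not integrable along the segment, the Bochner integral is
      0 by convention and the bound is trivial.\<close>
    proof (cases "integrable uint (\<lambda>t. V (x + t *\<^sub>R h) \<bullet> h)")
      case True
      then show ?thesis by (rule integral_norm_bound_ennreal)
    qed (simp add: not_integrable_integral_eq)
    also have "\<dots> \<le> (\<integral>\<^sup>+t. ennreal (norm h) * ennreal (norm (V (x + t *\<^sub>R h))) \<partial>uint)"
    proof (rule nn_integral_mono)
      fix t
      have "norm (V (x + t *\<^sub>R h) \<bullet> h) \<le> norm h * norm (V (x + t *\<^sub>R h))"
        using Cauchy_Schwarz_ineq2[of "V (x + t *\<^sub>R h)" h] by (simp add: mult.commute)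
      then show "ennreal (norm (V (x + t *\<^sub>R h) \<bullet> h)) \<le> ennreal (norm h) * ennreal (norm (V (x + t *\<^sub>R h)))"
        by (simp add: ennreal_mult[symmetric] ennreal_leI)
    qed
    also have "\<dots> = ennreal (norm h) * (\<integral>\<^sup>+t. ennreal (norm (V (x + t *\<^sub>R h))) \<partial>uint)"
    proof (rule nn_integral_cmult)
      show "(\<lambda>t. ennreal (norm (V (x + t *\<^sub>R h)))) \<in> borel_measurable uint"
        by (intro measurable_uint) measurable
    qed
    finally show "ennreal \<bar>u (x + h) - u x\<bar> \<le> ennreal (norm h) * (\<integral>\<^sup>+t. ennreal (norm (V (x + t *\<^sub>R h))) \<partial>uint)" .
  qed
qed

end

section \<open>Averages over balls\<close>

definition ball_avg :: "real \<Rightarrow> (real ^ 'd::finite \<Rightarrow> ennreal) \<Rightarrow> real ^ 'd \<Rightarrow> ennreal" where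
  "ball_avg R F x = (\<integral>\<^sup>+y. F y * indicator (ball x R) y \<partial>lborel) / emeasure lborel (ball x R)"

lemma ball_borel [measurable]: "ball (x :: 'a::metric_space) R \<in> sets borel"
  by (rule borel_open) simp

lemma emeasure_ball_cart:
  "0 \<le> R \<Longrightarrow> emeasure lborel (ball (x :: real ^ 'd::finite) R) = ennreal (unit_ball_vol (real CARD('d)) * R ^ CARD('d))"
  using emeasure_ball[of R x] by simp

lemma emeasure_ball_nz:
  "0 < R \<Longrightarrow> emeasure lborel (ball (x :: real ^ 'd::finite) R) \<noteq> 0"
  "0 \<le> R \<Longrightarrow> emeasure lborel (ball (x :: real ^ 'd::finite) R) \<noteq> top"
  by (auto simp: emeasure_ball_cart ennreal_eq_0_iff not_le)

lemma nn_integral_ball_eq: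
  "0 < R \<Longrightarrow> (\<integral>\<^sup>+y. F y * indicator (ball x R) y \<partial>lborel) = ball_avg R F x * emeasure lborel (ball (x :: real ^ 'd::finite) R)"
  by (simp add: ball_avg_def ennreal_divide_times emeasure_ball_nz less_top[symmetric])

lemma nn_integral_ball_translate:
  fixes F :: "real ^ 'd::finite \<Rightarrow> ennreal"
  assumes [measurable]: "F \<in> borel_measurable borel"
  shows "(\<integral>\<^sup>+y. F y * indicator (ball x R) y \<partial>lborel) = (\<integral>\<^sup>+h. F (x + h) * indicator (ball 0 R) h \<partial>lborel)"
proof -
  have "(\<integral>\<^sup>+y. F y * indicator (ball x R) y \<partial>lborel) = (\<integral>\<^sup>+h. F (h + x) * indicator (ball x R) (h + x) \<partial>lborel)"
    by (rule nn_integral_translate[symmetric]) measurable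
  also have "\<dots> = (\<integral>\<^sup>+h. F (x + h) * indicator (ball 0 R) h \<partial>lborel)"
    by (intro nn_integral_cong) (simp add: indicator_def dist_norm add.commute)
  finally show ?thesis .
qed

section \<open>The Poincare inequality and the averages of \<open>u\<close>\<close>

context borel_sobolev
begin

definition grad :: "real ^ 'd \<Rightarrow> ennreal" where
  "grad x = ennreal (norm (V x))"

lemma grad_meas [measurable]: "grad \<in> borel_measurable borel"
  unfolding grad_def by measurable

lemma grad_per: "periodic grad"
  unfolding grad_def by (rule periodic_comp[OF V_per])

lemma translation_bound_grad:
  "AE x in lborel. ennreal \<bar>u (x + h) - u x\<bar> \<le> ennreal (norm h) * (\<integral>\<^sup>+t. grad (x + t *\<^sub>R h) \<partial>uint)"
  unfolding grad_def by (rule translation_bound)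

lemma nn_integral_uint_lborel_swap:
  assumes [measurable]: "(\<lambda>(x, t). F x t) \<in> borel_measurable (borel \<Otimes>\<^sub>M borel)"
  shows "(\<integral>\<^sup>+x. \<integral>\<^sup>+t. F x t \<partial>uint \<partial>lborel) = (\<integral>\<^sup>+t. \<integral>\<^sup>+x. F x t \<partial>(lborel :: (real ^ 'd) measure) \<partial>uint)"
proof -
  interpret pair_sigma_finite uint "lborel :: (real ^ 'd) measure" ..
  have "(\<lambda>(t, x). F x t) \<in> borel_measurable (uint \<Otimes>\<^sub>M lborel)"
    by (rule measurable_pair_borel[OF _ measurable_ident_uint measurable_ident_sets[OF sets_lborel]]) measurable
  from Fubini'[OF this] show ?thesis .
qed

lemma nn_integral_uint_const: "(\<integral>\<^sup>+t. c \<partial>uint) = c"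
  by (simp add: emeasure_uint)

text \<open>Put \<open>w = z + h\<close>. The ball is convex, so the segment from \<open>z\<close>
  to \<open>z + h\<close> stays inside, and for each \<open>t\<close> the integral of
  \<open>grad (z + t *\<^sub>R h)\<close> over those \<open>z\<close> for which the point lies in
  the ball is just the integral of \<open>grad\<close> over the ball. Only shifts with
  \<open>norm h < 2 * R\<close> occur, which explains the volume and the factor
  \<open>2 * R\<close>.\<close>

lemma poincare_ball:
  assumes R: "0 < R"
  shows "(\<integral>\<^sup>+z. (\<integral>\<^sup>+w. ennreal \<bar>u w - u z\<bar> * indicator (ball c R) w \<partial>lborel) * indicator (ball c R) z \<partial>lborel)
    \<le> emeasure lborel (ball (0 :: real ^ 'd) (2 * R)) * (ennreal (2 * R) * (\<integral>\<^sup>+y. grad y * indicator (ball c R) y \<partial>lborel))"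
proof -
  define B where "B = ball c R"
  have B_meas [measurable]: "B \<in> sets borel" by (simp add: B_def)
  define I where "I = (\<integral>\<^sup>+y. grad y * indicator B y \<partial>lborel)"
  have "(\<integral>\<^sup>+z. (\<integral>\<^sup>+w. ennreal \<bar>u w - u z\<bar> * indicator B w \<partial>lborel) * indicator B z \<partial>lborel)
     = (\<integral>\<^sup>+z. (\<integral>\<^sup>+h. ennreal \<bar>u (h + z) - u z\<bar> * indicator B (h + z) \<partial>lborel) * indicator B z \<partial>lborel)"
  proof (rule nn_integral_cong)
    fix z
    have "(\<integral>\<^sup>+h. ennreal \<bar>u (h + z) - u z\<bar> * indicator B (h + z) \<partial>lborel) = (\<integral>\<^sup>+w. ennreal \<bar>u w - u z\<bar> * indicator B w \<partial>lborel)"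
      by (rule nn_integral_translate) measurable
    then show "(\<integral>\<^sup>+w. ennreal \<bar>u w - u z\<bar> * indicator B w \<partial>lborel) * indicator B z =
      (\<integral>\<^sup>+h. ennreal \<bar>u (h + z) - u z\<bar> * indicator B (h + z) \<partial>lborel) * indicator B z" by simp
  qed
  also have "\<dots> = (\<integral>\<^sup>+z. (\<integral>\<^sup>+h. ennreal \<bar>u (h + z) - u z\<bar> * indicator B (h + z) * indicator B z \<partial>lborel) \<partial>lborel)"
    by (intro nn_integral_cong nn_integral_multc[symmetric]) measurable
  \<comment> \<open>The shift \<open>h\<close> has to become the outer variable: the exceptional
    null set of \<open>translation_bound_grad\<close> depends on \<open>h\<close>.\<close>
  also have "\<dots> = (\<integral>\<^sup>+h. (\<integral>\<^sup>+z. ennreal \<bar>u (h + z) - u z\<bar> * indicator B (h + z) * indicator B z \<partial>lborel) \<partial>lborel)"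
    by (rule lborel_pair.Fubini') measurable
  also have "\<dots> \<le> (\<integral>\<^sup>+h. (ennreal (2 * R) * I) * indicator (ball (0 :: real ^ 'd) (2 * R)) h \<partial>lborel)"
  proof (rule nn_integral_mono)
    fix h :: "real ^ 'd"
    show "(\<integral>\<^sup>+z. ennreal \<bar>u (h + z) - u z\<bar> * indicator B (h + z) * indicator B z \<partial>lborel)
       \<le> (ennreal (2 * R) * I) * indicator (ball 0 (2 * R)) h"
    proof (cases "norm h < 2 * R")
      case False
      have zero: "indicator B (h + z) * indicator B z = (0 :: ennreal)" for z
      proof (rule ccontr)
        assume "indicator B (h + z) * indicator B z \<noteq> (0 :: ennreal)"
        then have "dist c (h + z) < R" "dist c z < R" by (auto simp: B_def indicator_def split: if_splits)
        then have "dist (h + z) z < 2 * R" using dist_triangle2[of "h + z" z c] by (simp add: dist_commute)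
        then show False using False by (simp add: dist_norm)
      qed
      have "(\<integral>\<^sup>+z. ennreal \<bar>u (h + z) - u z\<bar> * indicator B (h + z) * indicator B z \<partial>lborel) = (\<integral>\<^sup>+z. 0 \<partial>(lborel :: (real ^ 'd) measure))"
        by (intro nn_integral_cong) (simp only: mult.assoc zero mult_zero_right)
      then show ?thesis by simp
    next
      case True
      have "(\<integral>\<^sup>+z. ennreal \<bar>u (h + z) - u z\<bar> * indicator B (h + z) * indicator B z \<partial>lborel)
        \<le> (\<integral>\<^sup>+z. ennreal (2 * R) * (\<integral>\<^sup>+t. grad (z + t *\<^sub>R h) * indicator B (z + t *\<^sub>R h) \<partial>uint) \<partial>lborel)"
      proof (rule nn_integral_mono_AE, rule eventually_mono[OF translation_bound_grad[of h]])
        fix z assume z: "ennreal \<bar>u (z + h) - u z\<bar> \<le> ennreal (norm h) * (\<integral>\<^sup>+t. grad (z + t *\<^sub>R h) \<partial>uint)"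
        show "ennreal \<bar>u (h + z) - u z\<bar> * indicator B (h + z) * indicator B z
          \<le> ennreal (2 * R) * (\<integral>\<^sup>+t. grad (z + t *\<^sub>R h) * indicator B (z + t *\<^sub>R h) \<partial>uint)"
        proof (cases "h + z \<in> B \<and> z \<in> B")
          case mem: True
          have "z + t *\<^sub>R h \<in> B" if "t \<in> {0..1}" for t
          proof -
            have "z + t *\<^sub>R h = (1 - t) *\<^sub>R z + t *\<^sub>R (h + z)" by (simp add: algebra_simps)
            then show ?thesis
              using convexD_alt[of B z "h + z" t] convex_ball mem that by (auto simp: B_def)
          qed
          then have "(\<integral>\<^sup>+t. grad (z + t *\<^sub>R h) * indicator B (z + t *\<^sub>R h) \<partial>uint) = (\<integral>\<^sup>+t. grad (z + t *\<^sub>R h) \<partial>uint)"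
            by (intro nn_integral_cong) simp
          moreover have "ennreal (norm h) \<le> ennreal (2 * R)" using True by (intro ennreal_leI) simp
          ultimately show ?thesis using z mem order_trans[OF z mult_right_mono] by (simp add: add.commute)
        qed auto
      qed
      also have "\<dots> = ennreal (2 * R) * (\<integral>\<^sup>+z. (\<integral>\<^sup>+t. grad (z + t *\<^sub>R h) * indicator B (z + t *\<^sub>R h) \<partial>uint) \<partial>lborel)"
      proof (rule nn_integral_cmult)
        have "(\<lambda>(z, t). grad (z + t *\<^sub>R h) * indicator B (z + t *\<^sub>R h)) \<in> borel_measurable (borel \<Otimes>\<^sub>M uint)"
          by (rule measurable_pair_borel[OF _ measurable_ident_sets[OF refl] measurable_ident_uint]) measurable
        then show "(\<lambda>z. \<integral>\<^sup>+t. grad (z + t *\<^sub>R h) * indicator B (z + t *\<^sub>R h) \<partial>uint) \<in> borel_measurable lborel"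
          using uint.borel_measurable_nn_integral by simp
      qed
      also have "(\<integral>\<^sup>+z. (\<integral>\<^sup>+t. grad (z + t *\<^sub>R h) * indicator B (z + t *\<^sub>R h) \<partial>uint) \<partial>lborel)
        = (\<integral>\<^sup>+t. (\<integral>\<^sup>+z. grad (z + t *\<^sub>R h) * indicator B (z + t *\<^sub>R h) \<partial>lborel) \<partial>uint)"
        by (rule nn_integral_uint_lborel_swap) measurable
      also have "\<dots> = (\<integral>\<^sup>+t. I \<partial>uint)"
        unfolding I_def by (intro nn_integral_cong nn_integral_translate[of "\<lambda>y. grad y * indicator B y"]) measurable
      also have "\<dots> = I" by (rule nn_integral_uint_const)
      finally show ?thesis using True by simp
    qed
  qed
  also have "\<dots> = (ennreal (2 * R) * I) * emeasure lborel (ball (0 :: real ^ 'd) (2 * R))"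
    by (rule nn_integral_cmult_indicator) simp
  finally show ?thesis by (simp add: B_def I_def mult.commute)
qed

lemma set_integrable_ball: "set_integrable lborel (ball x R) u"
proof -
  obtain n :: nat where n: "\<And>F :: real ^ 'd \<Rightarrow> ennreal. F \<in> borel_measurable borel \<Longrightarrow> periodic F \<Longrightarrow>
     (\<integral>\<^sup>+y. F y * indicator (ball x R) y \<partial>lborel) \<le> of_nat n * (\<integral>\<^sup>+x. F x \<partial>cell)"
    by (rule nn_integral_bounded_le_cell[OF bounded_ball[of x R]]) (rule that)
  have "(\<integral>\<^sup>+y. ennreal \<bar>u y\<bar> * indicator (ball x R) y \<partial>lborel) \<le> of_nat n * (\<integral>\<^sup>+x. ennreal \<bar>u x\<bar> \<partial>cell)"
    by (rule n[OF _ periodic_comp[OF u_per]]) measurable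
  also have "\<dots> < \<infinity>"
    using u_int by (simp add: integrable_iff_bounded ennreal_mult_less_top of_nat_less_top)
  finally show ?thesis
    unfolding set_integrable_def
    by (intro integrableI_bounded) (auto simp: indicator_mult_ennreal abs_mult ennreal_mult' mult.commute ennreal_indicator)
qed

definition u_avg :: "real \<Rightarrow> real ^ 'd \<Rightarrow> real" where
  "u_avg R x = (LINT y:ball x R|lborel. u y) / measure lborel (ball x R)"

text \<open>The triangle inequality for the average of \<open>u - c\<close>, kept multiplied by the
  volume so that no division in \<open>ennreal\<close> arises.\<close>

lemma u_avg_diff_bound:
  assumes R: "0 < R"
  shows "ennreal \<bar>u_avg R x - c\<bar> * emeasure lborel (ball x R) \<le> (\<integral>\<^sup>+y. ennreal \<bar>u y - c\<bar> * indicator (ball x R) y \<partial>lborel)"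
proof -
  define m where "m = measure lborel (ball x R)"
  have m: "0 < m" "emeasure lborel (ball x R) = ennreal m"
    using R by (auto simp: m_def content_ball emeasure_ball_cart)
  have ci: "set_integrable lborel (ball x R) (\<lambda>y. c)"
    unfolding set_integrable_def
    by (intro integrable_scaleR_left integrable_real_indicator)
       (use R emeasure_ball_nz(2)[of R x] in \<open>auto simp: less_top\<close>)
  have "(LINT y:ball x R|lborel. u y - c) = (LINT y:ball x R|lborel. u y) - (LINT y:ball x R|lborel. c)"
    by (rule set_integral_diff(2)[OF set_integrable_ball ci])
  also have "(LINT y:ball x R|lborel. c) = m * c"
    by (simp add: set_lebesgue_integral_def m_def)
  finally have diff: "(LINT y:ball x R|lborel. u y - c) = (LINT y:ball x R|lborel. u y) - m * c" .
  have eq: "(u_avg R x - c) * m = (LINT y:ball x R|lborel. u y - c)"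
  proof -
    have "u_avg R x * m = (LINT y:ball x R|lborel. u y)" using m(1) by (simp add: u_avg_def m_def)
    with diff show ?thesis by (simp add: algebra_simps)
  qed
  have int: "integrable lborel (\<lambda>y. indicator (ball x R) y *\<^sub>R (u y - c))"
    using set_integral_diff(1)[OF set_integrable_ball ci] by (simp add: set_integrable_def)
  have "ennreal \<bar>u_avg R x - c\<bar> * emeasure lborel (ball x R) = ennreal \<bar>LINT y:ball x R|lborel. u y - c\<bar>"
    using m by (simp add: eq[symmetric] abs_mult ennreal_mult)
  also have "\<dots> \<le> (\<integral>\<^sup>+y. norm (indicator (ball x R) y *\<^sub>R (u y - c)) \<partial>lborel)"
    using integral_norm_bound_ennreal[OF int] by (simp add: set_lebesgue_integral_def)
  also have "\<dots> = (\<integral>\<^sup>+y. ennreal \<bar>u y - c\<bar> * indicator (ball x R) y \<partial>lborel)"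
    by (intro nn_integral_cong) (simp add: indicator_def)
  finally show ?thesis .
qed

text \<open>Two uses of \<open>u_avg_diff_bound\<close> bound the difference by the double integral
  in \<open>poincare_ball\<close>. Both small balls have radius at least \<open>R / 2\<close>, and
  \<open>8 ^ CARD('d)\<close> is the volume of the ball of radius \<open>2 * R\<close> times that of
  radius \<open>R\<close>, divided by the square of that of radius \<open>R / 2\<close>.\<close>

lemma u_avg_oscillation:
  assumes R: "0 < R" and s: "R / 2 \<le> s" "ball x s \<subseteq> ball c R" and s': "R / 2 \<le> s'" "ball y s' \<subseteq> ball c R"
  shows "ennreal \<bar>u_avg s x - u_avg s' y\<bar> \<le> ennreal (2 * 8 ^ CARD('d) * R) * ball_avg R grad c"
proof -
  define \<omega> where "\<omega> = unit_ball_vol (real CARD('d))"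
  define d where "d = CARD('d)"
  have \<omega>: "0 < \<omega>" by (simp add: \<omega>_def)
  have vol: "emeasure lborel (ball (z :: real ^ 'd) q) = ennreal (\<omega> * q ^ d)" if "0 \<le> q" for z q
    using that by (simp add: emeasure_ball_cart \<omega>_def d_def)
  have pos: "0 < s" "0 < s'" using R s s' by auto
  let ?A = "ennreal \<bar>u_avg s x - u_avg s' y\<bar>"
  let ?B = "\<lambda>z. indicator (ball c R) z :: ennreal"
  let ?h = "ennreal (\<omega> * (R / 2) ^ d)"
  have "?A * emeasure lborel (ball x s) * emeasure lborel (ball y s')
    \<le> (\<integral>\<^sup>+w. ennreal \<bar>u w - u_avg s' y\<bar> * indicator (ball x s) w \<partial>lborel) * emeasure lborel (ball y s')"
    by (intro mult_right_mono u_avg_diff_bound pos) simp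
  also have "\<dots> = (\<integral>\<^sup>+w. ennreal \<bar>u w - u_avg s' y\<bar> * indicator (ball x s) w * emeasure lborel (ball y s') \<partial>lborel)"
    by (rule nn_integral_multc[symmetric]) measurable
  also have "\<dots> \<le> (\<integral>\<^sup>+w. (\<integral>\<^sup>+z. ennreal \<bar>u z - u w\<bar> * ?B z \<partial>lborel) * ?B w \<partial>lborel)"
  proof (rule nn_integral_mono)
    fix w
    show "ennreal \<bar>u w - u_avg s' y\<bar> * indicator (ball x s) w * emeasure lborel (ball y s')
      \<le> (\<integral>\<^sup>+z. ennreal \<bar>u z - u w\<bar> * ?B z \<partial>lborel) * ?B w"
    proof (cases "w \<in> ball x s")
      case True
      have "ennreal \<bar>u_avg s' y - u w\<bar> * emeasure lborel (ball y s')
        \<le> (\<integral>\<^sup>+z. ennreal \<bar>u z - u w\<bar> * indicator (ball y s') z \<partial>lborel)"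
        by (rule u_avg_diff_bound[OF pos(2)])
      also have "\<dots> \<le> (\<integral>\<^sup>+z. ennreal \<bar>u z - u w\<bar> * ?B z \<partial>lborel)"
        using s'(2) by (intro nn_integral_mono mult_left_mono) (auto simp: indicator_def)
      finally have "ennreal \<bar>u_avg s' y - u w\<bar> * emeasure lborel (ball y s') \<le> (\<integral>\<^sup>+z. ennreal \<bar>u z - u w\<bar> * ?B z \<partial>lborel)" .
      moreover have "?B w = 1" using True s(2) by (auto simp: indicator_def)
      ultimately show ?thesis using True by (simp add: abs_minus_commute)
    qed simp
  qed
  also have "\<dots> \<le> emeasure lborel (ball (0 :: real ^ 'd) (2 * R)) * (ennreal (2 * R) * (\<integral>\<^sup>+y. grad y * indicator (ball c R) y \<partial>lborel))"
    by (rule poincare_ball[OF R])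
  also have "\<dots> = ennreal (\<omega> * (2 * R) ^ d) * (ennreal (2 * R) * (ball_avg R grad c * ennreal (\<omega> * R ^ d)))"
    using R by (simp add: nn_integral_ball_eq vol)
  also have "\<dots> = ennreal (\<omega> * (2 * R) ^ d * (2 * R) * (\<omega> * R ^ d)) * ball_avg R grad c"
    using R \<omega> by (simp add: ennreal_mult mult_ac)
  also have "\<omega> * (2 * R) ^ d * (2 * R) * (\<omega> * R ^ d) = (\<omega> * (R / 2) ^ d) * (\<omega> * (R / 2) ^ d) * (2 * 8 ^ d * R)"
  proof -
    have "(2 * R) ^ d * R ^ d = ((R / 2) * (R / 2) * 8) ^ d"
      unfolding power_mult_distrib[symmetric] by (rule arg_cong[where f="\<lambda>z. z ^ d"]) simp
    then have "(2 * R) ^ d * R ^ d = (R / 2) ^ d * (R / 2) ^ d * 8 ^ d" unfolding power_mult_distrib by simp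
    then have "\<omega> * \<omega> * 2 * R * ((2 * R) ^ d * R ^ d) = \<omega> * \<omega> * 2 * R * ((R / 2) ^ d * (R / 2) ^ d * 8 ^ d)"
      by (rule arg_cong)
    then show ?thesis by (simp only: mult_ac)
  qed
  also have "ennreal ((\<omega> * (R / 2) ^ d) * (\<omega> * (R / 2) ^ d) * (2 * 8 ^ d * R)) * ball_avg R grad c
     = (?h * ?h) * (ennreal (2 * 8 ^ d * R) * ball_avg R grad c)"
    using R \<omega> by (simp add: ennreal_mult mult_ac)
  finally have main: "?A * emeasure lborel (ball x s) * emeasure lborel (ball y s')
    \<le> (?h * ?h) * (ennreal (2 * 8 ^ d * R) * ball_avg R grad c)" .
  have "(R / 2) ^ d \<le> s ^ d" "(R / 2) ^ d \<le> s' ^ d"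
    using R s(1) s'(1) by (auto intro!: power_mono)
  then have "?h \<le> emeasure lborel (ball x s)" "?h \<le> emeasure lborel (ball y s')"
    using pos \<omega> by (auto simp: vol intro!: ennreal_leI)
  then have "(?h * ?h) * ?A \<le> emeasure lborel (ball x s) * emeasure lborel (ball y s') * ?A"
    by (intro mult_right_mono mult_mono) auto
  also have "\<dots> = ?A * emeasure lborel (ball x s) * emeasure lborel (ball y s')" by (simp only: mult_ac)
  also note main
  finally have "(?h * ?h) * ?A \<le> (?h * ?h) * (ennreal (2 * 8 ^ d * R) * ball_avg R grad c)" .
  moreover have "?h * ?h \<noteq> 0" "?h * ?h \<noteq> top"
    using R \<omega> by (auto simp: ennreal_mult[symmetric] ennreal_eq_0_iff not_le)
  ultimately show ?thesis by (subst (asm) ennreal_mult_le_mult_iff) (auto simp: d_def)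
qed

lemma u_avg_translate: "u_avg R x = (LINT h|lborel. indicator (ball 0 R) h *\<^sub>R u (x + h)) / measure lborel (ball x R)"
proof -
  have "(LINT y:ball x R|lborel. u y) = (LINT y|distr lborel borel ((+) x). indicator (ball x R) y *\<^sub>R u y)"
    by (simp add: set_lebesgue_integral_def lborel_distr_plus)
  also have "\<dots> = (LINT h|lborel. indicator (ball x R) (x + h) *\<^sub>R u (x + h))"
    by (rule integral_distr) measurable
  also have "\<dots> = (LINT h|lborel. indicator (ball 0 R) h *\<^sub>R u (x + h))"
    by (intro Bochner_Integration.integral_cong) (auto simp: indicator_def dist_norm)
  finally show ?thesis by (simp add: u_avg_def)
qed

lemma u_avg_meas [measurable]:
  assumes R: "0 < R" shows "u_avg R \<in> borel_measurable borel"
proof -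
  have "u_avg R = (\<lambda>x. (LINT h|lborel. indicator (ball 0 R) h *\<^sub>R u (x + h)) / measure lborel (ball (0 :: real ^ 'd) R))"
    using R by (simp add: fun_eq_iff u_avg_translate content_ball)
  moreover have "(\<lambda>x. LINT h|lborel. indicator (ball 0 R) h *\<^sub>R u (x + h)) \<in> borel_measurable borel"
    by (intro lborel.borel_measurable_lebesgue_integral) measurable
  ultimately show ?thesis by simp
qed

lemma u_avg_periodic: "0 < R \<Longrightarrow> periodic (u_avg R)"
  unfolding periodic_iff
proof (intro allI ballI)
  fix x k :: "real ^ 'd" assume k: "k \<in> int_vecs" and R: "0 < R"
  have "u (x + k + h) = u (x + h)" for h
    using periodicD[OF u_per k, of "x + h"] by (simp add: add.commute add.left_commute)
  then show "u_avg R (x + k) = u_avg R x"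
    using R by (simp add: u_avg_translate content_ball)
qed

text \<open>For each \<open>h\<close> in the ball, the L1 distance of \<open>u\<close> from its
  translate by \<open>h\<close> is at most \<open>R\<close> times the L1 norm of the gradient; then
  average over \<open>h\<close>. The linear rate in \<open>R\<close> is what makes the errors
  summable over dyadic radii in \<open>AE_rep\<close>.\<close>

lemma u_avg_L1_error:
  assumes R: "0 < R"
  shows "(\<integral>\<^sup>+x. ennreal \<bar>u_avg R x - u x\<bar> \<partial>cell) \<le> ennreal R * (\<integral>\<^sup>+x. grad x \<partial>cell)"
proof -
  interpret P: pair_sigma_finite cell "lborel :: (real ^ 'd) measure" ..
  interpret Q: pair_sigma_finite uint "cell :: (real ^ 'd) measure" ..
  let ?m = "emeasure lborel (ball (0 :: real ^ 'd) R)"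
  have m: "emeasure lborel (ball x R) = ?m" for x :: "real ^ 'd" using R by (simp add: emeasure_ball_cart)
  have mnz: "?m \<noteq> 0" "?m \<noteq> top" using R emeasure_ball_nz[of R "0 :: real ^ 'd"] by auto
  have [measurable]: "u_avg R \<in> borel_measurable borel" by (rule u_avg_meas[OF R])
  have "?m * (\<integral>\<^sup>+x. ennreal \<bar>u_avg R x - u x\<bar> \<partial>cell) = (\<integral>\<^sup>+x. ?m * ennreal \<bar>u_avg R x - u x\<bar> \<partial>cell)"
    by (rule nn_integral_cmult[symmetric]) (intro measurable_cell, measurable)
  also have "\<dots> \<le> (\<integral>\<^sup>+x. (\<integral>\<^sup>+h. ennreal \<bar>u (x + h) - u x\<bar> * indicator (ball 0 R) h \<partial>lborel) \<partial>cell)"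
  proof (rule nn_integral_mono)
    fix x
    have "?m * ennreal \<bar>u_avg R x - u x\<bar> \<le> (\<integral>\<^sup>+y. ennreal \<bar>u y - u x\<bar> * indicator (ball x R) y \<partial>lborel)"
      using u_avg_diff_bound[OF R, of x "u x"] unfolding m[of x] by (simp only: mult.commute)
    also have "\<dots> = (\<integral>\<^sup>+h. ennreal \<bar>u (x + h) - u x\<bar> * indicator (ball 0 R) h \<partial>lborel)"
      by (rule nn_integral_ball_translate) measurable
    finally show "?m * ennreal \<bar>u_avg R x - u x\<bar> \<le> (\<integral>\<^sup>+h. ennreal \<bar>u (x + h) - u x\<bar> * indicator (ball 0 R) h \<partial>lborel)" .
  qed
  also have "\<dots> = (\<integral>\<^sup>+h. (\<integral>\<^sup>+x. ennreal \<bar>u (x + h) - u x\<bar> * indicator (ball 0 R) h \<partial>cell) \<partial>lborel)"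
    by (rule P.Fubini'[symmetric], rule measurable_pair_borel[OF _ measurable_ident_cell measurable_ident_sets[OF sets_lborel]]) measurable
  also have "\<dots> \<le> (\<integral>\<^sup>+h. (ennreal R * (\<integral>\<^sup>+x. grad x \<partial>cell)) * indicator (ball (0 :: real ^ 'd) R) h \<partial>lborel)"
  proof (rule nn_integral_mono)
    fix h :: "real ^ 'd"
    show "(\<integral>\<^sup>+x. ennreal \<bar>u (x + h) - u x\<bar> * indicator (ball 0 R) h \<partial>cell) \<le> (ennreal R * (\<integral>\<^sup>+x. grad x \<partial>cell)) * indicator (ball (0 :: real ^ 'd) R) h"
    proof (cases "norm h < R")
      case True
      have mg: "(\<lambda>(t, x). grad (x + t *\<^sub>R h)) \<in> borel_measurable (uint \<Otimes>\<^sub>M cell)"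
        by (rule measurable_uint_cell) measurable
      have "AE x in cell. ennreal \<bar>u (x + h) - u x\<bar> \<le> ennreal R * (\<integral>\<^sup>+t. grad (x + t *\<^sub>R h) \<partial>uint)"
        unfolding AE_cell_iff
      proof (rule eventually_mono[OF translation_bound_grad[of h]], rule impI)
        fix x assume *: "ennreal \<bar>u (x + h) - u x\<bar> \<le> ennreal (norm h) * (\<integral>\<^sup>+t. grad (x + t *\<^sub>R h) \<partial>uint)"
        have "ennreal (norm h) \<le> ennreal R" using True by (intro ennreal_leI) simp
        then show "ennreal \<bar>u (x + h) - u x\<bar> \<le> ennreal R * (\<integral>\<^sup>+t. grad (x + t *\<^sub>R h) \<partial>uint)"
          by (intro order_trans[OF * mult_right_mono]) simp_all
      qed
      then have "(\<integral>\<^sup>+x. ennreal \<bar>u (x + h) - u x\<bar> \<partial>cell) \<le> (\<integral>\<^sup>+x. ennreal R * (\<integral>\<^sup>+t. grad (x + t *\<^sub>R h) \<partial>uint) \<partial>cell)"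
        by (rule nn_integral_mono_AE)
      also have "\<dots> = ennreal R * (\<integral>\<^sup>+x. (\<integral>\<^sup>+t. grad (x + t *\<^sub>R h) \<partial>uint) \<partial>cell)"
      proof (rule nn_integral_cmult)
        have "(\<lambda>(x, t). grad (x + t *\<^sub>R h)) \<in> borel_measurable (cell \<Otimes>\<^sub>M uint)"
          by (rule measurable_pair_borel[OF _ measurable_ident_cell measurable_ident_uint]) measurable
        then show "(\<lambda>x. \<integral>\<^sup>+t. grad (x + t *\<^sub>R h) \<partial>uint) \<in> borel_measurable cell"
          by (rule uint.borel_measurable_nn_integral)
      qed
      also have "(\<integral>\<^sup>+x. (\<integral>\<^sup>+t. grad (x + t *\<^sub>R h) \<partial>uint) \<partial>cell) = (\<integral>\<^sup>+t. (\<integral>\<^sup>+x. grad (x + t *\<^sub>R h) \<partial>cell) \<partial>uint)"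
        using Q.Fubini'[OF mg] .
      also have "\<dots> = (\<integral>\<^sup>+t. (\<integral>\<^sup>+x. grad x \<partial>cell) \<partial>uint)"
        by (intro nn_integral_cong nn_integral_cell_translate grad_meas grad_per)
      also have "\<dots> = (\<integral>\<^sup>+x. grad x \<partial>cell)" by (rule nn_integral_uint_const)
      finally show ?thesis using True by simp
    qed simp
  qed
  also have "\<dots> = (ennreal R * (\<integral>\<^sup>+x. grad x \<partial>cell)) * ?m"
    by (rule nn_integral_cmult_indicator) simp
  finally have "?m * (\<integral>\<^sup>+x. ennreal \<bar>u_avg R x - u x\<bar> \<partial>cell) \<le> ?m * (ennreal R * (\<integral>\<^sup>+x. grad x \<partial>cell))"
    by (simp add: mult.commute)
  then show ?thesis using mnz by (simp add: ennreal_mult_le_mult_iff)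
qed

end

section \<open>The maximal function\<close>

lemma epow_ennreal: "0 \<le> x \<Longrightarrow> epow (ennreal x) a = ennreal (x powr a)"
  by (simp add: epow_def)

lemma epow_top [simp]: "epow top a = top"
  by (simp add: epow_def)

lemma epow_0 [simp]: "epow 0 a = 0"
  by (simp add: epow_def)

lemma epow_1 [simp]: "epow x 1 = x"
  by (cases x) (auto simp: epow_ennreal)

lemma epow_mono: "0 \<le> a \<Longrightarrow> x \<le> y \<Longrightarrow> epow x a \<le> epow y a"
  by (cases x; cases y) (auto simp: epow_ennreal powr_mono2 top_unique intro!: ennreal_leI)

lemma epow_mult: "epow (x * y) a = epow x a * epow y a"
proof (cases "x = top \<or> y = top")
  case True
  then show ?thesis
    by (cases x; cases y) (auto simp: epow_ennreal ennreal_mult_top ennreal_top_mult)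
next
  case False
  then show ?thesis
    by (cases x; cases y) (auto simp: ennreal_mult[symmetric] epow_ennreal powr_mult)
qed

lemma epow_epow: "epow (epow x a) b = epow x (a * b)"
  by (cases x) (auto simp: epow_ennreal powr_powr)

lemma epow_add: "epow x a * epow x b = epow x (a + b)"
  by (cases x) (auto simp: epow_ennreal powr_add ennreal_mult[symmetric] ennreal_top_mult)

lemma epow_less_top: "epow x a < top \<longleftrightarrow> x < top"
  by (cases x) (auto simp: epow_ennreal)

lemma epow_eq_0: "epow x a = 0 \<longleftrightarrow> x = 0"
  by (cases x) (auto simp: epow_ennreal ennreal_eq_0_iff)

lemma epow_measurable [measurable]: "(\<lambda>x. epow x a) \<in> borel_measurable borel"
  unfolding epow_def by measurable

lemma layer_cake_epow_le:
  assumes s: "0 < s" and a: "0 \<le> a"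
  shows "(\<integral>\<^sup>+t. ennreal (s * t powr (s - 1)) * indicator {t. 0 < t \<and> t < a} t \<partial>lborel) = ennreal (a powr s)"
proof -
  let ?f = "\<lambda>t. if t \<in> {0..a} then s * t powr (s - 1) else 0"
  have "((\<lambda>t. t powr (s - 1)) has_integral (a powr (s - 1 + 1) / (s - 1 + 1))) {0..a}"
    using s a by (intro has_integral_powr_from_0) auto
  from has_integral_mult_right[OF this, of s]
  have "((\<lambda>t. s * t powr (s - 1)) has_integral (a powr s)) {0..a}" using s by simp
  then have "(?f has_integral (a powr s)) UNIV" by (simp only: has_integral_restrict_UNIV)
  then have "(\<integral>\<^sup>+t. ennreal (?f t) \<partial>lborel) = ennreal (a powr s)"
    using s by (intro nn_integral_has_integral_lborel) auto
  moreover have "(\<integral>\<^sup>+t. ennreal (s * t powr (s - 1)) * indicator {t. 0 < t \<and> t < a} t \<partial>lborel) = (\<integral>\<^sup>+t. ennreal (?f t) \<partial>lborel)"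
  proof (rule nn_integral_cong_AE)
    have "AE t in lborel. t \<notin> {0 :: real}" by (intro AE_not_in finite_imp_null_set_lborel) simp
    moreover have "AE t in lborel. t \<notin> {a :: real}" by (intro AE_not_in finite_imp_null_set_lborel) simp
    ultimately show "AE t in lborel. ennreal (s * t powr (s - 1)) * indicator {t. 0 < t \<and> t < a} t = ennreal (?f t)"
      by eventually_elim (auto simp: indicator_def)
  qed
  ultimately show ?thesis by simp
qed

text \<open>Stated for a single value, so that integrals of powers become iterated integrals over
  levels and points. For infinite \<open>X\<close> the integral dominates every finite
  \<open>b\<close>: restrict it to the levels below \<open>b powr (1 / s)\<close>.\<close>

lemma layer_cake_epow:
  assumes s: "0 < s"
  shows "(\<integral>\<^sup>+t. ennreal (s * t powr (s - 1)) * indicator {t. 0 < t \<and> ennreal t < X} t \<partial>lborel) = epow X s"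
    (is "?I = _")
proof (cases X)
  case (real a)
  have "{t. 0 < t \<and> ennreal t < X} = {t. 0 < t \<and> t < a}"
    using real by (auto simp: ennreal_less_iff)
  then show ?thesis using layer_cake_epow_le[OF s real(1)] real by (simp add: epow_ennreal)
next
  case top
  have "ennreal b \<le> ?I" if "0 \<le> b" for b
  proof -
    let ?a = "b powr (1 / s)"
    have "ennreal b = ennreal (?a powr s)" using s that by (simp add: powr_powr)
    also have "\<dots> = (\<integral>\<^sup>+t. ennreal (s * t powr (s - 1)) * indicator {t. 0 < t \<and> t < ?a} t \<partial>lborel)"
      by (rule layer_cake_epow_le[OF s, symmetric]) simp
    also have "\<dots> \<le> ?I"
      using top by (intro nn_integral_mono mult_left_mono) (auto simp: indicator_def)
    finally show ?thesis .
  qed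
  note ge = this
  show ?thesis
  proof (cases "?I")
    case (real r)
    then show ?thesis using ge[of "r + 1"] by simp
  qed (use top in simp)
qed

text \<open>A countable family of radii makes the supremum measurable at once, and since the radii
  are at most \<open>R\<close>, the balls centred in the cell stay in a fixed bounded set.\<close>

definition max_fn :: "real \<Rightarrow> (real ^ 'd::finite \<Rightarrow> ennreal) \<Rightarrow> real ^ 'd \<Rightarrow> ennreal" where
  "max_fn R F x = (SUP n. ball_avg (R / 2 ^ n) F x)"

lemma ball_avg_le_max_fn: "ball_avg (R / 2 ^ n) F x \<le> max_fn R F x"
  unfolding max_fn_def by (rule SUP_upper) simp

lemma ball_avg_translate:
  fixes F :: "real ^ 'd::finite \<Rightarrow> ennreal"
  assumes "F \<in> borel_measurable borel" and R: "0 < R"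
  shows "ball_avg R F x = (\<integral>\<^sup>+h. F (x + h) * indicator (ball 0 R) h \<partial>lborel) / emeasure lborel (ball (0 :: real ^ 'd) R)"
proof -
  have "emeasure lborel (ball x R) = emeasure lborel (ball (0 :: real ^ 'd) R)"
    using R by (simp add: emeasure_ball_cart)
  then show ?thesis using nn_integral_ball_translate[OF assms(1), of x R] by (simp only: ball_avg_def)
qed

lemma ball_avg_meas [measurable]:
  fixes F :: "real ^ 'd::finite \<Rightarrow> ennreal"
  assumes [measurable]: "F \<in> borel_measurable borel" and R: "0 < R"
  shows "ball_avg R F \<in> borel_measurable borel"
proof -
  have "ball_avg R F = (\<lambda>x. (\<integral>\<^sup>+h. F (x + h) * indicator (ball 0 R) h \<partial>lborel) / emeasure lborel (ball (0 :: real ^ 'd) R))"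
    by (intro ext ball_avg_translate assms)
  moreover have "(\<lambda>x. \<integral>\<^sup>+h. F (x + h) * indicator (ball 0 R) h \<partial>lborel) \<in> borel_measurable borel"
    by (intro lborel.borel_measurable_nn_integral) measurable
  ultimately show ?thesis by simp
qed

lemma max_fn_meas [measurable]:
  fixes F :: "real ^ 'd::finite \<Rightarrow> ennreal"
  assumes [measurable]: "F \<in> borel_measurable borel" and R: "0 < R"
  shows "max_fn R F \<in> borel_measurable borel"
proof -
  have [measurable]: "ball_avg (R / 2 ^ n) F \<in> borel_measurable borel" for n
    by (rule ball_avg_meas) (use R in simp_all)
  show ?thesis unfolding max_fn_def [abs_def] by measurable
qed

lemma max_fn_periodic:
  fixes F :: "real ^ 'd::finite \<Rightarrow> ennreal"
  assumes [measurable]: "F \<in> borel_measurable borel" and per: "periodic F" and R: "0 < R"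
  shows "periodic (max_fn R F)"
  unfolding periodic_iff
proof (intro allI ballI)
  fix x k :: "real ^ 'd" assume k: "k \<in> int_vecs"
  have "F (x + k + h) = F (x + h)" for h
    using periodicD[OF per k, of "x + h"] by (simp add: add.commute add.left_commute)
  then have "ball_avg q F (x + k) = ball_avg q F x" if "0 < q" for q
    unfolding ball_avg_translate[OF assms(1) that] by simp
  then show "max_fn R F (x + k) = max_fn R F x" using R by (simp add: max_fn_def)
qed

lemma ball_avg_mono: "(\<And>y. F y \<le> G y) \<Longrightarrow> ball_avg R F x \<le> ball_avg R G x"
  unfolding ball_avg_def by (intro divide_right_mono_ennreal nn_integral_mono mult_right_mono) auto

lemma ball_avg_cong_AE: "AE y in lborel. F y = G y \<Longrightarrow> ball_avg R F x = ball_avg R G x"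
  unfolding ball_avg_def by (intro arg_cong2[where f="(/)"] nn_integral_cong_AE) (auto elim!: eventually_mono)

lemma max_fn_mono: "(\<And>y. F y \<le> G y) \<Longrightarrow> max_fn R F x \<le> max_fn R G x"
  unfolding max_fn_def by (intro SUP_mono' ball_avg_mono)

lemma max_fn_cong_AE: "AE y in lborel. F y = G y \<Longrightarrow> max_fn R F x = max_fn R G x"
  unfolding max_fn_def by (intro SUP_cong ball_avg_cong_AE) auto

lemma ball_avg_const:
  "0 < R \<Longrightarrow> ball_avg R (\<lambda>_. c) (x :: real ^ 'd::finite) = c"
  by (simp add: ball_avg_def nn_integral_cmult_indicator ennreal_mult_divide_eq emeasure_ball_nz)

lemma ball_avg_add:
  assumes [measurable]: "F \<in> borel_measurable borel" "G \<in> borel_measurable borel"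
  shows "ball_avg R (\<lambda>y. F y + G y) x = ball_avg R F x + ball_avg R G x"
  unfolding ball_avg_def by (simp add: distrib_right nn_integral_add add_divide_distrib_ennreal)

lemma ball_avg_cmult:
  assumes [measurable]: "F \<in> borel_measurable borel"
  shows "ball_avg R (\<lambda>y. c * F y) x = c * ball_avg R F x"
  unfolding ball_avg_def by (simp add: mult.assoc nn_integral_cmult ennreal_times_divide)

lemma max_fn_linear_bound:
  assumes [measurable]: "F \<in> borel_measurable borel" "G \<in> borel_measurable borel"
  shows "max_fn R (\<lambda>y. a * F y + b * G y) x \<le> a * max_fn R F x + b * max_fn R G x"
  unfolding max_fn_def [of R "\<lambda>y. a * F y + b * G y"]
  by (intro SUP_least) (auto simp: ball_avg_add ball_avg_cmult intro!: add_mono mult_left_mono ball_avg_le_max_fn)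

section \<open>Weak and strong type estimates for the maximal function\<close>

lemma nn_integral_count_space_ge: "i \<in> I \<Longrightarrow> f i \<le> (\<integral>\<^sup>+j. f j \<partial>count_space I)"
proof -
  assume i: "i \<in> I"
  have "f i = (\<integral>\<^sup>+j. f i * indicator {i} j \<partial>count_space I)"
    using i by (subst nn_integral_cmult_indicator) auto
  also have "\<dots> \<le> (\<integral>\<^sup>+j. f j \<partial>count_space I)"
    by (intro nn_integral_mono) (auto simp: indicator_def)
  finally show ?thesis .
qed

text \<open>Each point of the superlevel set is the centre of a ball on which the average of
  \<open>F\<close> exceeds \<open>s\<close>. By Vitali's lemma a countable disjoint subfamily,
  enlarged five times, covers the set. Its balls lie in the \<open>R\<close>-neighbourhood
  \<open>S\<close> of the cell, so their integrals add up to at most \<open>n\<close> times the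
  integral over the cell. Hence the constant \<open>5 ^ CARD('d) * real n\<close>.\<close>

lemma max_fn_weak_type:
  assumes R: "0 < R"
  obtains c :: real where "0 \<le> c" "\<And>(F :: real ^ 'd::finite \<Rightarrow> ennreal) s. F \<in> borel_measurable borel \<Longrightarrow> periodic F \<Longrightarrow> 0 < s \<Longrightarrow>
    emeasure lborel {x \<in> unit_cell. ennreal s < max_fn R F x} * ennreal s \<le> ennreal c * (\<integral>\<^sup>+x. F x \<partial>cell)"
proof -
  define S where "S = (\<Union>x\<in>unit_cell. ball (x :: real ^ 'd) R)"
  have "bounded S"
  proof -
    obtain B where B: "\<And>x. x \<in> cbox 0 (1 :: real ^ 'd) \<Longrightarrow> norm x \<le> B"
      using bounded_cbox[of 0 "1 :: real ^ 'd"] by (auto simp: bounded_iff)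
    have "norm y \<le> B + R" if "y \<in> S" for y
    proof -
      from that obtain x where x: "x \<in> unit_cell" "dist x y < R" by (auto simp: S_def)
      have "norm y \<le> norm x + dist x y" using norm_triangle_sub[of y x] by (simp add: dist_norm norm_minus_commute)
      then show ?thesis using B[of x] x unit_cell_subset_cbox by fastforce
    qed
    then show ?thesis by (auto simp: bounded_iff)
  qed
  then obtain n :: nat where n: "\<And>F :: real ^ 'd \<Rightarrow> ennreal. F \<in> borel_measurable borel \<Longrightarrow> periodic F \<Longrightarrow>
     (\<integral>\<^sup>+x. F x * indicator S x \<partial>lborel) \<le> of_nat n * (\<integral>\<^sup>+x. F x \<partial>cell)"
    by (rule nn_integral_bounded_le_cell) (rule that)
  define c where "c = 5 ^ CARD('d) * real n"
  show ?thesis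
  proof (rule that[of c])
    show "0 \<le> c" by (simp add: c_def)
    fix F :: "real ^ 'd \<Rightarrow> ennreal" and s :: real
    assume F [measurable]: "F \<in> borel_measurable borel" and per: "periodic F" and s: "0 < s"
    define E where "E = {x \<in> unit_cell. ennreal s < max_fn R F x}"
    have "\<forall>x\<in>E. \<exists>k. ennreal s < ball_avg (R / 2 ^ k) F x"
      by (auto simp: E_def max_fn_def less_SUP_iff)
    then obtain k where k: "\<And>x. x \<in> E \<Longrightarrow> ennreal s < ball_avg (R / 2 ^ k x) F x"
      using bchoice[of E "\<lambda>x k. ennreal s < ball_avg (R / 2 ^ k) F x"] by auto
    define r where "r x = R / 2 ^ k x" for x
    let ?I = "\<lambda>x. \<integral>\<^sup>+y. F y * indicator (ball x (r x)) y \<partial>lborel"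
    have r: "0 < r x" "r x \<le> R" for x
      using R by (auto simp: r_def divide_le_eq mult_le_cancel_left1)
    have cov: "E \<subseteq> (\<Union>x\<in>E. ball x (r x))" using r(1) by force
    obtain C where C: "countable C" "C \<subseteq> E" "pairwise (\<lambda>i j. disjnt (ball i (r i)) (ball j (r j))) C"
      "E \<subseteq> (\<Union>x\<in>C. ball x (5 * r x))"
      by (rule Vitali_covering_lemma_balls[OF cov, of R]) (use r in blast)+
    have vol5: "emeasure lborel (ball x (5 * r x)) = ennreal (5 ^ CARD('d)) * emeasure lborel (ball x (r x))" for x :: "real ^ 'd"
      using r(1)[of x] by (simp add: emeasure_ball_cart power_mult_distrib ennreal_mult[symmetric] mult_ac)
    have E_meas [measurable]: "E \<in> sets lborel"
    proof -
      have [measurable]: "max_fn R F \<in> borel_measurable borel" by (rule max_fn_meas[OF F R])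
      have "E = unit_cell \<inter> {x \<in> space borel. ennreal s < max_fn R F x}" by (auto simp: E_def)
      also have "\<dots> \<in> sets borel" by measurable
      finally show ?thesis by simp
    qed
    have "emeasure lborel E * ennreal s = (\<integral>\<^sup>+y. indicator E y \<partial>lborel) * ennreal s"
      by (subst nn_integral_indicator[OF E_meas]) (rule refl)
    also have "\<dots> \<le> (\<integral>\<^sup>+y. (\<integral>\<^sup>+x. indicator (ball x (5 * r x)) y \<partial>count_space C) \<partial>lborel) * ennreal s"
    proof (intro mult_right_mono nn_integral_mono)
      fix y
      show "indicator E y \<le> (\<integral>\<^sup>+x. indicator (ball x (5 * r x)) y \<partial>count_space C)"
      proof (cases "y \<in> E")
        case True
        then obtain x where x: "x \<in> C" "y \<in> ball x (5 * r x)" using C(4) by blast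
        then have "(1 :: ennreal) = indicator (ball x (5 * r x)) y" by simp
        also have "\<dots> \<le> (\<integral>\<^sup>+x. indicator (ball x (5 * r x)) y \<partial>count_space C)"
          by (rule nn_integral_count_space_ge[OF x(1)])
        finally show ?thesis using True by simp
      qed simp
    qed simp
    also have "(\<integral>\<^sup>+y. (\<integral>\<^sup>+x. indicator (ball x (5 * r x)) y \<partial>count_space C) \<partial>lborel) = (\<integral>\<^sup>+x. (\<integral>\<^sup>+y. indicator (ball x (5 * r x)) y \<partial>lborel) \<partial>count_space C)"
      by (rule nn_integral_count_space_nn_integral[OF C(1)]) measurable
    also have "\<dots> * ennreal s = (\<integral>\<^sup>+x. (\<integral>\<^sup>+y. indicator (ball x (5 * r x)) y \<partial>lborel) * ennreal s \<partial>count_space C)"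
      by (rule nn_integral_multc[symmetric]) simp
    also have "\<dots> = (\<integral>\<^sup>+x. ennreal (5 ^ CARD('d)) * (ennreal s * emeasure lborel (ball x (r x))) \<partial>count_space C)"
      by (rule nn_integral_cong) (subst nn_integral_indicator, simp, subst vol5, simp only: mult_ac)
    also have "\<dots> \<le> (\<integral>\<^sup>+x. ennreal (5 ^ CARD('d)) * ?I x \<partial>count_space C)"
    proof (intro nn_integral_mono mult_left_mono)
      fix x assume "x \<in> space (count_space C)"
      then have "ennreal s \<le> ball_avg (r x) F x" using k C(2) by (force simp: r_def)
      then show "ennreal s * emeasure lborel (ball x (r x)) \<le> ?I x"
        by (simp add: nn_integral_ball_eq[OF r(1)] mult_right_mono)
    qed simp
    also have "\<dots> = ennreal (5 ^ CARD('d)) * (\<integral>\<^sup>+x. ?I x \<partial>count_space C)"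
      by (rule nn_integral_cmult) simp
    also have "(\<integral>\<^sup>+x. ?I x \<partial>count_space C) = (\<integral>\<^sup>+y. (\<integral>\<^sup>+x. F y * indicator (ball x (r x)) y \<partial>count_space C) \<partial>lborel)"
      by (rule nn_integral_count_space_nn_integral[OF C(1), symmetric]) measurable
    \<comment> \<open>The chosen balls are disjoint and contained in \<open>S\<close>, so every
      \<open>y\<close> is counted at most once.\<close>
    also have "\<dots> \<le> (\<integral>\<^sup>+y. F y * indicator S y \<partial>lborel)"
    proof (rule nn_integral_mono)
      fix y
      show "(\<integral>\<^sup>+x. F y * indicator (ball x (r x)) y \<partial>count_space C) \<le> F y * indicator S y"
      proof (cases "\<exists>x\<in>C. y \<in> ball x (r x)")
        case True
        then obtain x where x: "x \<in> C" "y \<in> ball x (r x)" by blast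
        have uniq: "x' = x" if "x' \<in> C" "y \<in> ball x' (r x')" for x'
          using C(3) x that unfolding pairwise_def disjnt_def by blast
        have "(\<integral>\<^sup>+x. F y * indicator (ball x (r x)) y \<partial>count_space C) = (\<Sum>x\<in>{x}. F y * indicator (ball x (r x)) y)"
        proof (rule nn_integral_count_space')
          fix x' assume "x' \<in> C" "x' \<notin> {x}"
          then have "y \<notin> ball x' (r x')" using uniq by blast
          then show "F y * indicator (ball x' (r x')) y = 0" by simp
        qed (use x in simp_all)
        also have "\<dots> = F y" using x by simp
        also have "y \<in> S"
        proof -
          have "x \<in> unit_cell" using x C(2) by (auto simp: E_def)
          moreover have "y \<in> ball x R" using x r(2)[of x] by auto
          ultimately show ?thesis unfolding S_def by blast
        qed
        then have "F y = F y * indicator S y" by simp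
        finally show ?thesis by simp
      next
        case False
        then have "(\<integral>\<^sup>+x. F y * indicator (ball x (r x)) y \<partial>count_space C) = (\<integral>\<^sup>+x. 0 \<partial>count_space C)"
          by (intro nn_integral_cong) (auto simp: indicator_def)
        then show ?thesis by simp
      qed
    qed
    also have "\<dots> \<le> of_nat n * (\<integral>\<^sup>+x. F x \<partial>cell)" by (rule n[OF F per])
    finally have "emeasure lborel E * ennreal s \<le> ennreal (5 ^ CARD('d)) * (of_nat n * (\<integral>\<^sup>+x. F x \<partial>cell))"
      by (simp add: mult_left_mono)
    then show "emeasure lborel {x \<in> unit_cell. ennreal s < max_fn R F x} * ennreal s \<le> ennreal c * (\<integral>\<^sup>+x. F x \<partial>cell)"
      by (simp add: E_def c_def ennreal_mult ennreal_of_nat_eq_real_of_nat mult.assoc)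
  qed
qed

text \<open>Marcinkiewicz interpolation between the weak type bound and the trivial bound for
  bounded functions: at level \<open>s\<close> the weak bound is applied only to the part of
  \<open>F\<close> above \<open>s / 2\<close>, and the layer-cake formula is used before and after
  exchanging levels and points.\<close>

lemma max_fn_strong_type:
  assumes R: "0 < R" and q: "1 < q"
  obtains c :: real where "0 \<le> c" "\<And>F :: real ^ 'd::finite \<Rightarrow> ennreal. F \<in> borel_measurable borel \<Longrightarrow> periodic F \<Longrightarrow>
    (\<integral>\<^sup>+x. epow (max_fn R F x) q \<partial>cell) \<le> ennreal c * (\<integral>\<^sup>+x. epow (F x) q \<partial>cell)"
proof -
  obtain c0 where c0: "0 \<le> c0" "\<And>(F :: real ^ 'd::finite \<Rightarrow> ennreal) s. F \<in> borel_measurable borel \<Longrightarrow> periodic F \<Longrightarrow> 0 < s \<Longrightarrow>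
    emeasure lborel {x \<in> unit_cell. ennreal s < max_fn R F x} * ennreal s \<le> ennreal c0 * (\<integral>\<^sup>+x. F x \<partial>cell)"
    by (rule max_fn_weak_type[OF R]) (rule that)
  \<comment> \<open>The factor 2 comes from applying the weak bound at level \<open>s / 2\<close>,
    and \<open>q\<close> from the layer-cake weight for the exponent \<open>q\<close>. Division by
    \<open>q - 1\<close> normalises the remaining weight to that for the exponent
    \<open>q - 1\<close>, which leaves \<open>epow (2 * F x) (q - 1)\<close> and thus the factor
    \<open>2 powr (q - 1)\<close> in \<open>c\<close>.\<close>
  define K where "K = 2 * c0 * q / (q - 1)"
  have K: "0 \<le> K" using c0(1) q by (simp add: K_def)
  define c where "c = K * 2 powr (q - 1)"
  interpret P: pair_sigma_finite "lborel :: real measure" "cell :: (real ^ 'd) measure" ..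
  let ?i = "\<lambda>X s. indicator {s. 0 < s \<and> ennreal s < X} s :: ennreal"
  let ?v = "\<lambda>s. ennreal (q * s powr (q - 1))" and ?w = "\<lambda>s. ennreal ((q - 1) * s powr (q - 1 - 1))"
  show ?thesis
  proof (rule that[of c])
    show "0 \<le> c" using K by (simp add: c_def)
    fix F :: "real ^ 'd \<Rightarrow> ennreal" assume F [measurable]: "F \<in> borel_measurable borel" and per: "periodic F"
    define M where "M = max_fn R F"
    have M [measurable]: "M \<in> borel_measurable borel" unfolding M_def by (rule max_fn_meas[OF F R])
    have pm: "f \<in> borel_measurable (lborel \<Otimes>\<^sub>M cell)" if f: "f \<in> borel_measurable (borel \<Otimes>\<^sub>M borel)"
      for f :: "real \<times> (real ^ 'd) \<Rightarrow> ennreal"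
      by (rule measurable_pair_borel[OF f _ measurable_ident_cell]) simp
    have swap: "(\<integral>\<^sup>+x. (\<integral>\<^sup>+s. ennreal (w s) * ?i (X x) s \<partial>lborel) \<partial>cell)
      = (\<integral>\<^sup>+s. (\<integral>\<^sup>+x. ennreal (w s) * ?i (X x) s \<partial>cell) \<partial>lborel)"
      if [measurable]: "w \<in> borel_measurable borel" "X \<in> borel_measurable borel" for w :: "real \<Rightarrow> real" and X :: "real ^ 'd \<Rightarrow> ennreal"
    proof (rule P.Fubini')
      have "(\<lambda>(s, x). ennreal (w s) * (if 0 < s \<and> ennreal s < X x then 1 else 0)) \<in> borel_measurable (borel \<Otimes>\<^sub>M borel)"
        by measurable
      then show "(\<lambda>(s, x). ennreal (w s) * ?i (X x) s) \<in> borel_measurable (lborel \<Otimes>\<^sub>M cell)"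
        by (intro pm) (simp add: indicator_def)
    qed
    have "(\<integral>\<^sup>+x. epow (M x) q \<partial>cell) = (\<integral>\<^sup>+x. (\<integral>\<^sup>+s. ?v s * ?i (M x) s \<partial>lborel) \<partial>cell)"
      using q by (simp add: layer_cake_epow)
    also have "\<dots> = (\<integral>\<^sup>+s. (\<integral>\<^sup>+x. ?v s * ?i (M x) s \<partial>cell) \<partial>lborel)"
      by (rule swap) measurable
    also have "\<dots> \<le> (\<integral>\<^sup>+s. (\<integral>\<^sup>+x. ennreal K * F x * (?w s * ?i (2 * F x) s) \<partial>cell) \<partial>lborel)"
    proof (rule nn_integral_mono)
      fix s :: real
      show "(\<integral>\<^sup>+x. ?v s * ?i (M x) s \<partial>cell)
        \<le> (\<integral>\<^sup>+x. ennreal K * F x * (?w s * ?i (2 * F x) s) \<partial>cell)"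
      proof (cases "0 < s")
        case True
        \<comment> \<open>The discarded part of \<open>F\<close> is at most \<open>s / 2\<close>,
          and so is its maximal function. Where \<open>M\<close> exceeds \<open>s\<close>, the
          maximal function of \<open>G\<close> therefore exceeds \<open>s / 2\<close>.\<close>
        define G where "G = (\<lambda>x. F x * (if ennreal s < 2 * F x then 1 else 0))"
        have G [measurable]: "G \<in> borel_measurable borel" unfolding G_def by measurable
        have Gper: "periodic G" unfolding G_def by (rule periodic_comp[OF per])
        have FG: "F y \<le> 1 * G y + ennreal (s / 2) * 1" for y
        proof (cases "ennreal s < 2 * F y")
          case False
          then have "2 * F y \<le> 2 * ennreal (s / 2)" using True by (simp add: not_less ennreal_mult[symmetric] flip: ennreal_numeral)
          then have "F y \<le> ennreal (s / 2)" by (subst (asm) ennreal_mult_le_mult_iff) auto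
          then show ?thesis using False by (simp add: G_def)
        qed (simp add: G_def)
        have sub: "{x \<in> unit_cell. ennreal s < M x} \<subseteq> {x \<in> unit_cell. ennreal (s / 2) < max_fn R G x}"
        proof (clarsimp)
          fix x assume x: "ennreal s < M x"
          have "M x \<le> max_fn R (\<lambda>y. 1 * G y + ennreal (s / 2) * 1) x"
            unfolding M_def by (rule max_fn_mono) (rule FG)
          also have "\<dots> \<le> 1 * max_fn R G x + ennreal (s / 2) * max_fn R (\<lambda>y. 1) x"
            by (rule max_fn_linear_bound) measurable
          also have "max_fn R (\<lambda>y. 1) x = 1" using R by (simp add: max_fn_def ball_avg_const)
          finally have "ennreal s < max_fn R G x + ennreal (s / 2)" using x by simp
          moreover have "ennreal s = ennreal (s / 2) + ennreal (s / 2)" using True by (simp add: ennreal_plus[symmetric] del: ennreal_plus)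
          ultimately show "ennreal (s / 2) < max_fn R G x"
            by (metis add_right_mono not_le)
        qed
        have [measurable]: "max_fn R G \<in> borel_measurable borel" by (rule max_fn_meas[OF G R])
        have Em: "{x \<in> unit_cell. ennreal (s / 2) < max_fn R G x} \<in> sets lborel"
        proof -
          have "{x \<in> unit_cell. ennreal (s / 2) < max_fn R G x} = unit_cell \<inter> {x \<in> space borel. ennreal (s / 2) < max_fn R G x}" by auto
          also have "\<dots> \<in> sets borel" by measurable
          finally show ?thesis by simp
        qed
        have "(\<integral>\<^sup>+x. ?v s * ?i (M x) s \<partial>cell)
          = ?v s * (\<integral>\<^sup>+x. ?i (M x) s \<partial>cell)"
        proof (rule nn_integral_cmult)
          have "(\<lambda>x. if ennreal s < M x then 1 else 0 :: ennreal) \<in> borel_measurable borel" by measurable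
          then show "(\<lambda>x. ?i (M x) s :: ennreal) \<in> borel_measurable cell"
            using True by (intro measurable_cell) (simp add: indicator_def)
        qed
        also have "(\<integral>\<^sup>+x. ?i (M x) s \<partial>cell) = (\<integral>\<^sup>+x. indicator {x \<in> unit_cell. ennreal s < M x} x \<partial>lborel)"
          unfolding nn_integral_cell by (intro nn_integral_cong) (auto simp: indicator_def True)
        also have "\<dots> \<le> (\<integral>\<^sup>+x. indicator {x \<in> unit_cell. ennreal (s / 2) < max_fn R G x} x \<partial>lborel)"
          using sub by (intro nn_integral_mono) (auto simp: indicator_def)
        also have "\<dots> = emeasure lborel {x \<in> unit_cell. ennreal (s / 2) < max_fn R G x}" using Em by simp
        also have "?v s * \<dots> = ennreal (2 * q * s powr (q - 2)) * (emeasure lborel {x \<in> unit_cell. ennreal (s / 2) < max_fn R G x} * ennreal (s / 2))"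
        proof -
          have "s powr (q - 1) = s powr (q - 2) * s" using True powr_add[of s "q - 2" 1] by simp
          then have "?v s = ennreal (2 * q * s powr (q - 2)) * ennreal (s / 2)"
            using True q by (simp add: ennreal_mult[symmetric])
          then show ?thesis by (simp only: mult_ac)
        qed
        also have "\<dots> \<le> ennreal (2 * q * s powr (q - 2)) * (ennreal c0 * (\<integral>\<^sup>+x. G x \<partial>cell))"
          using True by (intro mult_left_mono c0(2) G Gper) auto
        also have "\<dots> = ennreal (K * ((q - 1) * s powr (q - 1 - 1))) * (\<integral>\<^sup>+x. G x \<partial>cell)"
        proof -
          have e: "K * ((q - 1) * s powr (q - 1 - 1)) = (2 * q * s powr (q - 2)) * c0"
            using q by (simp add: K_def)
          have "ennreal (K * ((q - 1) * s powr (q - 1 - 1))) = ennreal (2 * q * s powr (q - 2)) * ennreal c0"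
            unfolding e using q c0(1) by (intro ennreal_mult) auto
          then show ?thesis by (simp only: mult.assoc)
        qed
        also have "\<dots> = (\<integral>\<^sup>+x. ennreal (K * ((q - 1) * s powr (q - 1 - 1))) * G x \<partial>cell)"
          by (rule nn_integral_cmult[symmetric]) (intro measurable_cell, measurable)
        also have "\<dots> = (\<integral>\<^sup>+x. ennreal K * F x * (?w s * ?i (2 * F x) s) \<partial>cell)"
          using K q True by (intro nn_integral_cong) (simp add: G_def indicator_def ennreal_mult mult_ac)
        finally show ?thesis by (simp add: mult_left_mono)
      qed simp
    qed
    also have "\<dots> = (\<integral>\<^sup>+x. (\<integral>\<^sup>+s. ennreal K * F x * (?w s * ?i (2 * F x) s) \<partial>lborel) \<partial>cell)"
    proof (rule P.Fubini'[symmetric])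
      have "(\<lambda>(s, x). ennreal K * F x * (?w s * (if 0 < s \<and> ennreal s < 2 * F x then 1 else 0))) \<in> borel_measurable (borel \<Otimes>\<^sub>M borel)"
        by measurable
      then show "(\<lambda>(s, x). ennreal K * F x * (?w s * ?i (2 * F x) s)) \<in> borel_measurable (lborel \<Otimes>\<^sub>M cell)"
        by (intro pm) (simp add: indicator_def)
    qed
    also have "\<dots> = (\<integral>\<^sup>+x. ennreal K * F x * epow (2 * F x) (q - 1) \<partial>cell)"
    proof (rule nn_integral_cong)
      fix x
      have m: "(\<lambda>s. ?w s * ?i (2 * F x) s) \<in> borel_measurable lborel"
      proof -
        have "(\<lambda>s. ?w s * (if 0 < s \<and> ennreal s < 2 * F x then 1 else 0)) \<in> borel_measurable lborel"
          by measurable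
        then show ?thesis by (simp add: indicator_def)
      qed
      show "(\<integral>\<^sup>+s. ennreal K * F x * (?w s * ?i (2 * F x) s) \<partial>lborel)
        = ennreal K * F x * epow (2 * F x) (q - 1)"
        using q by (subst nn_integral_cmult[OF m], subst layer_cake_epow) auto
    qed
    also have "\<dots> = (\<integral>\<^sup>+x. ennreal c * epow (F x) q \<partial>cell)"
    proof (rule nn_integral_cong)
      fix x
      have "F x * epow (F x) (q - 1) = epow (F x) q"
        using epow_add[of "F x" 1 "q - 1"] by simp
      moreover have "epow 2 (q - 1) = ennreal (2 powr (q - 1))"
        using epow_ennreal[of 2 "q - 1"] by simp
      moreover have "ennreal c = ennreal K * ennreal (2 powr (q - 1))"
        using K by (simp add: c_def ennreal_mult)
      moreover have "ennreal K * F x * epow (2 * F x) (q - 1) = (ennreal K * epow 2 (q - 1)) * (F x * epow (F x) (q - 1))"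
        by (simp only: epow_mult mult_ac)
      ultimately show "ennreal K * F x * epow (2 * F x) (q - 1) = ennreal c * epow (F x) q"
        by (simp only:)
    qed
    also have "\<dots> = ennreal c * (\<integral>\<^sup>+x. epow (F x) q \<partial>cell)"
      by (rule nn_integral_cmult) (intro measurable_cell, measurable)
    finally show "(\<integral>\<^sup>+x. epow (max_fn R F x) q \<partial>cell) \<le> ennreal c * (\<integral>\<^sup>+x. epow (F x) q \<partial>cell)"
      by (simp add: M_def)
  qed
qed

section \<open>The maximal function of exponent \<open>p\<close>: triangle and Jensen
  inequalities\<close>

lemma powr_weighted_convex:
  fixes g h a b p :: real
  assumes "0 \<le> g" "0 \<le> h" "0 < a" "0 < b" "1 \<le> p"
  shows "(g + h) powr p \<le> (a + b) powr (p - 1) * (a powr (1 - p) * g powr p + b powr (1 - p) * h powr p)"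
proof -
  have *: "((1 - t) * x + t * y) powr p \<le> (1 - t) * x powr p + t * y powr p"
    if xyt: "0 \<le> x" "0 \<le> y" "0 < t" "t < 1" for x y t :: real
  proof -
    have small: "(t * y) powr p \<le> t * y powr p" if "0 < t" "t < 1" "0 \<le> y" for t y :: real
    proof -
      have "t powr p \<le> t powr 1" using that assms(5) by (intro powr_mono') auto
      then show ?thesis using that by (simp add: powr_mult mult_right_mono)
    qed
    consider "x = 0" | "y = 0" | "0 < x" "0 < y" using xyt by linarith
    then show ?thesis
    proof cases
      case 1
      then show ?thesis using small[of t y] xyt by simp
    next
      case 2
      then show ?thesis using small[of "1 - t" x] xyt by simp
    next
      case 3
      then show ?thesis using convex_onD[OF powr_convex[OF assms(5)], of t x y] xyt by simp
    qed
  qed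
  \<comment> \<open>Convexity is applied at \<open>g / a\<close> and \<open>h / b\<close> with
    weights \<open>a / (a + b)\<close> and \<open>b / (a + b)\<close>, whose combination is
    \<open>(g + h) / (a + b)\<close>.\<close>
  define t where "t = b / (a + b)"
  have t: "0 < t" "t < 1" "1 - t = a / (a + b)" using assms by (auto simp: t_def field_simps)
  have e: "(1 - t) * (g / a) + t * (h / b) = (g + h) / (a + b)"
    unfolding t(3) using assms by (simp add: t_def add_divide_distrib)
  have "(g + h) powr p = (a + b) powr p * ((g + h) / (a + b)) powr p"
    using assms by (simp add: powr_divide)
  also have "\<dots> \<le> (a + b) powr p * ((1 - t) * (g / a) powr p + t * (h / b) powr p)"
    unfolding e[symmetric] using assms t(1,2) by (intro mult_left_mono *) auto
  also have "\<dots> = ((a + b) powr p / (a + b)) * ((a / a powr p) * g powr p + (b / b powr p) * h powr p)"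
    unfolding t(3) using assms by (simp add: t_def powr_divide distrib_left)
  also have "(a + b) powr p / (a + b) = (a + b) powr (p - 1)" using assms by (simp add: powr_diff)
  also have "a / a powr p = a powr (1 - p)" using assms by (simp add: powr_diff)
  also have "b / b powr p = b powr (1 - p)" using assms by (simp add: powr_diff)
  finally show ?thesis .
qed

definition max_p :: "real \<Rightarrow> real \<Rightarrow> (real ^ 'd::finite \<Rightarrow> ennreal) \<Rightarrow> real ^ 'd \<Rightarrow> ennreal" where
  "max_p p R F x = epow (max_fn R (\<lambda>y. epow (F y) p) x) (1 / p)"

lemma max_fn_le_powr_of_max_p_less:
  assumes "1 \<le> p" "max_p p R F x \<le> ennreal a" "0 \<le> a"
  shows "max_fn R (\<lambda>y. epow (F y) p) x \<le> ennreal (a powr p)"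
proof -
  have "max_fn R (\<lambda>y. epow (F y) p) x = epow (max_p p R F x) p"
    using assms(1) by (simp add: max_p_def epow_epow)
  also have "\<dots> \<le> epow (ennreal a) p" using assms by (intro epow_mono) auto
  finally show ?thesis using assms by (simp add: epow_ennreal)
qed

text \<open>Minkowski's inequality by linearisation. For \<open>a\<close> and \<open>b\<close> just
  above the two values at \<open>x\<close>, weighted convexity gives
  \<open>epow (F y) p \<le> k * epow (G y) p + l * epow (H y) p\<close> with coefficients
  independent of \<open>y\<close>. The maximal function respects such bounds, and
  \<open>k * a powr p + l * b powr p = (a + b) powr p\<close>.\<close>

lemma max_p_triangle:
  fixes F G H :: "real ^ 'd::finite \<Rightarrow> ennreal"
  assumes p: "1 \<le> p" and [measurable]: "G \<in> borel_measurable borel" "H \<in> borel_measurable borel"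
    and le: "\<And>y. F y \<le> G y + H y"
  shows "max_p p R F x \<le> max_p p R G x + max_p p R H x"
proof (rule ennreal_le_epsilon)
  fix e :: real assume fin: "max_p p R G x + max_p p R H x < top" and e: "0 < e"
  obtain a' b' where ab': "max_p p R G x = ennreal a'" "0 \<le> a'" "max_p p R H x = ennreal b'" "0 \<le> b'"
    using fin by (cases "max_p p R G x"; cases "max_p p R H x") auto
  \<comment> \<open>Adding \<open>e / 2\<close> keeps \<open>a\<close> and \<open>b\<close> positive
    even if a maximal function vanishes at \<open>x\<close>; the weights involve
    \<open>a powr (1 - p)\<close>.\<close>
  define a b where "a = a' + e / 2" and "b = b' + e / 2"
  have ab: "0 < a" "0 < b" using ab' e by (auto simp: a_def b_def)
  have MG: "max_fn R (\<lambda>y. epow (G y) p) x \<le> ennreal (a powr p)"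
    using ab' e by (intro max_fn_le_powr_of_max_p_less p) (auto simp: a_def intro!: ennreal_leI)
  have MH: "max_fn R (\<lambda>y. epow (H y) p) x \<le> ennreal (b powr p)"
    using ab' e by (intro max_fn_le_powr_of_max_p_less p) (auto simp: b_def intro!: ennreal_leI)
  define k l where "k = (a + b) powr (p - 1) * a powr (1 - p)" and "l = (a + b) powr (p - 1) * b powr (1 - p)"
  have kl: "0 < k" "0 < l" using ab by (auto simp: k_def l_def)
  have pt: "epow (F y) p \<le> ennreal k * epow (G y) p + ennreal l * epow (H y) p" for y
  proof -
    have "epow (F y) p \<le> epow (G y + H y) p" using le p by (intro epow_mono) auto
    also have "\<dots> \<le> ennreal k * epow (G y) p + ennreal l * epow (H y) p"
    proof (cases "G y = top \<or> H y = top")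
      case True
      then show ?thesis using kl by (auto simp: ennreal_mult_top ennreal_eq_0_iff)
    next
      case False
      then obtain g h where gh: "G y = ennreal g" "0 \<le> g" "H y = ennreal h" "0 \<le> h"
        by (cases "G y"; cases "H y") auto
      have "(g + h) powr p \<le> k * g powr p + l * h powr p"
        using powr_weighted_convex[OF gh(2,4) ab p] by (simp add: k_def l_def algebra_simps)
      then show ?thesis using gh kl
        by (simp add: epow_ennreal ennreal_plus[symmetric] ennreal_mult[symmetric] del: ennreal_plus)
    qed
    finally show ?thesis .
  qed
  have "max_fn R (\<lambda>y. epow (F y) p) x \<le> max_fn R (\<lambda>y. ennreal k * epow (G y) p + ennreal l * epow (H y) p) x"
    by (rule max_fn_mono) (rule pt)
  also have "\<dots> \<le> ennreal k * max_fn R (\<lambda>y. epow (G y) p) x + ennreal l * max_fn R (\<lambda>y. epow (H y) p) x"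
    by (rule max_fn_linear_bound) measurable
  also have "\<dots> \<le> ennreal k * ennreal (a powr p) + ennreal l * ennreal (b powr p)"
    by (intro add_mono mult_left_mono MG MH) auto
  also have "\<dots> = ennreal (k * a powr p + l * b powr p)" using kl by (simp add: ennreal_mult)
  also have "k * a powr p + l * b powr p = (a + b) powr p"
  proof -
    have "a powr (1 - p) * a powr p = a" "b powr (1 - p) * b powr p = b"
      using ab by (simp_all add: powr_add[symmetric])
    then have "k * a powr p + l * b powr p = (a + b) powr (p - 1) * (a + b)"
      by (simp add: k_def l_def mult.assoc distrib_left)
    also have "\<dots> = (a + b) powr p" using ab powr_add[of "a + b" "p - 1" 1] by simp
    finally show ?thesis .
  qed
  finally have "max_p p R F x \<le> epow (ennreal ((a + b) powr p)) (1 / p)"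
    unfolding max_p_def using p by (intro epow_mono) auto
  also have "\<dots> = ennreal (a + b)" using ab p by (simp add: epow_ennreal powr_powr)
  also have "\<dots> = max_p p R G x + max_p p R H x + ennreal e"
    using ab' e by (simp add: a_def b_def ennreal_plus[symmetric] del: ennreal_plus)
  finally show "max_p p R F x \<le> max_p p R G x + max_p p R H x + ennreal e" .
qed

text \<open>The convex function \<open>x powr p / p\<close> lies above its tangent at
  \<open>x = 1\<close>.\<close>

lemma young_tangent:
  fixes x p :: real
  assumes "1 \<le> p" "0 \<le> x"
  shows "x \<le> x powr p / p + (1 - 1 / p)"
proof (cases "p = 1")
  case False
  have "x * 1 \<le> x powr p / p + 1 powr (1 / (1 - 1 / p)) / (1 / (1 - 1 / p))"
    using assms False by (intro Youngs_inequality) (auto simp: field_simps)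
  then show ?thesis using False assms by (simp add: field_simps)
qed (use assms in simp)

text \<open>Apply the tangent inequality to \<open>F y / b\<close> with \<open>b\<close> just above
  the mean of exponent \<open>p\<close>. Averaging bounds the left side by
  \<open>b / p + (1 - 1 / p) * b\<close>, which is \<open>b\<close>.\<close>

lemma ball_avg_jensen:
  fixes F :: "real ^ 'd::finite \<Rightarrow> ennreal"
  assumes p: "1 \<le> p" and R: "0 < R" and [measurable]: "F \<in> borel_measurable borel"
  shows "ball_avg R F x \<le> epow (ball_avg R (\<lambda>y. epow (F y) p) x) (1 / p)"
proof (rule ennreal_le_epsilon)
  let ?B = "ball_avg R (\<lambda>y. epow (F y) p) x"
  fix e :: real assume fin: "epow ?B (1 / p) < top" and e: "0 < e"
  then obtain b' where b': "epow ?B (1 / p) = ennreal b'" "0 \<le> b'" by (cases "epow ?B (1 / p)") auto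
  define b where "b = b' + e"
  have b: "0 < b" using b' e by (simp add: b_def)
  have "?B = epow (epow ?B (1 / p)) p" using p by (simp add: epow_epow)
  also have "\<dots> \<le> epow (ennreal b) p" using p e b' by (intro epow_mono) (auto simp: b_def intro!: ennreal_leI)
  finally have B: "?B \<le> ennreal (b powr p)" using b by (simp add: epow_ennreal)
  have pt: "F y \<le> ennreal (b powr (1 - p) / p) * epow (F y) p + ennreal ((1 - 1 / p) * b)" for y
  proof (cases "F y")
    case (real f)
    have "f / b \<le> (f / b) powr p / p + (1 - 1 / p)" using p b real by (intro young_tangent) auto
    then have "f / b * b \<le> ((f / b) powr p / p + (1 - 1 / p)) * b" using b by (intro mult_right_mono) auto
    moreover have "(f / b) powr p * b = b powr (1 - p) * f powr p"
      using b real by (simp add: powr_divide powr_diff)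
    moreover have "((f / b) powr p / p + (1 - 1 / p)) * b = ((f / b) powr p * b) / p + (1 - 1 / p) * b"
      by (simp add: distrib_right)
    ultimately have "f \<le> b powr (1 - p) / p * f powr p + (1 - 1 / p) * b"
      using b by simp
    then show ?thesis using real p b
      by (simp add: epow_ennreal ennreal_mult[symmetric] ennreal_plus[symmetric] ennreal_leI del: ennreal_plus)
  next
    case top
    have "0 < b powr (1 - p) / p" using p b by simp
    then have "ennreal (b powr (1 - p) / p) \<noteq> 0" by (simp add: ennreal_eq_0_iff)
    then show ?thesis using top by (simp add: ennreal_mult_top)
  qed
  have "ball_avg R F x \<le> ball_avg R (\<lambda>y. ennreal (b powr (1 - p) / p) * epow (F y) p + ennreal ((1 - 1 / p) * b)) x"
    by (rule ball_avg_mono) (rule pt)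
  also have "\<dots> = ennreal (b powr (1 - p) / p) * ?B + ennreal ((1 - 1 / p) * b)"
    using R by (subst ball_avg_add) (auto simp: ball_avg_cmult ball_avg_const)
  also have "\<dots> \<le> ennreal (b powr (1 - p) / p) * ennreal (b powr p) + ennreal ((1 - 1 / p) * b)"
    by (intro add_mono mult_left_mono B) auto
  also have "\<dots> = ennreal (b powr (1 - p) / p * b powr p + (1 - 1 / p) * b)"
    using p b by (simp add: ennreal_mult[symmetric] ennreal_plus[symmetric] del: ennreal_plus)
  also have "b powr (1 - p) / p * b powr p + (1 - 1 / p) * b = b"
  proof -
    have "b powr (1 - p) * b powr p = b" using b by (simp add: powr_add[symmetric])
    then show ?thesis using p by (simp add: field_simps)
  qed
  also have "ennreal b = epow ?B (1 / p) + ennreal e" using b' e by (simp add: b_def)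
  finally show "ball_avg R F x \<le> epow ?B (1 / p) + ennreal e" .
qed

lemma ball_avg_le_max_p:
  fixes F :: "real ^ 'd::finite \<Rightarrow> ennreal"
  assumes p: "1 \<le> p" and R: "0 < R" and F: "F \<in> borel_measurable borel"
  shows "ball_avg (R / 2 ^ n) F x \<le> max_p p R F x"
proof -
  have "ball_avg (R / 2 ^ n) F x \<le> epow (ball_avg (R / 2 ^ n) (\<lambda>y. epow (F y) p) x) (1 / p)"
    using R by (intro ball_avg_jensen p F) simp
  also have "\<dots> \<le> max_p p R F x"
    unfolding max_p_def using p by (intro epow_mono ball_avg_le_max_fn) simp
  finally show ?thesis .
qed

section \<open>The pointwise inequality\<close>

lemma telescoping_limit:
  fixes f :: "nat \<Rightarrow> real"
  assumes le: "\<And>k. \<bar>f k - f (Suc k)\<bar> \<le> c k" and c: "c sums S"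
  obtains l where "f \<longlonglongrightarrow> l" "\<bar>l - f 0\<bar> \<le> S"
proof -
  have sm: "summable (\<lambda>k. f (Suc k) - f k)"
  proof (rule summable_comparison_test'[OF sums_summable[OF c]])
    show "norm (f (Suc k) - f k) \<le> c k" for k using le[of k] by (simp add: abs_minus_commute)
  qed
  define l where "l = f 0 + (\<Sum>k. f (Suc k) - f k)"
  have "(\<lambda>n. f 0 + (\<Sum>k<n. f (Suc k) - f k)) \<longlonglongrightarrow> l"
    unfolding l_def by (intro tendsto_add tendsto_const summable_LIMSEQ sm)
  then have lim: "f \<longlonglongrightarrow> l" by (simp add: sum_lessThan_telescope)
  have "\<bar>l - f 0\<bar> = norm (\<Sum>k. f (Suc k) - f k)" by (simp add: l_def)
  also have "\<dots> \<le> (\<Sum>k. c k)"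
  proof (rule norm_suminf_le[OF _ sums_summable[OF c]])
    show "norm (f (Suc k) - f k) \<le> c k" for k using le[of k] by (simp add: abs_minus_commute)
  qed
  also have "\<dots> = S" using c by (simp add: sums_iff)
  finally show ?thesis using that lim by blast
qed

lemma ball_avg_subset:
  fixes F :: "real ^ 'd::finite \<Rightarrow> ennreal"
  assumes "0 < s" "0 < q" "ball y s \<subseteq> ball x q"
  shows "ball_avg s F y \<le> ennreal ((q / s) ^ CARD('d)) * ball_avg q F x"
proof -
  define \<omega> where "\<omega> = unit_ball_vol (real CARD('d))"
  have \<omega>: "0 < \<omega>" by (simp add: \<omega>_def)
  have "(\<integral>\<^sup>+z. F z * indicator (ball y s) z \<partial>lborel) \<le> (\<integral>\<^sup>+z. F z * indicator (ball x q) z \<partial>lborel)"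
    using assms(3) by (intro nn_integral_mono mult_left_mono) (auto simp: indicator_def)
  also have "\<dots> = ball_avg q F x * ennreal (\<omega> * q ^ CARD('d))"
    using assms by (simp add: nn_integral_ball_eq emeasure_ball_cart \<omega>_def)
  also have "ennreal (\<omega> * q ^ CARD('d)) = ennreal (\<omega> * s ^ CARD('d)) * ennreal ((q / s) ^ CARD('d))"
    using assms \<omega> by (simp add: ennreal_mult[symmetric] power_divide)
  finally have "(\<integral>\<^sup>+z. F z * indicator (ball y s) z \<partial>lborel) \<le> emeasure lborel (ball y s) * (ennreal ((q / s) ^ CARD('d)) * ball_avg q F x)"
    using assms by (simp add: emeasure_ball_cart \<omega>_def mult_ac)
  then show ?thesis
    unfolding ball_avg_def[of s] using emeasure_ball_nz(1)[OF assms(1)]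
    by (intro divide_le_posI_ennreal) (auto simp: zero_less_iff_neq_zero)
qed

lemma interpolate_powr:
  fixes b X Y \<alpha> :: real
  assumes "0 \<le> b" "b \<le> X" "b \<le> Y" "0 < \<alpha>" "\<alpha> < 1"
  shows "b \<le> X powr \<alpha> * Y powr (1 - \<alpha>)"
proof -
  have "b = b powr \<alpha> * b powr (1 - \<alpha>)"
    using assms by (cases "b = 0") (auto simp: powr_add[symmetric])
  also have "\<dots> \<le> X powr \<alpha> * Y powr (1 - \<alpha>)"
    using assms by (intro mult_mono powr_mono2) auto
  finally show ?thesis .
qed

context borel_sobolev
begin

text \<open>Where the averages diverge, \<open>lim\<close> is still a fixed value depending only on
  the sequence, so \<open>rep\<close> is defined and periodic everywhere. The pointwise estimate
  never relies on such values: convergence is proved wherever the maximal function is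
  finite.\<close>

definition rep :: "real \<Rightarrow> real ^ 'd \<Rightarrow> real" where
  "rep R x = lim (\<lambda>n. u_avg (R / 2 ^ n) x)"

lemma rep_periodic: "0 < R \<Longrightarrow> periodic (rep R)"
  unfolding periodic_iff rep_def using u_avg_periodic unfolding periodic_iff by simp

text \<open>The L1 errors of the averages decay geometrically, so their sum has a finite integral;
  at almost every point the errors are summable and hence tend to 0.\<close>

lemma AE_rep:
  assumes R: "0 < R" shows "AE x in lborel. rep R x = u x"
proof -
  have m [measurable]: "u_avg (R / 2 ^ n) \<in> borel_measurable borel" for n
    using R by (intro u_avg_meas) simp
  define I where "I = (\<integral>\<^sup>+x. grad x \<partial>cell)"
  have I: "I < top" using V_int by (simp add: I_def grad_def integrable_iff_bounded)
  then obtain i where i: "I = ennreal i" "0 \<le> i" by (cases I) auto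
  have "(\<integral>\<^sup>+x. (\<Sum>n. ennreal \<bar>u_avg (R / 2 ^ n) x - u x\<bar>) \<partial>cell) = (\<Sum>n. \<integral>\<^sup>+x. ennreal \<bar>u_avg (R / 2 ^ n) x - u x\<bar> \<partial>cell)"
    by (rule nn_integral_suminf) (intro measurable_cell, measurable)
  also have "\<dots> \<le> (\<Sum>n. ennreal (R / 2 ^ n) * I)"
    using R unfolding I_def by (intro suminf_le u_avg_L1_error) auto
  also have "\<dots> = (\<Sum>n. ennreal (R * i * (1 / 2) ^ n))"
    using R i by (simp add: ennreal_mult[symmetric] power_divide)
  also have "\<dots> = ennreal (\<Sum>n. R * i * (1 / 2) ^ n)"
    using R i by (intro suminf_ennreal2 summable_mult summable_geometric) auto
  also have "\<dots> < top" by simp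
  finally have "(\<integral>\<^sup>+x. (\<Sum>n. ennreal \<bar>u_avg (R / 2 ^ n) x - u x\<bar>) \<partial>cell) \<noteq> \<infinity>" by simp
  then have "AE x in cell. (\<Sum>n. ennreal \<bar>u_avg (R / 2 ^ n) x - u x\<bar>) \<noteq> \<infinity>"
    by (intro nn_integral_PInf_AE) (intro measurable_cell, measurable)
  then have "AE x in cell. rep R x = u x"
  proof (rule eventually_mono)
    fix x assume "(\<Sum>n. ennreal \<bar>u_avg (R / 2 ^ n) x - u x\<bar>) \<noteq> \<infinity>"
    then have "summable (\<lambda>n. \<bar>u_avg (R / 2 ^ n) x - u x\<bar>)"
      by (intro summable_suminf_not_top) auto
    then have "(\<lambda>n. \<bar>u_avg (R / 2 ^ n) x - u x\<bar>) \<longlonglongrightarrow> 0" by (rule summable_LIMSEQ_zero)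
    then have "(\<lambda>n. u_avg (R / 2 ^ n) x) \<longlonglongrightarrow> u x"
      by (simp add: tendsto_rabs_zero_iff LIM_zero_iff)
    then show "rep R x = u x" unfolding rep_def by (rule limI)
  qed
  then show ?thesis
    by (subst (asm) AE_cell_periodic) (rule periodic_comp2[OF rep_periodic[OF R] u_per], assumption)
qed

definition osc_const :: real where
  "osc_const = 2 * 8 ^ CARD('d)"

lemma u_avg_step:
  assumes R: "0 < R"
  shows "ennreal \<bar>u_avg (R / 2 ^ n) x - u_avg (R / 2 ^ Suc n) x\<bar>
    \<le> ennreal (osc_const * (R / 2 ^ n)) * ball_avg (R / 2 ^ n) grad x"
  unfolding osc_const_def using R
  by (intro u_avg_oscillation) (auto intro!: subset_ball simp: field_simps)

lemma u_avg_cross: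
  assumes R: "0 < R" and xy: "dist x y \<le> R / 2 ^ Suc n"
  shows "ennreal \<bar>u_avg (R / 2 ^ Suc n) x - u_avg (R / 2 ^ Suc n) y\<bar>
    \<le> ennreal (osc_const * (R / 2 ^ n)) * ball_avg (R / 2 ^ n) grad x"
proof -
  have "ball y (R / 2 ^ Suc n) \<subseteq> ball x (R / 2 ^ n)"
  proof
    fix z assume "z \<in> ball y (R / 2 ^ Suc n)"
    then have "dist x z < R / 2 ^ Suc n + R / 2 ^ Suc n"
      using xy dist_triangle[of x z y] by simp
    then show "z \<in> ball x (R / 2 ^ n)" by simp
  qed
  then show ?thesis
    unfolding osc_const_def using R
    by (intro u_avg_oscillation) (auto intro!: subset_ball simp: field_simps)
qed

text \<open>Telescoping from scale \<open>N\<close> downwards; convergence of the averages at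
  \<open>x\<close> comes out of the same argument. The bounds \<open>b k\<close> may vary with the
  scale, because those used at \<open>y\<close> in \<open>rep_pointwise\<close> grow
  geometrically.\<close>

lemma rep_error:
  assumes R: "0 < R" and b: "\<And>k. ball_avg (R / 2 ^ (N + k)) grad x \<le> ennreal (b k)" "\<And>k. 0 \<le> b k"
    and S: "(\<lambda>k. osc_const * (R / 2 ^ (N + k)) * b k) sums S"
  shows "\<bar>rep R x - u_avg (R / 2 ^ N) x\<bar> \<le> S"
proof -
  define f where "f k = u_avg (R / 2 ^ (k + N)) x" for k
  have K: "0 < osc_const" by (simp add: osc_const_def)
  have "\<bar>f k - f (Suc k)\<bar> \<le> osc_const * (R / 2 ^ (N + k)) * b k" for k
  proof -
    have "ennreal \<bar>f k - f (Suc k)\<bar> \<le> ennreal (osc_const * (R / 2 ^ (k + N))) * ball_avg (R / 2 ^ (k + N)) grad x"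
      unfolding f_def using u_avg_step[OF R, of "k + N" x] by simp
    also have "\<dots> \<le> ennreal (osc_const * (R / 2 ^ (k + N))) * ennreal (b k)"
      using b(1)[of k] by (intro mult_left_mono) (simp_all add: add.commute)
    also have "\<dots> = ennreal (osc_const * (R / 2 ^ (N + k)) * b k)"
      using K R b(2) by (simp add: ennreal_mult[symmetric] add.commute)
    finally show ?thesis using K R b(2)[of k] by (subst (asm) ennreal_le_iff) auto
  qed
  from telescoping_limit[OF this S] obtain l where l: "f \<longlonglongrightarrow> l" "\<bar>l - f 0\<bar> \<le> S" by blast
  have "(\<lambda>k. u_avg (R / 2 ^ k) x) \<longlonglongrightarrow> l"
    using l(1) unfolding f_def by (rule LIMSEQ_offset)
  then have "rep R x = l" unfolding rep_def by (rule limI)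
  then show ?thesis using l(2) by (simp add: f_def)
qed

text \<open>In the constant, the 2 collects the error at \<open>x\<close> and the comparison of the
  averages at \<open>x\<close> and \<open>y\<close>. The error at \<open>y\<close> carries bounds
  growing by the factor \<open>2 powr (\<alpha> * real CARD('d) / p)\<close> per halving of the
  radius, so it is a geometric series of ratio \<open>\<theta>\<close>, with sum
  \<open>\<theta> / (1 - \<theta>)\<close>. The 4 is the ratio allowed between the initial radius
  and the distance.\<close>

lemma rep_pointwise:
  assumes R: "0 < R" and p: "1 \<le> p" and \<alpha>: "0 < \<alpha>" "\<alpha> < 1" "\<alpha> * real CARD('d) < p"
    and X: "max_p p R grad x = ennreal X" "0 \<le> X" and Y: "max_p p R grad y = ennreal Y" "0 \<le> Y"
    and xy: "x \<noteq> y" "dist x y \<le> R / 2"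
    and \<theta>: "\<theta> = 2 powr (\<alpha> * real CARD('d) / p - 1)"
  shows "\<bar>rep R x - rep R y\<bar> \<le> 4 * osc_const * (2 + \<theta> / (1 - \<theta>)) * dist x y * (X + X powr \<alpha> * Y powr (1 - \<alpha>))"
proof -
  let ?\<beta> = "2 powr (\<alpha> * real CARD('d) / p)" and ?P = "\<lambda>y. epow (grad y) p"
  define Z where "Z = X powr \<alpha> * Y powr (1 - \<alpha>)"
  have K: "0 < osc_const" by (simp add: osc_const_def)
  have \<theta>01: "0 < \<theta>" "\<theta> < 1"
  proof -
    show "0 < \<theta>" by (simp add: \<theta>)
    have "\<alpha> * real CARD('d) / p - 1 < 0" using \<alpha>(3) p by simp
    then have "2 powr (\<alpha> * real CARD('d) / p - 1) < 2 powr (0 :: real)" by (intro powr_less_mono) auto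
    then show "\<theta> < 1" by (simp add: \<theta>)
  qed
  have Z: "0 \<le> Z" by (simp add: Z_def)
  \<comment> \<open>The scale is chosen so that the ball around \<open>y\<close> of half the radius
    \<open>r = R / 2 ^ n\<close> lies in the ball of radius \<open>r\<close> around
    \<open>x\<close>, while \<open>r\<close> is still less than four times the distance. The least
    admissible exponent is at least 2 because \<open>dist x y \<le> R / 2\<close>.\<close>
  obtain n where n: "dist x y \<le> R / 2 ^ Suc n" "R / 2 ^ Suc (Suc n) < dist x y"
  proof -
    have "(\<lambda>m. R * (1 / 2) ^ m) \<longlonglongrightarrow> R * 0"
      by (intro tendsto_mult tendsto_const LIMSEQ_power_zero) simp
    then have "eventually (\<lambda>m. R * (1 / 2) ^ m < dist x y) sequentially"
      using xy(1) by (intro order_tendstoD) auto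
    then obtain m0 where m0: "R / 2 ^ m0 < dist x y"
      by (auto simp: eventually_sequentially power_divide)
    define m where "m = (LEAST m. R / 2 ^ m < dist x y)"
    have m: "R / 2 ^ m < dist x y" unfolding m_def using m0 by (rule LeastI)
    have nm: "\<not> R / 2 ^ k < dist x y" if "k < m" for k
      using that not_less_Least unfolding m_def by blast
    have "m \<noteq> 0" by (rule notI) (use m xy(2) R in simp)
    moreover have "m \<noteq> 1" by (rule notI) (use m xy(2) R in simp)
    ultimately obtain n where n: "m = Suc (Suc n)" by (metis One_nat_def not0_implies_Suc)
    show ?thesis using that[of n] nm[of "Suc n"] m n by simp
  qed
  define r where "r = R / 2 ^ n"
  have r: "0 < r" using R by (simp add: r_def)
  have [measurable]: "?P \<in> borel_measurable borel" by measurable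
  have x_err: "\<bar>rep R x - u_avg (R / 2 ^ Suc n) x\<bar> \<le> osc_const * r * X"
  proof (rule rep_error[OF R])
    show "ball_avg (R / 2 ^ (Suc n + k)) grad x \<le> ennreal X" for k
      unfolding X(1)[symmetric] by (rule ball_avg_le_max_p[OF p R grad_meas])
    have "(\<lambda>k. osc_const * r * X * (1 / 2) ^ Suc k) sums (osc_const * r * X * 1)"
      by (intro sums_mult power_half_series)
    then show "(\<lambda>k. osc_const * (R / 2 ^ (Suc n + k)) * X) sums (osc_const * r * X)"
      by (simp add: r_def power_add power_divide mult_ac)
  qed (rule X)
  have y_err: "\<bar>rep R y - u_avg (R / 2 ^ Suc n) y\<bar> \<le> osc_const * r * (Z * (\<theta> / (1 - \<theta>)))"
  proof (rule rep_error[OF R])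
    fix k
    let ?s = "R / 2 ^ (Suc n + k)" and ?t = "(2 :: real) ^ Suc k"
    let ?T = "(?t ^ CARD('d)) powr (1 / p)"
    have s: "0 < ?s" using R by simp
    show "ball_avg ?s grad y \<le> ennreal (Z * ?\<beta> ^ Suc k)"
    proof -
      have "ball y ?s \<subseteq> ball x r"
      proof
        fix z assume "z \<in> ball y ?s"
        moreover have "?s \<le> R / 2 ^ Suc n" using R by (intro divide_left_mono power_increasing) auto
        ultimately have "dist x z < R / 2 ^ Suc n + R / 2 ^ Suc n"
          using n(1) dist_triangle[of x z y] by simp
        then show "z \<in> ball x r" by (simp add: r_def)
      qed
      \<comment> \<open>The balls are compared for the powers \<open>epow (grad z) p\<close>, before
        taking the root. The volume ratio \<open>?t ^ CARD('d)\<close> then enters only with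
        exponent \<open>1 / p\<close>, which is how the condition
        \<open>\<alpha> * real CARD('d) < p\<close> becomes sufficient.\<close>
      then have "ball_avg ?s ?P y \<le> ennreal ((r / ?s) ^ CARD('d)) * ball_avg r ?P x"
        by (rule ball_avg_subset[OF s r])
      also have "r / ?s = ?t" using R by (simp add: r_def power_add)
      also have "ball_avg r ?P x \<le> max_fn R ?P x"
        unfolding r_def by (rule ball_avg_le_max_fn)
      finally have 1: "ball_avg ?s ?P y \<le> ennreal (?t ^ CARD('d)) * max_fn R ?P x"
        by (simp add: mult_left_mono)
      have "ball_avg ?s grad y \<le> epow (ball_avg ?s ?P y) (1 / p)"
        by (rule ball_avg_jensen[OF p s grad_meas])
      also have "\<dots> \<le> epow (ennreal (?t ^ CARD('d)) * max_fn R ?P x) (1 / p)"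
        using p by (intro epow_mono 1) simp
      also have "\<dots> = ennreal (?T) * ennreal X"
        by (simp add: epow_mult epow_ennreal X(1)[symmetric] max_p_def del: power_Suc)
      also have "\<dots> = ennreal (?T * X)" using X by (simp add: ennreal_mult)
      finally have bX: "ball_avg ?s grad y \<le> ennreal (?T * X)" .
      have bY: "ball_avg ?s grad y \<le> ennreal Y"
        unfolding Y(1)[symmetric] by (rule ball_avg_le_max_p[OF p R grad_meas])
      obtain b where b: "ball_avg ?s grad y = ennreal b" "0 \<le> b"
        using bY by (cases "ball_avg ?s grad y") (auto simp: top_unique)
      \<comment> \<open>The growing bound through \<open>x\<close> gets the weight
        \<open>\<alpha>\<close>, the constant bound through \<open>y\<close> the weight
        \<open>1 - \<alpha>\<close>. This turns the growth into \<open>?\<beta> ^ Suc k\<close>, and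
        \<open>?\<beta> / 2 = \<theta> < 1\<close>.\<close>
      have "b \<le> (?T * X) powr \<alpha> * Y powr (1 - \<alpha>)"
        using bX bY b X Y \<alpha> by (intro interpolate_powr) auto
      also have "\<dots> = (?T) powr \<alpha> * Z"
        using X by (simp add: powr_mult Z_def del: power_Suc)
      also have "(?T) powr \<alpha> = ?\<beta> ^ Suc k"
      proof -
        have "?t ^ CARD('d) = 2 powr (real (Suc k) * real CARD('d))"
          by (simp add: powr_realpow[symmetric] powr_powr del: power_Suc of_nat_Suc)
        then have "(?T) powr \<alpha> = 2 powr (real (Suc k) * real CARD('d) * (1 / p) * \<alpha>)"
          by (simp add: powr_powr del: power_Suc of_nat_Suc)
        also have "\<dots> = ?\<beta> powr real (Suc k)"
          by (simp add: powr_powr mult_ac del: of_nat_Suc)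
        also have "\<dots> = ?\<beta> ^ Suc k" by (rule powr_realpow) simp
        finally show ?thesis .
      qed
      finally show ?thesis unfolding b(1) by (intro ennreal_leI) (simp only: mult.commute)
    qed
  next
    show "0 \<le> Z * ?\<beta> ^ Suc k" for k using Z by simp
    have "(\<lambda>k. osc_const * r * Z * \<theta> * \<theta> ^ k) sums (osc_const * r * Z * \<theta> * (1 / (1 - \<theta>)))"
      using \<theta>01 by (intro sums_mult geometric_sums) simp
    moreover have "osc_const * (R / 2 ^ (Suc n + k)) * (Z * ?\<beta> ^ Suc k) = osc_const * r * Z * \<theta> * \<theta> ^ k" for k
    proof -
      have "\<theta> * \<theta> ^ k = ?\<beta> ^ Suc k / 2 ^ Suc k"
        unfolding \<theta> powr_diff by (simp add: power_divide)
      then show ?thesis by (simp add: r_def power_add mult.assoc del: power_Suc) (simp add: power_add mult_ac)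
    qed
    ultimately show "(\<lambda>k. osc_const * (R / 2 ^ (Suc n + k)) * (Z * ?\<beta> ^ Suc k)) sums (osc_const * r * (Z * (\<theta> / (1 - \<theta>))))"
      by (simp add: mult_ac)
  qed
  have cross: "\<bar>u_avg (R / 2 ^ Suc n) x - u_avg (R / 2 ^ Suc n) y\<bar> \<le> osc_const * r * X"
  proof -
    have "ennreal \<bar>u_avg (R / 2 ^ Suc n) x - u_avg (R / 2 ^ Suc n) y\<bar> \<le> ennreal (osc_const * r) * ball_avg r grad x"
      unfolding r_def by (rule u_avg_cross[OF R n(1)])
    also have "\<dots> \<le> ennreal (osc_const * r) * ennreal X"
      unfolding X(1)[symmetric] r_def by (intro mult_left_mono ball_avg_le_max_p[OF p R grad_meas]) simp
    also have "\<dots> = ennreal (osc_const * r * X)" using K r X by (simp add: ennreal_mult)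
    finally show ?thesis using K r X by (subst (asm) ennreal_le_iff) auto
  qed
  have "\<bar>rep R x - rep R y\<bar> \<le> osc_const * r * X + osc_const * r * X + osc_const * r * (Z * (\<theta> / (1 - \<theta>)))"
    using x_err y_err cross by linarith
  also have "\<dots> = osc_const * r * (2 * X + \<theta> / (1 - \<theta>) * Z)" by (simp add: algebra_simps)
  also have "\<dots> \<le> osc_const * r * ((2 + \<theta> / (1 - \<theta>)) * (X + Z))"
  proof (intro mult_left_mono)
    have "0 \<le> \<theta> / (1 - \<theta>)" using \<theta>01 by simp
    from mult_nonneg_nonneg[OF this X(2)] have "0 \<le> \<theta> / (1 - \<theta>) * X" .
    then show "2 * X + \<theta> / (1 - \<theta>) * Z \<le> (2 + \<theta> / (1 - \<theta>)) * (X + Z)"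
      using Z by (simp add: distrib_left distrib_right)
  qed (use K r in simp)
  also have "\<dots> \<le> osc_const * (4 * dist x y) * ((2 + \<theta> / (1 - \<theta>)) * (X + Z))"
  proof (intro mult_right_mono mult_left_mono)
    show "r \<le> 4 * dist x y" using n(2) by (simp add: r_def field_simps)
    show "0 \<le> (2 + \<theta> / (1 - \<theta>)) * (X + Z)" using \<theta>01 X Z by (intro mult_nonneg_nonneg add_nonneg_nonneg) auto
  qed (use K in simp)
  also have "\<dots> = 4 * osc_const * (2 + \<theta> / (1 - \<theta>)) * dist x y * (X + Z)" by (simp only: mult_ac)
  finally show ?thesis by (simp only: Z_def)
qed

end

section \<open>Torus norms and the selection\<close>

lemma max_p_cong_AE: "AE y in lborel. F y = G y \<Longrightarrow> max_p p R F x = max_p p R G x"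
  unfolding max_p_def by (intro arg_cong2[where f=epow] max_fn_cong_AE) (auto elim!: eventually_mono)

lemma max_p_meas:
  fixes F :: "real ^ 'd::finite \<Rightarrow> ennreal"
  assumes [measurable]: "F \<in> borel_measurable borel" and R: "0 < R"
  shows "max_p p R F \<in> borel_measurable borel"
proof -
  have [measurable]: "max_fn R (\<lambda>y. epow (F y) p) \<in> borel_measurable borel"
    by (rule max_fn_meas[OF _ R]) measurable
  show ?thesis unfolding max_p_def [abs_def] by measurable
qed

lemma max_p_periodic:
  fixes F :: "real ^ 'd::finite \<Rightarrow> ennreal"
  assumes [measurable]: "F \<in> borel_measurable borel" and per: "periodic F" and R: "0 < R"
  shows "periodic (max_p p R F)"
proof -
  have "periodic (max_fn R (\<lambda>y. epow (F y) p))"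
    by (rule max_fn_periodic[OF _ periodic_comp[OF per] R]) measurable
  then show ?thesis unfolding max_p_def [abs_def] by (rule periodic_comp)
qed

lemma eLr_norm_cell: "eLr_norm r g = epow (\<integral>\<^sup>+x. epow (g x) r \<partial>cell) (1 / r)"
  by (simp add: eLr_norm_def nn_integral_torus)

lemma AE_lborel_cell: "AE x in lborel. P x \<Longrightarrow> AE x in cell. P x"
  unfolding AE_cell_iff by (rule eventually_mono) auto

lemma eLr_norm_mono_AE:
  assumes "0 < r" "AE x in cell. f x \<le> g x" shows "eLr_norm r f \<le> eLr_norm r g"
  unfolding eLr_norm_cell using assms
  by (intro epow_mono nn_integral_mono_AE) (auto elim!: eventually_mono intro: epow_mono)

lemma eLr_norm_cong_AE:
  assumes "0 < r" "AE x in cell. f x = g x" shows "eLr_norm r f = eLr_norm r g"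
  by (intro antisym eLr_norm_mono_AE[OF assms(1)]) (use assms(2) in \<open>auto elim!: eventually_mono\<close>)

text \<open>The strong type estimate with exponent \<open>r / p\<close>, applied to the
  \<open>p\<close>-th power of \<open>F\<close>.\<close>

lemma eLr_norm_max_p:
  assumes R: "0 < R" and p: "1 \<le> p" "p < r" and c1: "0 \<le> c1"
  obtains C :: real where "0 \<le> C" "\<And>F :: real ^ 'd::finite \<Rightarrow> ennreal. F \<in> borel_measurable borel \<Longrightarrow> periodic F \<Longrightarrow>
    eLr_norm r (\<lambda>x. ennreal c1 * max_p p R F x) \<le> ennreal C * eLr_norm r F"
proof -
  have q: "1 < r / p" using p by simp
  obtain c where c: "0 \<le> c" "\<And>F :: real ^ 'd::finite \<Rightarrow> ennreal. F \<in> borel_measurable borel \<Longrightarrow> periodic F \<Longrightarrow>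
    (\<integral>\<^sup>+x. epow (max_fn R F x) (r / p) \<partial>cell) \<le> ennreal c * (\<integral>\<^sup>+x. epow (F x) (r / p) \<partial>cell)"
    by (rule max_fn_strong_type[OF R q]) (rule that)
  show ?thesis
  proof (rule that[of "c1 * c powr (1 / r)"])
    show "0 \<le> c1 * c powr (1 / r)" using c1 by simp
    fix F :: "real ^ 'd \<Rightarrow> ennreal" assume [measurable]: "F \<in> borel_measurable borel" and per: "periodic F"
    define M where "M = max_fn R (\<lambda>y. epow (F y) p)"
    have [measurable]: "M \<in> borel_measurable borel"
      unfolding M_def by (rule max_fn_meas[OF _ R]) measurable
    have "(\<integral>\<^sup>+x. epow (ennreal c1 * max_p p R F x) r \<partial>cell) = (\<integral>\<^sup>+x. epow (ennreal c1) r * epow (M x) (r / p) \<partial>cell)"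
      by (intro nn_integral_cong) (simp add: epow_mult epow_epow max_p_def M_def)
    also have "\<dots> = epow (ennreal c1) r * (\<integral>\<^sup>+x. epow (M x) (r / p) \<partial>cell)"
      by (rule nn_integral_cmult) (intro measurable_cell, measurable)
    also have "\<dots> \<le> epow (ennreal c1) r * (ennreal c * (\<integral>\<^sup>+x. epow (epow (F x) p) (r / p) \<partial>cell))"
      unfolding M_def by (intro mult_left_mono c(2) periodic_comp[OF per]) auto
    also have "(\<integral>\<^sup>+x. epow (epow (F x) p) (r / p) \<partial>cell) = (\<integral>\<^sup>+x. epow (F x) r \<partial>cell)"
      using p by (simp add: epow_epow)
    finally have "eLr_norm r (\<lambda>x. ennreal c1 * max_p p R F x) \<le> epow (epow (ennreal c1) r * (ennreal c * (\<integral>\<^sup>+x. epow (F x) r \<partial>cell))) (1 / r)"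
      unfolding eLr_norm_cell using p by (intro epow_mono) auto
    also have "\<dots> = ennreal c1 * (ennreal (c powr (1 / r)) * eLr_norm r F)"
      using p c(1) by (simp add: eLr_norm_cell epow_mult epow_epow epow_ennreal[OF c(1)])
    also have "\<dots> = ennreal (c1 * c powr (1 / r)) * eLr_norm r F"
      using c1 by (simp add: ennreal_mult mult.assoc)
    finally show "eLr_norm r (\<lambda>x. ennreal c1 * max_p p R F x) \<le> ennreal (c1 * c powr (1 / r)) * eLr_norm r F" .
  qed
qed

text \<open>The torus has finite measure and \<open>x \<le> 1 + epow x r\<close>.\<close>

lemma Lr_integrable:
  fixes f :: "real ^ 'd::finite \<Rightarrow> 'b::euclidean_space"
  assumes r: "1 \<le> r" and f: "f \<in> Lr r"
  shows "integrable torus f"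
proof (rule integrableI_bounded)
  show m [measurable]: "f \<in> borel_measurable torus" using f by (simp add: Lr_def)
  have le: "x \<le> 1 + epow x r" for x :: ennreal
  proof (cases x)
    case (real a)
    have "a \<le> 1 + a powr r"
    proof (cases "a \<le> 1")
      case True
      then show ?thesis using real by (smt (verit) powr_ge_zero)
    next
      case False
      then have "a powr 1 \<le> a powr r" using r by (intro powr_mono) auto
      then show ?thesis using False by simp
    qed
    then have "ennreal a \<le> ennreal (1 + a powr r)" by (rule ennreal_leI)
    then show ?thesis using real by (simp add: epow_ennreal)
  qed simp
  have "(\<integral>\<^sup>+x. ennreal (norm (f x)) \<partial>torus) \<le> (\<integral>\<^sup>+x. 1 + epow (ennreal (norm (f x))) r \<partial>torus)"
    by (intro nn_integral_mono le)
  also have "\<dots> = (\<integral>\<^sup>+x. 1 \<partial>(torus :: (real ^ 'd) measure)) + (\<integral>\<^sup>+x. epow (ennreal (norm (f x))) r \<partial>torus)"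
    by (rule nn_integral_add) measurable
  also have "(\<integral>\<^sup>+x. 1 \<partial>(torus :: (real ^ 'd) measure)) < \<infinity>"
    unfolding nn_integral_torus nn_integral_cell by (simp add: emeasure_unit_cell)
  then have "(\<integral>\<^sup>+x. 1 \<partial>(torus :: (real ^ 'd) measure)) + (\<integral>\<^sup>+x. epow (ennreal (norm (f x))) r \<partial>torus) < \<infinity>"
    using f by (simp add: Lr_def Lr_norm_def eLr_norm_def epow_less_top)
  finally show "(\<integral>\<^sup>+x. ennreal (norm (f x)) \<partial>torus) < \<infinity>" .
qed

lemma weak_gradient_is:
  assumes "u \<in> W1r r" shows "is_weak_gradient u (weak_gradient u)"
proof -
  obtain V where "is_weak_gradient u V" using assms by (auto simp: W1r_def)
  then show ?thesis unfolding weak_gradient_def by (rule someI[where P="is_weak_gradient u"])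
qed

text \<open>The bridge from Sobolev classes to the locale: the chosen weak gradient is only
  measurable on \<open>torus\<close>, but it has a periodic Borel version.\<close>

lemma W1r_borel_version:
  fixes u :: "real ^ 'd::finite \<Rightarrow> real"
  assumes r: "1 \<le> r" and u: "u \<in> W1r r"
  obtains u' V' where "borel_sobolev u' V'" "AE x in lborel. u x = u' x" "AE x in lborel. weak_gradient u x = V' x"
proof -
  let ?V = "weak_gradient u"
  have uL: "u \<in> Lr r" using u by (simp add: W1r_def)
  note uint = Lr_integrable[OF r uL] and wg = weak_gradient_is[OF u]
  have um: "u \<in> borel_measurable torus" and uper: "periodic u" using uL by (auto simp: Lr_def)
  note Vper = is_weak_gradientD(1)[OF wg] and Vint = is_weak_gradientD(2)[OF wg]
  obtain u' where u': "u' \<in> borel_measurable borel" "periodic u'" "AE x in lborel. u x = u' x"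
    by (rule periodic_borel_version_real[OF um uper]) (rule that)
  obtain V' where V': "V' \<in> borel_measurable borel" "periodic V'" "AE x in lborel. ?V x = V' x"
    by (rule periodic_borel_version_vec[OF borel_measurable_integrable[OF Vint] Vper]) (rule that)
  have "borel_sobolev u' V'"
  proof
    show "integrable cell u'" by (rule integrable_torus_AE[OF uint u'(1,3)])
    show "integrable cell V'" by (rule integrable_torus_AE[OF Vint V'(1,3)])
    fix \<phi> :: "real ^ 'd \<Rightarrow> real" and i assume \<phi>: "\<phi> \<in> test_functions"
    note [measurable] = u'(1) V'(1) test_function_borel[OF \<phi>] partial_borel[OF \<phi>]
    have "(\<lambda>x. V' x \<bullet> axis i 1) \<in> borel_measurable borel" by measurable
    then have [measurable]: "(\<lambda>x. V' x $ i) \<in> borel_measurable borel" by (simp add: inner_axis)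
    have "AE x in lborel. u x * partial i \<phi> x = u' x * partial i \<phi> x" using u'(3) by (rule eventually_mono) simp
    then have 1: "(LINT x|torus. u x * partial i \<phi> x) = (LINT x|cell. u' x * partial i \<phi> x)"
      by (rule integral_torus_AE[OF borel_measurable_integrable[OF integrable_mult_test_function(2)[OF uint \<phi>]], rotated]) measurable
    have "AE x in lborel. ?V x $ i * \<phi> x = V' x $ i * \<phi> x" using V'(3) by (rule eventually_mono) simp
    then have 2: "(LINT x|torus. ?V x $ i * \<phi> x) = (LINT x|cell. V' x $ i * \<phi> x)"
      by (rule integral_torus_AE[OF borel_measurable_integrable[OF integrable_mult_test_function(1)[OF integrable_vec_nth[OF Vint] \<phi>]], rotated]) measurable
    show "(LINT x|cell. u' x * partial i \<phi> x) = - (LINT x|cell. V' x $ i * \<phi> x)"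
      using is_weak_gradientD(3)[OF wg \<phi>, of i] unfolding 1 2 .
  qed (use u' V' in auto)
  then show ?thesis using that u'(3) V'(3) by blast
qed

text \<open>The choice in \<open>weak_gradient\<close> does not ask for membership in
  \<open>Lr r\<close>; finiteness is inherited from the witness in \<open>W1r\<close> by uniqueness
  almost everywhere.\<close>

lemma Lr_norm_weak_gradient_finite:
  assumes r: "0 < r" and u: "u \<in> W1r r" shows "Lr_norm r (weak_gradient u) < \<infinity>"
proof -
  obtain V where V: "is_weak_gradient u V" "V \<in> Lr r" using u by (auto simp: W1r_def)
  have "AE x in cell. ennreal (norm (weak_gradient u x)) = ennreal (norm (V x))"
    using AE_lborel_cell[OF weak_gradient_unique[OF weak_gradient_is[OF u] V(1)]] by (rule eventually_mono) simp
  then have "Lr_norm r (weak_gradient u) = Lr_norm r V"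
    unfolding Lr_norm_def by (rule eLr_norm_cong_AE[OF r])
  then show ?thesis using V(2) by (simp add: Lr_def)
qed

lemma norm_unit_cell_le: "z \<in> unit_cell \<Longrightarrow> norm (z :: real ^ 'd::finite) \<le> real CARD('d)"
proof -
  assume z: "z \<in> unit_cell"
  have "norm z \<le> (\<Sum>i\<in>UNIV. \<bar>z $ i\<bar>)" by (rule norm_le_l1_cart)
  also have "\<dots> \<le> (\<Sum>i\<in>(UNIV :: 'd set). 1)"
    using z by (intro sum_mono) (auto simp: unit_cell_def less_imp_le)
  finally show ?thesis by simp
qed

text \<open>Every ball of radius \<open>R\<close> contains a full period cell.\<close>

lemma max_fn_zero:
  fixes F :: "real ^ 'd::finite \<Rightarrow> ennreal"
  assumes F [measurable]: "F \<in> borel_measurable borel" and per: "periodic F" and R: "real CARD('d) < R"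
    and zero: "max_fn R F x = 0"
  shows "max_fn R F y = 0"
proof -
  have R0: "0 < R" using R by (smt (verit) of_nat_0_le_iff)
  have "ball_avg (R / 2 ^ 0) F x = 0" using ball_avg_le_max_fn[of R 0 F x] zero by simp
  then have z: "(\<integral>\<^sup>+z. F z * indicator (ball x R) z \<partial>lborel) = 0"
    using nn_integral_ball_eq[OF R0, of F x] by simp
  have "(\<integral>\<^sup>+z. F z \<partial>cell) = (\<integral>\<^sup>+z. F (z + x) * indicator unit_cell z \<partial>lborel)"
    using nn_integral_cell_translate[OF F per, of x] by (simp add: nn_integral_cell)
  also have "\<dots> \<le> (\<integral>\<^sup>+z. F (x + z) * indicator (ball 0 R) z \<partial>lborel)"
  proof (rule nn_integral_mono)
    fix z :: "real ^ 'd"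
    show "F (z + x) * indicator unit_cell z \<le> F (x + z) * indicator (ball 0 R) z"
      using norm_unit_cell_le[of z] R by (auto simp: indicator_def add.commute)
  qed
  also have "\<dots> = 0" using z nn_integral_ball_translate[OF F, of x R] by simp
  finally have cz: "(\<integral>\<^sup>+z. F z \<partial>cell) = 0" by simp
  have "ball_avg q F y = 0" for q
  proof -
    obtain n :: nat where n: "\<And>F :: real ^ 'd \<Rightarrow> ennreal. F \<in> borel_measurable borel \<Longrightarrow> periodic F \<Longrightarrow>
       (\<integral>\<^sup>+z. F z * indicator (ball y q) z \<partial>lborel) \<le> of_nat n * (\<integral>\<^sup>+x. F x \<partial>cell)"
      by (rule nn_integral_bounded_le_cell[OF bounded_ball[of y q]]) (rule that)
    show ?thesis using n[OF F per] cz by (simp add: ball_avg_def)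
  qed
  then show ?thesis by (simp add: max_fn_def)
qed

context borel_sobolev
begin

text \<open>With \<open>R = 2 * real CARD('d)\<close>, half of \<open>R\<close> bounds the norm of
  every point of the cell, and \<open>R\<close> itself is large enough for
  \<open>max_fn_zero\<close>. The constant can be absorbed into \<open>g\<close> because the
  right-hand side is homogeneous of degree one in \<open>g\<close>; its factor
  \<open>8 * 8 ^ CARD('d)\<close> is \<open>4 * osc_const\<close>.\<close>

lemma rep_lusin_lipschitz:
  assumes p: "1 \<le> p" and \<alpha>: "0 < \<alpha>" "\<alpha> < 1" "\<alpha> * real CARD('d) < p"
    and R: "R = 2 * real CARD('d)" and \<theta>: "\<theta> = 2 powr (\<alpha> * real CARD('d) / p - 1)"
    and c: "c = 8 * 8 ^ CARD('d) * (2 + \<theta> / (1 - \<theta>))"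
  shows "lusin_lipschitz \<alpha> (rep R) (\<lambda>x. ennreal c * max_p p R grad x) UNIV"
  unfolding lusin_lipschitz_def
proof (intro ballI)
  fix x y :: "real ^ 'd"
  have R0: "0 < R" "real CARD('d) < R" by (auto simp: R)
  have c_eq: "c = 4 * osc_const * (2 + \<theta> / (1 - \<theta>))" by (simp add: c osc_const_def)
  have c0: "0 < c"
  proof -
    have "\<alpha> * real CARD('d) / p - 1 < 0" using \<alpha>(3) p by simp
    then have "2 powr (\<alpha> * real CARD('d) / p - 1) < 2 powr (0 :: real)" by (intro powr_less_mono) auto
    then have "0 \<le> \<theta> / (1 - \<theta>)" by (simp add: \<theta>)
    then show ?thesis by (simp add: c)
  qed
  let ?M = "max_p p R grad"
  let ?g = "\<lambda>x. ennreal c * ?M x"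
  have Mper: "periodic ?M" by (rule max_p_periodic[OF grad_meas grad_per R0(1)])
  show "ennreal \<bar>rep R x - rep R y\<bar> \<le> ennreal (norm (x - y)) * (?g x + epow (?g x) \<alpha> * epow (?g y) (1 - \<alpha>))"
  proof (cases "x = y")
    case False
    then have nz: "ennreal (norm (x - y)) \<noteq> 0" by (simp add: ennreal_eq_0_iff)
    have cnz: "ennreal c \<noteq> 0" using c0 by (simp add: ennreal_eq_0_iff)
    consider "?M x = top" | "?M x \<noteq> top" "?M y = top" | "?M x \<noteq> top" "?M y \<noteq> top" by blast
    then show ?thesis
    proof cases
      case 1
      then have "ennreal (norm (x - y)) * (?g x + epow (?g x) \<alpha> * epow (?g y) (1 - \<alpha>)) = top"
        using nz cnz by (simp add: ennreal_mult_top)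
      then show ?thesis by simp
    next
      case 2
      \<comment> \<open>Here \<open>?g y\<close> is infinite but \<open>?g x\<close> is not. As 0
        times infinity is 0 in \<open>ennreal\<close>, \<open>?M x = 0\<close> must be excluded: by
        \<open>max_fn_zero\<close> it would make \<open>?M y\<close> vanish as well.\<close>
      have "?M x \<noteq> 0"
      proof
        assume "?M x = 0"
        then have "max_fn R (\<lambda>y. epow (grad y) p) x = 0" by (simp add: max_p_def epow_eq_0)
        then have "max_fn R (\<lambda>y. epow (grad y) p) y = 0"
          by (rule max_fn_zero[OF _ periodic_comp[OF grad_per] R0(2), rotated]) measurable
        then show False using 2(2) by (simp add: max_p_def)
      qed
      then have "epow (?g x) \<alpha> \<noteq> 0" using cnz by (simp add: epow_eq_0)
      then have "ennreal (norm (x - y)) * (?g x + epow (?g x) \<alpha> * epow (?g y) (1 - \<alpha>)) = top"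
        using nz cnz 2(2) by (simp add: ennreal_mult_top)
      then show ?thesis by simp
    next
      case 3
      then obtain X Y where X: "?M x = ennreal X" "0 \<le> X" and Y: "?M y = ennreal Y" "0 \<le> Y"
        by (cases "?M x"; cases "?M y") auto
      \<comment> \<open>If \<open>y\<close> is far from \<open>x\<close>, it is replaced by the
        integer translate for which \<open>x - (y + k)\<close> lies in the unit cell. Periodicity
        preserves the values of \<open>rep R\<close> and \<open>?M\<close>, and the distance does
        not increase.\<close>
      obtain k where k: "k \<in> int_vecs" "dist x (y + k) \<le> R / 2" "dist x (y + k) \<le> dist x y"
      proof (cases "dist x y \<le> R / 2")
        case True
        then show ?thesis using that[of 0] by (simp add: int_vecs_def)
      next
        case False
        let ?k = "(x - y) - frac_vec (x - y)"
        have "dist x (y + ?k) = norm (frac_vec (x - y))" by (simp add: dist_norm)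
        also have "\<dots> \<le> R / 2" using norm_unit_cell_le[OF frac_vec_in_unit_cell, of "x - y"] by (simp add: R)
        finally show ?thesis using False that[of ?k] diff_frac_vec_in_int_vecs by auto
      qed
      define z where "z = y + k"
      have z: "rep R z = rep R y" "?M z = ennreal Y"
        using periodicD[OF rep_periodic[OF R0(1)] k(1), of y] periodicD[OF Mper k(1), of y] Y(1) by (simp_all add: z_def)
      define W where "W = X + X powr \<alpha> * Y powr (1 - \<alpha>)"
      have W: "0 \<le> W" using X Y by (simp add: W_def)
      have "\<bar>rep R x - rep R y\<bar> \<le> c * dist x z * W"
      proof (cases "x = z")
        case False
        show ?thesis
          using rep_pointwise[OF R0(1) p \<alpha> X z(2) Y(2) False _ \<theta>] k(2)
          unfolding z(1) c_eq W_def by (simp add: z_def)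
      qed (simp add: z)
      also have "\<dots> \<le> c * norm (x - y) * W"
        using c0 W k(3) by (intro mult_right_mono mult_left_mono) (auto simp: dist_norm z_def)
      finally have "ennreal \<bar>rep R x - rep R y\<bar> \<le> ennreal (norm (x - y) * (c * W))"
        by (intro ennreal_leI) (simp add: mult_ac)
      \<comment> \<open>The exponents \<open>\<alpha>\<close> and \<open>1 - \<alpha>\<close> add up
        to 1, so \<open>c\<close> passes into both terms.\<close>
      also have "c * W = c * X + (c * X) powr \<alpha> * (c * Y) powr (1 - \<alpha>)"
      proof -
        have "c powr \<alpha> * c powr (1 - \<alpha>) = c" using c0 by (simp add: powr_add[symmetric])
        then have "(c * X) powr \<alpha> * (c * Y) powr (1 - \<alpha>) = c * (X powr \<alpha> * Y powr (1 - \<alpha>))"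
          using c0 X Y by (simp add: powr_mult)
        then show ?thesis by (simp add: W_def distrib_left)
      qed
      also have "ennreal (norm (x - y) * (c * X + (c * X) powr \<alpha> * (c * Y) powr (1 - \<alpha>)))
        = ennreal (norm (x - y)) * (?g x + epow (?g x) \<alpha> * epow (?g y) (1 - \<alpha>))"
        using c0 X Y by (simp add: ennreal_mult[symmetric] ennreal_plus[symmetric] epow_ennreal del: ennreal_plus)
      finally show ?thesis .
    qed
  qed simp
qed

end

theorem proposition1p7:
  fixes r \<alpha> :: real
  assumes "1 < r" and "r \<le> real CARD('d::finite)"
    and "0 < \<alpha>" and "\<alpha> < r / real CARD('d)"
  shows "\<exists>C\<ge>0. \<exists>G :: (real ^ 'd \<Rightarrow> real) \<Rightarrow> real ^ 'd \<Rightarrow> ennreal.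
    continuous_W1r_Lr r G \<and>
    (\<forall>u\<in>W1r r.
       G u \<in> eLr r \<and>
       eLr_norm r (G u) \<le> ennreal C * Lr_norm r (weak_gradient u) \<and>
       (\<exists>N. negligible N \<and> periodic (\<lambda>x. x \<in> N) \<and> lusin_lipschitz \<alpha> u (G u) (- N)) \<and>
       (\<exists>v. periodic v \<and> (AE x in lebesgue. v x = u x) \<and> lusin_lipschitz \<alpha> v (G u) UNIV))"
proof -
  let ?d = "real CARD('d)"
  have d: "0 < ?d" by simp
  have r: "0 < r" "1 \<le> r" using assms(1) by auto
  have \<alpha>d: "\<alpha> * ?d < r" using assms(4) d by (simp add: field_simps)
  \<comment> \<open>The hypothesis \<open>r \<le> real CARD('d)\<close> makes
    \<open>\<alpha>\<close> less than 1, so both exponents in the product are positive.\<close>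
  have "\<alpha> < r / ?d" "r / ?d \<le> 1" using assms(2,4) d by (auto simp: field_simps)
  then have \<alpha>: "0 < \<alpha>" "\<alpha> < 1" using assms(3) by linarith+
  \<comment> \<open>The midpoint between the lower bounds 1 and \<open>\<alpha> * ?d\<close> and the
    upper bound \<open>r\<close>.\<close>
  define p where "p = (max 1 (\<alpha> * ?d) + r) / 2"
  have p: "1 \<le> p" "\<alpha> * ?d < p" "p < r" using assms(1) \<alpha>d by (auto simp: p_def max_def)
  define R where "R = 2 * ?d"
  have R: "0 < R" by (simp add: R_def)
  define \<theta> where "\<theta> = 2 powr (\<alpha> * ?d / p - 1)"
  define c where "c = 8 * 8 ^ CARD('d) * (2 + \<theta> / (1 - \<theta>))"
  have c: "0 \<le> c"
  proof -
    have "\<alpha> * ?d / p - 1 < 0" using p by simp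
    then have "2 powr (\<alpha> * ?d / p - 1) < 2 powr (0 :: real)" by (intro powr_less_mono) auto
    then have "0 \<le> \<theta> / (1 - \<theta>)" by (simp add: \<theta>_def)
    then show ?thesis by (simp add: c_def)
  qed
  \<comment> \<open>\<open>C\<close> is fixed before any function \<open>u\<close> is considered,
    and \<open>p\<close>, \<open>R\<close> and \<open>c\<close> are determined by
    \<open>\<alpha>\<close>, \<open>r\<close> and the dimension.\<close>
  obtain C where C: "0 \<le> C" "\<And>F :: real ^ 'd \<Rightarrow> ennreal. F \<in> borel_measurable borel \<Longrightarrow> periodic F \<Longrightarrow>
    eLr_norm r (\<lambda>x. ennreal c * max_p p R F x) \<le> ennreal C * eLr_norm r F"
    by (rule eLr_norm_max_p[OF R p(1,3) c]) (rule that)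
  define A :: "(real ^ 'd \<Rightarrow> real ^ 'd) \<Rightarrow> real ^ 'd \<Rightarrow> ennreal"
    where "A V x = ennreal c * max_p p R (\<lambda>y. ennreal (norm (V y))) x" for V x
  \<comment> \<open>Ball averages ignore null sets, so gradients equal almost everywhere give the
    same function at every point. Hence \<open>G u\<close> is exactly periodic and Borel although
    \<open>weak_gradient u\<close> is an arbitrary choice.\<close>
  have A_cong: "A V = A V'" if "AE x in lborel. V x = V' x" for V V'
  proof -
    have "AE y in lborel. ennreal (norm (V y)) = ennreal (norm (V' y))" using that by (rule eventually_mono) simp
    from max_p_cong_AE[OF this] show ?thesis by (simp add: A_def fun_eq_iff)
  qed
  have A_meas: "A V \<in> borel_measurable borel" if [measurable]: "V \<in> borel_measurable borel" for V
  proof -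
    have [measurable]: "max_p p R (\<lambda>y. ennreal (norm (V y))) \<in> borel_measurable borel"
      by (rule max_p_meas[OF _ R]) measurable
    show ?thesis unfolding A_def [abs_def] by measurable
  qed
  have A_per: "periodic (A V)" if [measurable]: "V \<in> borel_measurable borel" and per: "periodic V" for V
  proof -
    have "periodic (max_p p R (\<lambda>y. ennreal (norm (V y))))"
      by (rule max_p_periodic[OF _ periodic_comp[OF per] R]) measurable
    then show ?thesis unfolding A_def [abs_def] by (rule periodic_comp)
  qed
  have A_norm: "eLr_norm r (A V) \<le> ennreal C * Lr_norm r V" if [measurable]: "V \<in> borel_measurable borel" and per: "periodic V" for V
    unfolding A_def [abs_def] Lr_norm_def by (rule C(2)[OF _ periodic_comp[OF per]]) measurable
  \<comment> \<open>This subadditivity bounds \<open>A V\<close> and \<open>A W\<close> by each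
    other up to \<open>A\<close> of the difference of the gradients, so the selection is Lipschitz
    with constant \<open>C\<close>.\<close>
  have A_triangle: "A V x \<le> A W x + A (\<lambda>y. V y - W y) x"
    if [measurable]: "V \<in> borel_measurable borel" "W \<in> borel_measurable borel" for V W x
  proof -
    have "max_p p R (\<lambda>y. ennreal (norm (V y))) x \<le> max_p p R (\<lambda>y. ennreal (norm (W y))) x + max_p p R (\<lambda>y. ennreal (norm (V y - W y))) x"
    proof (rule max_p_triangle[OF p(1)])
      fix y
      have "norm (V y) \<le> norm (W y) + norm (V y - W y)" using norm_triangle_ineq[of "W y" "V y - W y"] by simp
      then show "ennreal (norm (V y)) \<le> ennreal (norm (W y)) + ennreal (norm (V y - W y))"
        by (simp add: ennreal_plus[symmetric] ennreal_leI del: ennreal_plus)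
    qed measurable
    then show ?thesis unfolding A_def by (simp add: distrib_left[symmetric] mult_left_mono)
  qed
  define G where "G u = A (weak_gradient u)" for u
  have Lr_norm_cong: "Lr_norm r V = Lr_norm r V'" if "AE x in lborel. V x = V' x" for V V' :: "real ^ 'd \<Rightarrow> real ^ 'd"
  proof -
    have "AE x in cell. ennreal (norm (V x)) = ennreal (norm (V' x))"
      using AE_lborel_cell[OF that] by (rule eventually_mono) simp
    then show ?thesis unfolding Lr_norm_def by (rule eLr_norm_cong_AE[OF r(1)])
  qed
  have main: "G u \<in> eLr r \<and> eLr_norm r (G u) \<le> ennreal C * Lr_norm r (weak_gradient u) \<and>
       (\<exists>N. negligible N \<and> periodic (\<lambda>x. x \<in> N) \<and> lusin_lipschitz \<alpha> u (G u) (- N)) \<and>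
       (\<exists>v. periodic v \<and> (AE x in lebesgue. v x = u x) \<and> lusin_lipschitz \<alpha> v (G u) UNIV)"
    if u: "u \<in> W1r r" for u
  proof -
    obtain u' V' where bs: "borel_sobolev u' V'" and ae: "AE x in lborel. u x = u' x" "AE x in lborel. weak_gradient u x = V' x"
      by (rule W1r_borel_version[OF r(2) u]) (rule that)
    interpret borel_sobolev u' V' by (rule bs)
    have G: "G u = A V'" unfolding G_def by (rule A_cong[OF ae(2)])
    have norm: "eLr_norm r (G u) \<le> ennreal C * Lr_norm r (weak_gradient u)"
      unfolding G Lr_norm_cong[OF ae(2)] by (rule A_norm[OF V_meas V_per])
    also have "\<dots> < \<infinity>"
      using Lr_norm_weak_gradient_finite[OF r(1) u] by (simp add: ennreal_mult_less_top)
    finally have Gin: "G u \<in> eLr r"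
      using A_per[OF V_meas V_per] A_meas[OF V_meas] by (simp add: eLr_def G measurable_torus)
    have lus: "lusin_lipschitz \<alpha> (rep R) (G u) UNIV"
      using rep_lusin_lipschitz[OF p(1) \<alpha> p(2) R_def \<theta>_def c_def]
      unfolding G A_def [abs_def] grad_def [abs_def] .
    have rep_u: "AE x in lborel. rep R x = u x"
      using AE_rep[OF R] ae(1) by eventually_elim simp
    have uper: "periodic u" using u by (simp add: W1r_def Lr_def)
    \<comment> \<open>The exceptional set for the given representative is where it differs from
      \<open>rep R\<close>; it is null and periodic, and outside it the inequality for
      \<open>rep R\<close> is the one for \<open>u\<close>.\<close>
    define N where "N = {x. rep R x \<noteq> u x}"
    have "negligible N"
    proof -
      obtain S where S: "{x \<in> space lborel. \<not> rep R x = u x} \<subseteq> S" "emeasure lborel S = 0" "S \<in> sets lborel"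
        using rep_u by (rule AE_E)
      have "negligible S" using S(2,3) by (simp add: negligible_iff_null_sets null_sets_completionI null_setsI)
      then show ?thesis by (rule negligible_subset) (use S(1) in \<open>simp add: N_def\<close>)
    qed
    moreover have "periodic (\<lambda>x. x \<in> N)"
      using periodic_comp2[OF rep_periodic[OF R] uper, of "\<lambda>a b. a \<noteq> b"] by (simp add: N_def)
    moreover have "lusin_lipschitz \<alpha> u (G u) (- N)"
      unfolding lusin_lipschitz_def
    proof (intro ballI)
      fix x y assume "x \<in> - N" "y \<in> - N"
      then have "u x = rep R x" "u y = rep R y" by (simp_all add: N_def)
      then show "ennreal \<bar>u x - u y\<bar> \<le> ennreal (norm (x - y)) * (G u x + epow (G u x) \<alpha> * epow (G u y) (1 - \<alpha>))"
        using lus by (simp add: lusin_lipschitz_def)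
    qed
    moreover have "AE x in lebesgue. rep R x = u x" using rep_u by (simp only: AE_completion_iff)
    ultimately show ?thesis using norm Gin lus rep_periodic[OF R] by blast
  qed
  have cont: "continuous_W1r_Lr r G"
    unfolding continuous_W1r_Lr_def
  proof (intro conjI ballI allI impI)
    show "G \<in> W1r r \<rightarrow> eLr r" using main by blast
    fix u :: "real ^ 'd \<Rightarrow> real" and \<epsilon> :: real assume u: "u \<in> W1r r" and \<epsilon>: "0 < \<epsilon>"
    \<comment> \<open>The added 1 avoids division by zero and makes
      \<open>C * \<delta> < \<epsilon>\<close> strict.\<close>
    define \<delta> where "\<delta> = \<epsilon> / (C + 1)"
    have \<delta>: "0 < \<delta>" "C * \<delta> < \<epsilon>" using \<epsilon> C(1) by (auto simp: \<delta>_def field_simps)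
    show "\<exists>\<delta>>0. \<forall>v\<in>W1r r. W1r_norm r (\<lambda>x. v x - u x) < ennreal \<delta> \<longrightarrow>
        Lr_norm r (\<lambda>x. enn2real (G v x) - enn2real (G u x)) < ennreal \<epsilon>"
    proof (intro exI[of _ \<delta>] conjI ballI impI \<delta>(1))
      fix v assume v: "v \<in> W1r r" and small: "W1r_norm r (\<lambda>x. v x - u x) < ennreal \<delta>"
      obtain u' U where bu: "borel_sobolev u' U" and ae_u: "AE x in lborel. weak_gradient u x = U x"
        by (rule W1r_borel_version[OF r(2) u]) (rule that)
      obtain v' V where bv: "borel_sobolev v' V" and ae_v: "AE x in lborel. weak_gradient v x = V x"
        by (rule W1r_borel_version[OF r(2) v]) (rule that)
      note mU [measurable] = borel_sobolev.V_meas[OF bu] and mV [measurable] = borel_sobolev.V_meas[OF bv]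
      note pU = borel_sobolev.V_per[OF bu] and pV = borel_sobolev.V_per[OF bv]
      have Gu: "G u = A U" and Gv: "G v = A V" unfolding G_def by (rule A_cong[OF ae_u], rule A_cong[OF ae_v])
      let ?D = "\<lambda>x. V x - U x"
      have wd: "is_weak_gradient (\<lambda>x. v x - u x) (\<lambda>x. weak_gradient v x - weak_gradient u x)"
        using u v by (intro is_weak_gradient_diff weak_gradient_is Lr_integrable[OF r(2)]) (auto simp: W1r_def)
      \<comment> \<open>The choice in \<open>weak_gradient\<close> is not linear by construction;
        uniqueness identifies the chosen gradient of \<open>v - u\<close> almost everywhere with the
        difference of the chosen gradients.\<close>
      then have "is_weak_gradient (\<lambda>x. v x - u x) (weak_gradient (\<lambda>x. v x - u x))"
        unfolding weak_gradient_def[of "\<lambda>x. v x - u x"]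
        by (rule someI[where P="is_weak_gradient (\<lambda>x. v x - u x)"])
      from weak_gradient_unique[OF this wd] ae_u ae_v
      have ae_d: "AE x in lborel. weak_gradient (\<lambda>x. v x - u x) x = ?D x" by eventually_elim simp
      \<comment> \<open>\<open>enn2real\<close> sends infinity to 0, so a bound on the difference of
        the real values is available only where both functions are finite.\<close>
      have fin: "AE x in cell. G w x \<noteq> \<infinity>" if w: "w \<in> W1r r" and m: "G w \<in> borel_measurable borel" for w
      proof -
        note [measurable] = m
        have "eLr_norm r (G w) < \<infinity>" using main[OF w] by (simp add: eLr_def)
        then have "(\<integral>\<^sup>+x. epow (G w x) r \<partial>cell) \<noteq> \<infinity>" by (simp add: eLr_norm_cell epow_less_top)
        then have "AE x in cell. epow (G w x) r \<noteq> \<infinity>"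
          by (intro nn_integral_PInf_AE) (intro measurable_cell, measurable)
        then show ?thesis by (rule eventually_mono) auto
      qed
      have "AE x in cell. ennreal (norm (enn2real (G v x) - enn2real (G u x))) \<le> A ?D x"
      proof -
        have fu: "AE x in cell. A U x \<noteq> \<infinity>" using fin[OF u] A_meas[OF mU] unfolding Gu .
        have fv: "AE x in cell. A V x \<noteq> \<infinity>" using fin[OF v] A_meas[OF mV] unfolding Gv .
        show ?thesis
          unfolding Gu Gv using fu fv
        proof eventually_elim
          case (elim x)
          have "A (\<lambda>y. U y - V y) x = A ?D x" unfolding A_def by (simp add: norm_minus_commute)
          then have t: "A V x \<le> A U x + A ?D x" "A U x \<le> A V x + A ?D x"
            using A_triangle[OF mV mU, of x] A_triangle[OF mU mV, of x] by simp_all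
          show ?case
          proof (cases "A ?D x")
            case (real e)
            obtain a b where ab: "A U x = ennreal a" "0 \<le> a" "A V x = ennreal b" "0 \<le> b"
              using elim by (cases "A U x"; cases "A V x") auto
            have "b \<le> a + e" "a \<le> b + e"
              using t ab real by (simp_all add: ennreal_plus[symmetric] del: ennreal_plus)
            then have "\<bar>b - a\<bar> \<le> e" by linarith
            then show ?thesis using ab real by (simp add: ennreal_leI)
          qed simp
        qed
      qed
      then have "Lr_norm r (\<lambda>x. enn2real (G v x) - enn2real (G u x)) \<le> eLr_norm r (A ?D)"
        unfolding Lr_norm_def by (rule eLr_norm_mono_AE[OF r(1)])
      also have "\<dots> \<le> ennreal C * Lr_norm r ?D"
        by (rule A_norm) (measurable, rule periodic_comp2[OF pV pU])
      also have "Lr_norm r ?D = Lr_norm r (weak_gradient (\<lambda>x. v x - u x))"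
        by (rule Lr_norm_cong[OF ae_d, symmetric])
      also have "ennreal C * \<dots> \<le> ennreal C * ennreal \<delta>"
      proof (rule mult_left_mono)
        have "Lr_norm r (weak_gradient (\<lambda>x. v x - u x)) \<le> W1r_norm r (\<lambda>x. v x - u x)" by (simp add: W1r_norm_def)
        then show "Lr_norm r (weak_gradient (\<lambda>x. v x - u x)) \<le> ennreal \<delta>" using small by simp
      qed simp
      also have "\<dots> < ennreal \<epsilon>" using \<delta> C(1) \<epsilon> by (simp add: ennreal_mult[symmetric] ennreal_less_iff)
      finally show "Lr_norm r (\<lambda>x. enn2real (G v x) - enn2real (G u x)) < ennreal \<epsilon>" .
    qed
  qed
  show ?thesis using C(1) cont main by blast
qed

end
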